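(* Let $n\ge3$ and $m\in\mathbb{N}$. There exists a constant $C_n>0$ depending only on $n$ such that for all $R>0$ and all $u\in C_c^\infty(B_R^+)$, $$\int_{B_R^+}|\nabla u|^2dx\ \ge\ \frac{n^2}{4}\int_{B_R^+}\frac{u^2}{|x|^2}dx+\frac14\sum_{i=1}^m\int_{B_R^+}\frac{u^2}{|x|^2}X_1^2\cdots X_i^2dx+\frac{1}{16R^{1/2}}\int_{B_R^+}\frac{u^2}{|x|^{3/2}}dx+C_n\Big(\int_{B_R^+}(X_1\cdots X_{m+1})^{\frac{2n-2}{n-2}}|u|^{\frac{2n}{n-2}}dx\Big)^{\frac{n-2}{n}},$$ where $X_i=X_i(|x|/(\kappa R))$.
   Context: $B_R^+=\{x\in\mathbb{R}^n:\ |x|<R,\ x_n>0\}$. Iterated logarithms: $X_1(t)=\frac{1}{1-\ln t}$, $X_{k+1}(t)=X_k(X_1(t))$ for $t\in(0,1]$. The series $\sum_{i\ge1}X_1(t)\cdots X_i(t)$ converges for $t\in(0,1)$ and is strictly increasing in $t$; $\kappa>1$ is the unique number with $\sum_{i=1}^\infty X_1(1/\kappa)\cdots X_i(1/\kappa)=\frac14$. The constant $C_n$ depends on $n$ only (in particular not on $m$ or $R$). *)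

theory Defs
  imports "HOL-Analysis.Analysis"
begin

(* The recursion starts at index 0 with the identity, so that X 1 t = 1 / (1 - ln t)
   and X (k + 1) t = X k (X 1 t).  Relevant arguments are 0 < t <= 1. *)
primrec X :: "nat \<Rightarrow> real \<Rightarrow> real" where
  "X 0 t = t"
| "X (Suc k) t = X k (1 / (1 - ln t))"

definition kappa :: real where
  "kappa = (THE c. c > 1 \<and> (\<lambda>i. \<Prod>j=1..Suc i. X j (1 / c)) sums (1 / 4))"

(* The index type carries no order; the coordinate k plays the role of the last one. *)
definition half_ball :: "'n::finite \<Rightarrow> real \<Rightarrow> (real ^ 'n) set" where
  "half_ball k R = {x. norm x < R \<and> x $ k > 0}"

definition partial_deriv :: "'n::finite \<Rightarrow> (real ^ 'n \<Rightarrow> real) \<Rightarrow> real ^ 'n \<Rightarrow> real" where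
  "partial_deriv i f x = frechet_derivative f (at x) (axis i 1)"

definition gradient :: "(real ^ 'n::finite \<Rightarrow> real) \<Rightarrow> real ^ 'n \<Rightarrow> real ^ 'n" where
  "gradient f x = (\<chi> i. partial_deriv i f x)"

primrec C_k :: "nat \<Rightarrow> (real ^ 'n::finite \<Rightarrow> real) \<Rightarrow> bool" where
  "C_k 0 f \<longleftrightarrow> continuous_on UNIV f"
| "C_k (Suc r) f \<longleftrightarrow> (\<forall>x. f differentiable (at x)) \<and> (\<forall>i. C_k r (partial_deriv i f))"

(* Functions on an open set S are identified with their extension by zero to the whole space. *)
definition test_functions :: "(real ^ 'n::finite) set \<Rightarrow> (real ^ 'n \<Rightarrow> real) set" where
  "test_functions S =
     {u. (\<forall>r. C_k r u) \<and> compact (closure {x. u x \<noteq> 0}) \<and> closure {x. u x \<noteq> 0} \<subseteq> S}"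

end

theory Submission
  imports Defs
begin

text \<open>
  Let \<open>T\<close> be a vector field on the half ball.  Expanding \<open>|\<nabla>U - U T|\<^sup>2\<close> and integrating the divergence of
  \<open>U\<^sup>2 T\<close> to zero gives
  \<open>\<integral>|\<nabla>U|\<^sup>2 = \<integral>|\<nabla>U - U T|\<^sup>2 + \<integral>U\<^sup>2 (- div T - |T|\<^sup>2)\<close> (\<open>hardy_identity\<close>).  For \<open>T = \<nabla>\<phi> / \<phi>\<close> the
  potential is \<open>- \<Delta>\<phi> / \<phi>\<close>.  Take
  \<open>\<phi>(x) = x\<^sub>k |x| powr (-n/2) (X\<^sub>1 ... X\<^sub>m) powr (-1/2) (2 - sqrt(|x|/R))\<close>.
  The factor \<open>x\<^sub>k |x| powr (-n/2)\<close> produces \<open>n\<^sup>2/4\<close>, the logarithms produce \<open>1/4\<close> times the sum of the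
  \<open>(X\<^sub>1 ... X\<^sub>i)\<^sup>2\<close>, and the last factor produces the term with \<open>|x| powr (-3/2)\<close>.  The interaction of the
  last two is harmless because \<open>kappa\<close> is chosen such that the sum of the products \<open>X\<^sub>1 ... X\<^sub>i\<close> never
  exceeds \<open>1/4\<close>.  This is \<open>improved_hardy\<close>; the square \<open>\<integral>|\<nabla>u - u T|\<^sup>2\<close> is left over and has to pay for the
  Sobolev term.

  Since \<open>1 \<le> 2 - sqrt(|x|/R) \<le> 2\<close>, passing to \<open>v = u / (2 - sqrt(|x|/R))\<close> replaces \<open>T\<close> by the field \<open>T\<^sub>0\<close>
  without that factor and costs only a factor \<open>4\<close> (\<open>ground_state_substitution\<close>).  So a bound for the
  deficit \<open>D = \<integral>|\<nabla>v - v T\<^sub>0|\<^sup>2\<close> is needed.  Write \<open>Y = X\<^sub>1 ... X\<^sub>m\<^sub>+\<^sub>1\<close>.  Comparing \<open>T\<^sub>0\<close> with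
  \<open>T\<^sub>0 - Y \<theta> x / |x|\<^sup>2\<close> for a radial function \<open>\<theta>\<close> shows
  \<open>\<integral>v\<^sup>2 |x| powr (-2) (Y |x| \<theta>' + Y\<^sup>2 \<theta> (1 - \<theta>)) \<le> D\<close> (\<open>deficit_lower_bound\<close>).
  The constant \<open>\<theta> = 1/2\<close> gives \<open>\<integral>v\<^sup>2 Y\<^sup>2 / |x|\<^sup>2 \<le> 4 D\<close>.  The increasing \<open>\<theta> = r\<^sup>2 / (r\<^sup>2 + \<rho>\<^sup>2)\<close> gives
  \<open>\<integral>v\<^sup>2 Y / |x|\<^sup>2 \<le> 10 D\<close> over the shell where \<open>|x|\<close> is comparable to \<open>\<rho>\<close>.  No constant here depends on \<open>m\<close>;
  this is why \<open>C\<close> depends on \<open>n\<close> only.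

  On one such shell, a cutoff and the Sobolev inequality of the whole space bound the integral of
  \<open>|v| powr (2n/(n-2))\<close> by a constant times \<open>(e + H) powr (n/(n-2))\<close>, where \<open>e\<close> is the part of \<open>D\<close> on the
  shell and \<open>H = \<integral>v\<^sup>2 / |x|\<^sup>2\<close> (\<open>shell_sobolev\<close>).  As \<open>Y\<close> varies by at most a factor \<open>2\<close> on the relevant range,
  and as \<open>(2n-2)/(n-2) = 2 + 2/(n-2)\<close>, the integral with weight \<open>Y powr ((2n-2)/(n-2))\<close> over the shell is at
  most a constant times \<open>Y\<^sup>2 (e + H) (Y (e + H)) powr (2/(n-2))\<close>.  By the two bounds above and \<open>Y \<le> 1\<close>, the
  product \<open>Y (e + H)\<close> is at most \<open>11 D\<close> on every shell, and the sum of \<open>Y\<^sup>2 (e + H)\<close> over all dyadic shells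
  is at most a multiple of \<open>D\<close>.  Adding up gives \<open>deficit_sobolev\<close>.

  The Sobolev inequality is proved in the classical way: Gagliardo's inequality for gradients in \<open>L\<^sup>1\<close>,
  obtained by integrating out one coordinate after the other with Hoelder's inequality, is applied to a
  power of \<open>|U|\<close>.
\<close>

section \<open>Hoelder's inequality with finitely many factors\<close>

text \<open>
  Convexity of \<open>exp\<close> at the points \<open>ln (x j)\<close>; a vanishing \<open>x j\<close> makes the left side zero.
\<close>

lemma weighted_am_gm:
  fixes x p :: "'i \<Rightarrow> real"
  assumes "finite J" "\<And>j. j \<in> J \<Longrightarrow> 0 \<le> x j" "\<And>j. j \<in> J \<Longrightarrow> 0 < p j" "sum p J = 1"
  shows "(\<Prod>j\<in>J. x j powr p j) \<le> (\<Sum>j\<in>J. p j * x j)"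
proof (cases "\<exists>j\<in>J. x j = 0")
  case True
  then have "(\<Prod>j\<in>J. x j powr p j) = 0"
    using assms(1) by (auto intro: prod_zero)
  then show ?thesis
    using assms(2,3) by (simp add: sum_nonneg less_imp_le)
next
  case False
  then have pos: "\<And>j. j \<in> J \<Longrightarrow> 0 < x j" using assms(2) by force
  have ne: "J \<noteq> {}" using assms(4) by auto
  have "(\<Prod>j\<in>J. x j powr p j) = exp (\<Sum>j\<in>J. p j *\<^sub>R ln (x j))"
    using pos assms(1) by (simp add: exp_sum powr_def less_imp_neq[symmetric])
  also have "\<dots> \<le> (\<Sum>j\<in>J. p j * exp (ln (x j)))"
    using convex_on_sum[OF assms(1) ne exp_convex assms(4), of "\<lambda>j. ln (x j)"] assms(3)
    by (simp add: less_imp_le)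
  also have "\<dots> = (\<Sum>j\<in>J. p j * x j)" using pos by simp
  finally show ?thesis .
qed

text \<open>
  Real powers on \<open>ennreal\<close>.  The convention that every zeroth power is \<open>1\<close>, also that of \<open>0\<close> and
  of infinity, makes the law of exponents hold without side conditions.  On the reals,
  \<open>0 powr 0 = 0\<close> would break it.
\<close>

definition epow :: "ennreal \<Rightarrow> real \<Rightarrow> ennreal" where
  "epow x a = (if a = 0 then 1 else if x = top then top else ennreal (enn2real x powr a))"

lemma epow_0 [simp]: "epow x 0 = 1" by (simp add: epow_def)
lemma epow_zero [simp]: "a \<noteq> 0 \<Longrightarrow> epow 0 a = 0" by (simp add: epow_def)
lemma epow_top [simp]: "a \<noteq> 0 \<Longrightarrow> epow top a = top" by (simp add: epow_def)
lemma epow_ennreal: "0 \<le> r \<Longrightarrow> a \<noteq> 0 \<Longrightarrow> epow (ennreal r) a = ennreal (r powr a)"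
  by (simp add: epow_def)

lemma epow_eq_0_iff: "epow x a = 0 \<longleftrightarrow> a \<noteq> 0 \<and> x = 0"
  by (cases x) (auto simp: epow_def ennreal_eq_0_iff)

lemma epow_add:
  assumes "0 \<le> a" "0 \<le> b"
  shows "epow x (a + b) = epow x a * epow x b"
proof (cases "a = 0 \<or> b = 0")
  case False
  with assms have "a + b \<noteq> 0" by linarith
  with False show ?thesis
    by (cases x) (auto simp: epow_def powr_add ennreal_mult ennreal_top_mult)
qed auto

lemma epow_mono: "x \<le> y \<Longrightarrow> 0 \<le> a \<Longrightarrow> epow x a \<le> epow y a"
  by (cases x; cases y) (auto simp: epow_def top_unique intro!: ennreal_leI powr_mono2)

lemma epow_measurable [measurable]:
  assumes [measurable]: "f \<in> borel_measurable M"
  shows "(\<lambda>x. epow (f x) a) \<in> borel_measurable M"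
  unfolding epow_def by measurable

text \<open>
  Pointwise form of Hoelder's inequality: the weighted arithmetic-geometric mean inequality for
  the functions normalised by their integrals \<open>G j\<close>.
\<close>

lemma young_ennreal:
  fixes g G :: "'i \<Rightarrow> ennreal"
  assumes J: "finite J" and p: "\<And>j. j \<in> J \<Longrightarrow> 0 < p j" "sum p J = 1"
    and G: "\<And>j. j \<in> J \<Longrightarrow> G j \<noteq> 0" "\<And>j. j \<in> J \<Longrightarrow> G j \<noteq> top"
  shows "(\<Prod>j\<in>J. epow (g j) (p j))
    \<le> (\<Prod>j\<in>J. epow (G j) (p j)) * (\<Sum>j\<in>J. ennreal (p j) * (g j / G j))"
proof (cases "\<exists>j\<in>J. g j = top")
  case True
  then obtain i where i: "i \<in> J" "g i = top" by auto
  have "(\<Sum>j\<in>J. ennreal (p j) * (g j / G j)) \<ge> ennreal (p i) * (g i / G i)"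
    using J i by (intro member_le_sum) auto
  moreover have "ennreal (p i) * (g i / G i) = top"
    using i p(1)[OF i(1)] G(2)[OF i(1)] by (simp add: ennreal_top_divide ennreal_mult_top)
  ultimately have "(\<Sum>j\<in>J. ennreal (p j) * (g j / G j)) = top" by (simp add: top.extremum_unique)
  moreover have "(\<Prod>j\<in>J. epow (G j) (p j)) \<noteq> 0"
    using G(1) J by (auto simp: epow_eq_0_iff)
  ultimately have "(\<Prod>j\<in>J. epow (G j) (p j)) * (\<Sum>j\<in>J. ennreal (p j) * (g j / G j)) = top"
    by (simp only: ennreal_mult_top if_False)
  then show ?thesis by simp
next
  case False
  define h where "h j = enn2real (g j)" for j
  define H where "H j = enn2real (G j)" for j
  have g: "g j = ennreal (h j)" "0 \<le> h j" if "j \<in> J" for j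
    using False that unfolding h_def by (auto simp: ennreal_enn2real_if)
  have H: "G j = ennreal (H j)" "0 < H j" if "j \<in> J" for j
    using G[OF that] unfolding H_def by (auto simp: ennreal_enn2real_if enn2real_positive_iff less_top zero_less_iff_neq_zero)
  have p0: "p j \<noteq> 0" if "j \<in> J" for j using p(1)[OF that] by simp
  have "(\<Prod>j\<in>J. epow (g j) (p j)) = (\<Prod>j\<in>J. ennreal (h j powr p j))"
    using g p0 by (intro prod.cong) (auto simp: epow_ennreal)
  also have "\<dots> = ennreal (\<Prod>j\<in>J. h j powr p j)" by (simp add: prod_ennreal)
  also have "(\<Prod>j\<in>J. h j powr p j) = (\<Prod>j\<in>J. H j powr p j) * (\<Prod>j\<in>J. (h j / H j) powr p j)"
    unfolding prod.distrib[symmetric]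
    by (intro prod.cong refl) (use g H in \<open>force simp: powr_divide\<close>)
  also have "\<dots> \<le> (\<Prod>j\<in>J. H j powr p j) * (\<Sum>j\<in>J. p j * (h j / H j))"
    by (intro mult_left_mono weighted_am_gm J p prod_nonneg) (use g H in \<open>force+\<close>)
  also have "ennreal \<dots> = ennreal (\<Prod>j\<in>J. H j powr p j) * ennreal (\<Sum>j\<in>J. p j * (h j / H j))"
    by (rule ennreal_mult) (auto intro!: prod_nonneg sum_nonneg mult_nonneg_nonneg divide_nonneg_pos simp: g H p(1) less_imp_le)
  also have "ennreal (\<Prod>j\<in>J. H j powr p j) = (\<Prod>j\<in>J. epow (G j) (p j))"
    unfolding prod_ennreal[symmetric, OF powr_ge_zero]
    using H p0 by (intro prod.cong) (auto simp: epow_ennreal less_imp_le)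
  also have "ennreal (\<Sum>j\<in>J. p j * (h j / H j)) = (\<Sum>j\<in>J. ennreal (p j * (h j / H j)))"
    by (rule sum_ennreal[symmetric]) (auto intro!: mult_nonneg_nonneg divide_nonneg_pos simp: g H p(1) less_imp_le)
  also have "\<dots> = (\<Sum>j\<in>J. ennreal (p j) * (g j / G j))"
    by (intro sum.cong refl) (use g H p(1) in \<open>simp add: ennreal_mult divide_ennreal less_imp_le del: times_divide_eq_right\<close>)
  finally show ?thesis by (simp add: ennreal_leI)
qed

text \<open>
  Integrate the pointwise inequality.  If one of the integrals is zero or infinite there is
  nothing to normalise by, and the claim is immediate.
\<close>

lemma hoelder_positive_exponents:
  fixes g :: "'i \<Rightarrow> 'a \<Rightarrow> ennreal"
  assumes J: "finite J" and p: "\<And>j. j \<in> J \<Longrightarrow> 0 < p j" "sum p J = 1"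
    and m [measurable]: "\<And>j. j \<in> J \<Longrightarrow> g j \<in> borel_measurable M"
  shows "(\<integral>\<^sup>+x. (\<Prod>j\<in>J. epow (g j x) (p j)) \<partial>M) \<le> (\<Prod>j\<in>J. epow (\<integral>\<^sup>+x. g j x \<partial>M) (p j))"
proof -
  define G where "G j = (\<integral>\<^sup>+x. g j x \<partial>M)" for j
  have p0: "p j \<noteq> 0" if "j \<in> J" for j using p(1)[OF that] by simp
  \<comment> \<open>In the degenerate cases either the left side vanishes almost everywhere or the right side is infinite.\<close>
  consider "\<exists>j\<in>J. G j = 0" | "\<forall>j\<in>J. G j \<noteq> 0" "\<exists>j\<in>J. G j = top"
    | "\<forall>j\<in>J. G j \<noteq> 0" "\<forall>j\<in>J. G j \<noteq> top" by blast
  then show ?thesis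
  proof cases
    case 1
    then obtain i where i: "i \<in> J" "G i = 0" by auto
    have "AE x in M. g i x = 0"
      using i m[OF i(1)] unfolding G_def by (subst (asm) nn_integral_0_iff_AE) auto
    then have "AE x in M. (\<Prod>j\<in>J. epow (g j x) (p j)) = 0"
      by eventually_elim (use i J p0 in \<open>auto intro!: prod_zero bexI[of _ i]\<close>)
    then have "(\<integral>\<^sup>+x. (\<Prod>j\<in>J. epow (g j x) (p j)) \<partial>M) = (\<integral>\<^sup>+x. 0 \<partial>M)"
      by (rule nn_integral_cong_AE)
    then show ?thesis by simp
  next
    case 2
    then obtain i where i: "i \<in> J" "G i = top" by auto
    have "(\<Prod>j\<in>J. epow (G j) (p j)) = epow (G i) (p i) * (\<Prod>j\<in>J - {i}. epow (G j) (p j))"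
      using J i by (simp add: prod.remove)
    also have "\<dots> = top"
      using i p0 2 J by (auto simp: ennreal_top_mult epow_eq_0_iff)
    finally show ?thesis by (simp add: G_def)
  next
    case 3
    have "(\<integral>\<^sup>+x. (\<Prod>j\<in>J. epow (g j x) (p j)) \<partial>M)
      \<le> (\<integral>\<^sup>+x. (\<Prod>j\<in>J. epow (G j) (p j)) * (\<Sum>j\<in>J. ennreal (p j) * (g j x / G j)) \<partial>M)"
      using 3 by (intro nn_integral_mono young_ennreal J p) auto
    also have "\<dots> = (\<Prod>j\<in>J. epow (G j) (p j)) * (\<Sum>j\<in>J. ennreal (p j) * (G j / G j))"
      by (subst nn_integral_cmult, measurable, subst nn_integral_sum, measurable)
         (simp add: nn_integral_cmult nn_integral_divide G_def cong: sum.cong)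
    also have "(\<Sum>j\<in>J. ennreal (p j) * (G j / G j)) = (\<Sum>j\<in>J. ennreal (p j))"
      using 3 by (intro sum.cong refl) (auto simp: ennreal_divide_self less_top)
    also have "\<dots> = 1" using p by (subst sum_ennreal) (auto simp: less_imp_le)
    finally show ?thesis by (simp add: G_def)
  qed
qed

lemma hoelder:
  fixes g :: "'i \<Rightarrow> 'a \<Rightarrow> ennreal"
  assumes J: "finite J" and p: "\<And>j. j \<in> J \<Longrightarrow> 0 \<le> p j" "sum p J = 1"
    and m [measurable]: "\<And>j. j \<in> J \<Longrightarrow> g j \<in> borel_measurable M"
  shows "(\<integral>\<^sup>+x. (\<Prod>j\<in>J. epow (g j x) (p j)) \<partial>M) \<le> (\<Prod>j\<in>J. epow (\<integral>\<^sup>+x. g j x \<partial>M) (p j))"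
proof -
  define K where "K = {j\<in>J. p j \<noteq> 0}"
  have drop: "(\<Prod>j\<in>J. epow (h j) (p j)) = (\<Prod>j\<in>K. epow (h j) (p j))" for h
    by (rule prod.mono_neutral_right) (use J in \<open>auto simp: K_def\<close>)
  have "sum p J = sum p K"
    by (rule sum.mono_neutral_right) (use J in \<open>auto simp: K_def\<close>)
  then show ?thesis unfolding drop
    by (intro hoelder_positive_exponents) (use J p m in \<open>force simp: K_def\<close>)+
qed

section \<open>The Sobolev inequality in Euclidean space\<close>

text \<open>
  Each factor on the left is the integral of \<open>f\<close> along a line parallel to a coordinate axis.
  Integrate over one coordinate \<open>i\<close>: the factor belonging to \<open>i\<close> is constant in that direction,
  and Hoelder's inequality applies to the others, because their exponents add up to \<open>1\<close>.  What
  comes out is the same expression for the marginal of \<open>f\<close> with one coordinate less.  The power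
  of \<open>f\<close> in front, trivial for the exponent of the Sobolev inequality, absorbs the factor
  belonging to \<open>i\<close> and closes the induction.
\<close>

lemma gridline_inequality:
  fixes f :: "('i \<Rightarrow> real) \<Rightarrow> ennreal" and p :: real
  assumes "finite I" "0 \<le> p" "(real (card I) - 1) * p \<le> 1"
    and "f \<in> borel_measurable (PiM I (\<lambda>_. lborel))"
  shows "(\<integral>\<^sup>+x. epow (f x) (1 - (real (card I) - 1) * p)
            * (\<Prod>i\<in>I. epow (\<integral>\<^sup>+t. f (x(i := t)) \<partial>lborel) p) \<partial>PiM I (\<lambda>_. lborel))
    \<le> epow (\<integral>\<^sup>+x. f x \<partial>PiM I (\<lambda>_. lborel)) (1 + p)"
  using assms
proof (induction I arbitrary: f rule: finite_induct)
  case empty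
  interpret product_sigma_finite "\<lambda>_::'i. lborel :: real measure" by standard
  show ?case by (simp add: PiM_empty nn_integral_count_space_finite)
next
  case (insert i s)
  interpret product_sigma_finite "\<lambda>_::'i. lborel :: real measure" by standard
  note [measurable] = insert.prems(3)
  have s [simp]: "finite s" "i \<notin> s" by fact+
  have cp: "real (card s) * p \<le> 1" using insert.prems(2) by simp
  have ups: "(\<lambda>(x, t). x(i := t)) \<in> PiM s (\<lambda>_. lborel) \<Otimes>\<^sub>M lborel \<rightarrow>\<^sub>M PiM (insert i s) (\<lambda>_. lborel :: real measure)"
    by (rule measurable_add_dim)
  have upd1 [measurable]: "(\<lambda>t. x(i := t)) \<in> lborel \<rightarrow>\<^sub>M PiM (insert i s) (\<lambda>_. lborel :: real measure)"
    if "x \<in> space (PiM s (\<lambda>_. lborel :: real measure))" for x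
    using measurable_compose[OF measurable_Pair1'[OF that] ups] by simp
  define F where "F x = (\<integral>\<^sup>+t. f (x(i := t)) \<partial>lborel)" for x
  have upI: "(\<lambda>(x, t). x(j := t)) \<in> PiM (insert i s) (\<lambda>_. lborel) \<Otimes>\<^sub>M lborel \<rightarrow>\<^sub>M PiM (insert i s) (\<lambda>_. lborel :: real measure)"
    if "j \<in> insert i s" for j
  proof -
    have "insert j (insert i s) = insert i s" using that by auto
    then show ?thesis using measurable_add_dim[of j "insert i s" "\<lambda>_. lborel :: real measure"] by simp
  qed
  have marg [measurable]: "(\<lambda>x. \<integral>\<^sup>+t. f (x(j := t)) \<partial>lborel) \<in> borel_measurable (PiM (insert i s) (\<lambda>_. lborel))"
    if "j \<in> insert i s" for j
    using measurable_compose[OF upI[OF that] insert.prems(3)]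
    by (intro lborel.borel_measurable_nn_integral) (simp add: split_def fun_upd_def)
  have F [measurable]: "F \<in> borel_measurable (PiM s (\<lambda>_. lborel))"
    unfolding F_def using measurable_compose[OF ups insert.prems(3)]
    by (intro lborel.borel_measurable_nn_integral) (simp add: split_def fun_upd_def)
  have swap: "(\<integral>\<^sup>+t. \<integral>\<^sup>+t'. f (x(i := t, j := t')) \<partial>lborel \<partial>lborel) = (\<integral>\<^sup>+t'. F (x(j := t')) \<partial>lborel)"
    if x: "x \<in> space (PiM s (\<lambda>_. lborel :: real measure))" and j: "j \<in> s" for x j
  proof -
    have ij: "j \<noteq> i" using j by auto
    have "(\<lambda>z. ((x(i := fst z)), snd z)) \<in> lborel \<Otimes>\<^sub>M lborel \<rightarrow>\<^sub>M PiM (insert i s) (\<lambda>_. lborel :: real measure) \<Otimes>\<^sub>M lborel"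
      using upd1[OF x] by measurable
    from measurable_compose[OF this upI[of j]] j
    have "(\<lambda>z. x(i := fst z, j := snd z)) \<in> lborel \<Otimes>\<^sub>M lborel \<rightarrow>\<^sub>M PiM (insert i s) (\<lambda>_. lborel :: real measure)"
      by simp
    from measurable_compose[OF this insert.prems(3)]
    have "(\<lambda>(t, t'). f (x(i := t, j := t'))) \<in> borel_measurable (lborel \<Otimes>\<^sub>M lborel)"
      by (simp add: split_def fun_upd_def)
    then have "(\<integral>\<^sup>+t. \<integral>\<^sup>+t'. f (x(i := t, j := t')) \<partial>lborel \<partial>lborel)
      = (\<integral>\<^sup>+t'. \<integral>\<^sup>+t. f (x(i := t, j := t')) \<partial>lborel \<partial>lborel)"
      by (intro lborel_pair.Fubini'[symmetric]) auto
    also have "\<dots> = (\<integral>\<^sup>+t'. F (x(j := t')) \<partial>lborel)"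
      unfolding F_def using ij by (simp add: fun_upd_twist)
    finally show ?thesis .
  qed
  define a where "a = 1 - real (card s) * p"
  have a: "0 \<le> a" using cp by (simp add: a_def)
  have inner: "(\<integral>\<^sup>+t. epow (f (x(i := t))) a * (\<Prod>j\<in>s. epow (\<integral>\<^sup>+t'. f (x(i := t, j := t')) \<partial>lborel) p) \<partial>lborel)
      \<le> epow (F x) a * (\<Prod>j\<in>s. epow (\<integral>\<^sup>+t. F (x(j := t)) \<partial>lborel) p)"
    if x: "x \<in> space (PiM s (\<lambda>_. lborel :: real measure))" for x
  proof -
    \<comment> \<open>\<open>None\<close> indexes the power of \<open>f\<close> itself, \<open>Some j\<close> the line integrals in direction \<open>j\<close>.\<close>
    define J where "J = insert None (Some ` s)"
    define g where "g k t = (case k of None \<Rightarrow> f (x(i := t)) | Some j \<Rightarrow> (\<integral>\<^sup>+t'. f (x(i := t, j := t')) \<partial>lborel))" for k t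
    define q where "q k = (case k of None \<Rightarrow> a | Some j \<Rightarrow> p)" for k :: "'i option"
    have pr: "(\<Prod>k\<in>J. epow (h k) (q k)) = epow (h None) a * (\<Prod>j\<in>s. epow (h (Some j)) p)" for h
      unfolding J_def by (subst prod.insert) (auto simp: prod.reindex q_def)
    have "(\<integral>\<^sup>+t. (\<Prod>k\<in>J. epow (g k t) (q k)) \<partial>lborel) \<le> (\<Prod>k\<in>J. epow (\<integral>\<^sup>+t. g k t \<partial>lborel) (q k))"
    proof (rule hoelder)
      show "finite J" by (simp add: J_def)
      show "0 \<le> q k" for k using a insert.prems by (auto simp: q_def split: option.split)
      show "sum q J = 1" unfolding J_def by (subst sum.insert) (auto simp: sum.reindex q_def a_def)
      show "g k \<in> borel_measurable lborel" if "k \<in> J" for k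
        using that measurable_compose[OF upd1[OF x] insert.prems(3)] measurable_compose[OF upd1[OF x] marg]
        by (auto simp: J_def g_def[abs_def] fun_upd_def)
    qed
    then show ?thesis unfolding pr
      using x by (simp add: g_def[abs_def] F_def[symmetric] swap)
  qed
  have split: "epow (F x) p * epow (F x) a = epow (F x) (1 - (real (card s) - 1) * p)" for x
    using epow_add[OF insert.prems(1) a, of "F x"] by (simp add: a_def algebra_simps)
  have "(\<integral>\<^sup>+x. epow (f x) (1 - (real (card (insert i s)) - 1) * p)
            * (\<Prod>j\<in>insert i s. epow (\<integral>\<^sup>+t. f (x(j := t)) \<partial>lborel) p) \<partial>PiM (insert i s) (\<lambda>_. lborel))
     = (\<integral>\<^sup>+x. epow (f x) a
            * (\<Prod>j\<in>insert i s. epow (\<integral>\<^sup>+t. f (x(j := t)) \<partial>lborel) p) \<partial>PiM (insert i s) (\<lambda>_. lborel))"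
    by (simp add: a_def)
  also have "\<dots> = (\<integral>\<^sup>+x. \<integral>\<^sup>+t. epow (f (x(i := t))) a
            * (\<Prod>j\<in>insert i s. epow (\<integral>\<^sup>+t'. f (x(i := t, j := t')) \<partial>lborel) p) \<partial>lborel \<partial>PiM s (\<lambda>_. lborel))"
    by (subst product_nn_integral_insert) (auto intro!: borel_measurable_times_ennreal borel_measurable_prod_ennreal epow_measurable marg insert.prems(3))
  also have "\<dots> \<le> (\<integral>\<^sup>+x. epow (F x) p * (epow (F x) a * (\<Prod>j\<in>s. epow (\<integral>\<^sup>+t. F (x(j := t)) \<partial>lborel) p)) \<partial>PiM s (\<lambda>_. lborel))"
  proof (rule nn_integral_mono)
    fix x assume x: "x \<in> space (PiM s (\<lambda>_. lborel :: real measure))"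
    have m: "(\<lambda>t. epow (f (x(i := t))) a * (\<Prod>j\<in>s. epow (\<integral>\<^sup>+t'. f (x(i := t, j := t')) \<partial>lborel) p)) \<in> borel_measurable lborel"
      using measurable_compose[OF upd1[OF x] insert.prems(3)] measurable_compose[OF upd1[OF x] marg]
      by (intro borel_measurable_times_ennreal borel_measurable_prod_ennreal epow_measurable) (auto simp: fun_upd_def)
    have "(\<integral>\<^sup>+t. epow (f (x(i := t))) a * (\<Prod>j\<in>insert i s. epow (\<integral>\<^sup>+t'. f (x(i := t, j := t')) \<partial>lborel) p) \<partial>lborel)
      = (\<integral>\<^sup>+t. epow (F x) p * (epow (f (x(i := t))) a * (\<Prod>j\<in>s. epow (\<integral>\<^sup>+t'. f (x(i := t, j := t')) \<partial>lborel) p)) \<partial>lborel)"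
      by (simp add: F_def mult_ac)
    also have "\<dots> = epow (F x) p * (\<integral>\<^sup>+t. epow (f (x(i := t))) a * (\<Prod>j\<in>s. epow (\<integral>\<^sup>+t'. f (x(i := t, j := t')) \<partial>lborel) p) \<partial>lborel)"
      by (rule nn_integral_cmult[OF m])
    also have "\<dots> \<le> epow (F x) p * (epow (F x) a * (\<Prod>j\<in>s. epow (\<integral>\<^sup>+t. F (x(j := t)) \<partial>lborel) p))"
      by (intro mult_left_mono inner x) auto
    finally show "(\<integral>\<^sup>+t. epow (f (x(i := t))) a * (\<Prod>j\<in>insert i s. epow (\<integral>\<^sup>+t'. f (x(i := t, j := t')) \<partial>lborel) p) \<partial>lborel) \<le> \<dots>" .
  qed
  also have "\<dots> = (\<integral>\<^sup>+x. epow (F x) (1 - (real (card s) - 1) * p) * (\<Prod>j\<in>s. epow (\<integral>\<^sup>+t. F (x(j := t)) \<partial>lborel) p) \<partial>PiM s (\<lambda>_. lborel))"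
    by (simp add: split[symmetric] mult.assoc)
  also have "\<dots> \<le> epow (\<integral>\<^sup>+x. F x \<partial>PiM s (\<lambda>_. lborel)) (1 + p)"
    using insert.prems(1) cp by (intro insert.IH F) (auto simp: algebra_simps)
  also have "(\<integral>\<^sup>+x. F x \<partial>PiM s (\<lambda>_. lborel)) = (\<integral>\<^sup>+x. f x \<partial>PiM (insert i s) (\<lambda>_. lborel))"
    unfolding F_def by (subst product_nn_integral_insert) auto
  finally show ?case .
qed

text \<open>
  Continuously differentiable functions with compact support in \<open>S\<close>, together with their
  gradient, extended by zero.  Naming the gradient avoids the choice operator of
  \<open>frechet_derivative\<close> in all computations.
\<close>

definition compact_C1 :: "'a::euclidean_space set \<Rightarrow> ('a \<Rightarrow> real) \<Rightarrow> ('a \<Rightarrow> 'a) \<Rightarrow> bool" where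
  "compact_C1 S U g \<longleftrightarrow> (\<forall>x. (U has_derivative (\<lambda>h. g x \<bullet> h)) (at x)) \<and> continuous_on UNIV g
     \<and> (\<exists>K. compact K \<and> K \<subseteq> S \<and> (\<forall>x. x \<notin> K \<longrightarrow> U x = 0 \<and> g x = 0))"

lemma integrable_compact_support:
  fixes f :: "'a::euclidean_space \<Rightarrow> 'b::{banach, second_countable_topology}"
  assumes "compact K" "continuous_on K f" "\<And>x. x \<notin> K \<Longrightarrow> f x = 0"
  shows "integrable lborel f"
proof -
  have "f = (\<lambda>x. indicator K x *\<^sub>R f x)" using assms(3) by (auto simp: indicator_def fun_eq_iff)
  with borel_integrable_compact[OF assms(1,2)] show ?thesis by simp
qed

lemma compact_C1_continuous: "compact_C1 S U g \<Longrightarrow> continuous_on A U"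
  unfolding compact_C1_def
  by (meson UNIV_I continuous_on_subset has_derivative_continuous_on has_derivative_at_withinI subset_UNIV)

text \<open>
  The fundamental theorem of calculus along a line, started at a point outside the support.
\<close>

lemma compact_C1_pointwise_bound:
  assumes U: "compact_C1 S U g" and b: "b \<in> Basis"
  shows "ennreal \<bar>U x\<bar> \<le> (\<integral>\<^sup>+t. ennreal (norm (g (x + (t - x \<bullet> b) *\<^sub>R b))) \<partial>lborel)"
proof -
  from U obtain K where K: "compact K" "\<And>x. x \<notin> K \<Longrightarrow> U x = 0" by (auto simp: compact_C1_def)
  then obtain B where B: "\<And>x. x \<in> K \<Longrightarrow> norm x \<le> B" using compact_imp_bounded bounded_iff by metis
  define y where "y t = x + (t - x \<bullet> b) *\<^sub>R b" for t
  \<comment> \<open>A parameter left of \<open>x\<close> at which the line is outside the support.\<close>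
  define a where "a = min (x \<bullet> b) (-(B+1))"
  have yb: "y t \<bullet> b = t" for t using b by (simp add: y_def inner_add_left inner_diff_left)
  have "U (y a) = 0"
  proof (rule K(2), rule)
    assume "y a \<in> K"
    from B[OF this] have "\<bar>y a \<bullet> b\<bar> \<le> B" using Basis_le_norm[OF b] by (meson order_trans)
    then show False unfolding yb a_def by auto
  qed
  have dy: "(y has_vector_derivative b) (at t within A)" for t A
    unfolding y_def by (auto intro!: derivative_eq_intros)
  have der: "((\<lambda>t. U (y t)) has_vector_derivative (g (y t) \<bullet> b)) (at t within A)" for t A
  proof -
    have "(U has_derivative (\<lambda>h. g (y t) \<bullet> h)) (at (y t) within y ` A)"
      using U by (auto simp: compact_C1_def intro: has_derivative_at_withinI)
    from has_derivative_in_compose[OF dy[unfolded has_vector_derivative_def] this]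
    show ?thesis by (simp add: has_vector_derivative_def)
  qed
  have cy: "continuous_on A y" for A
    unfolding y_def by (intro continuous_intros)
  have cg: "continuous_on A (\<lambda>t. g (y t))" for A
    by (rule continuous_on_compose2[OF _ cy]) (use U in \<open>auto simp: compact_C1_def\<close>)
  have cont: "continuous_on A (\<lambda>t. g (y t) \<bullet> b)" for A
    by (intro continuous_intros cg)
  have ax: "a \<le> x \<bullet> b" by (simp add: a_def)
  have I: "has_bochner_integral lborel (\<lambda>t. indicator {a..x \<bullet> b} t *\<^sub>R (g (y t) \<bullet> b)) (U (y (x \<bullet> b)) - U (y a))"
    by (rule has_bochner_integral_FTC_Icc[OF ax der cont])
  have "ennreal \<bar>U x\<bar> = ennreal (norm (\<integral>t. indicator {a..x \<bullet> b} t *\<^sub>R (g (y t) \<bullet> b) \<partial>lborel))"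
    using has_bochner_integral_integral_eq[OF I] \<open>U (y a) = 0\<close> by (simp add: y_def)
  also have "\<dots> \<le> (\<integral>\<^sup>+t. ennreal (norm (indicator {a..x \<bullet> b} t *\<^sub>R (g (y t) \<bullet> b))) \<partial>lborel)"
    using I by (intro integral_norm_bound_ennreal) (auto simp: has_bochner_integral_iff)
  also have "\<dots> \<le> (\<integral>\<^sup>+t. ennreal (norm (g (y t))) \<partial>lborel)"
    using Cauchy_Schwarz_ineq2[of "g (y t)" b for t] b
    by (intro nn_integral_mono ennreal_leI) (auto simp: indicator_def)
  finally show ?thesis by (simp add: y_def)
qed

text \<open>
  Multiply the pointwise bounds for all coordinate directions, each to the power \<open>1/(n-1)\<close>, and
  integrate with the gridline inequality.
\<close>

lemma gagliardo_nirenberg_L1: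
  fixes U :: "'a::euclidean_space \<Rightarrow> real"
  assumes U: "compact_C1 S U g" and n: "n = real DIM('a)" "n \<ge> 2"
  shows "(\<integral>x. \<bar>U x\<bar> powr (n / (n - 1)) \<partial>lborel) \<le> (\<integral>x. norm (g x) \<partial>lborel) powr (n / (n - 1))"
proof -
  interpret product_sigma_finite "\<lambda>_::'a. lborel :: real measure" by standard
  let ?P = "PiM (Basis::'a set) (\<lambda>_. lborel :: real measure)"
  define e where "e x = (\<Sum>b\<in>Basis. x b *\<^sub>R b)" for x :: "'a \<Rightarrow> real"
  define p where "p = 1 / (n - 1)"
  have p: "0 < p" "(n - 1) * p = 1" "1 + p = n / (n - 1)" "p * n = n / (n - 1)"
    using n by (auto simp: p_def field_simps)
  from U obtain K where K: "compact K" "\<And>x. x \<notin> K \<Longrightarrow> U x = 0" "\<And>x. x \<notin> K \<Longrightarrow> g x = 0"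
    and cg: "continuous_on UNIV g" by (auto simp: compact_C1_def)
  have cU: "continuous_on UNIV U" by (rule compact_C1_continuous[OF U])
  have [measurable]: "g \<in> borel_measurable borel" "U \<in> borel_measurable borel"
    using cg cU by (auto intro: borel_measurable_continuous_onI)
  have e [measurable]: "e \<in> ?P \<rightarrow>\<^sub>M borel"
    unfolding e_def[abs_def] by measurable
  have lb: "lborel = distr ?P borel e" by (subst lborel_eq) (simp add: e_def[abs_def])
  have eu: "e (x(b := t)) = e x + (t - e x \<bullet> b) *\<^sub>R b" if "b \<in> Basis" for x b t
  proof -
    have "e x \<bullet> b = x b" using that by (simp add: e_def)
    moreover have "e y = y b *\<^sub>R b + (\<Sum>c\<in>Basis - {b}. y c *\<^sub>R c)" for y
      unfolding e_def using that by (simp add: sum.remove)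
    ultimately show ?thesis by (simp add: algebra_simps cong: sum.cong_simp)
  qed
  define f where "f x = ennreal (norm (g (e x)))" for x
  have f [measurable]: "f \<in> borel_measurable ?P" unfolding f_def[abs_def] by measurable
  have "ennreal (\<integral>x. \<bar>U x\<bar> powr (n / (n - 1)) \<partial>lborel) = (\<integral>\<^sup>+x. ennreal (\<bar>U x\<bar> powr (n / (n - 1))) \<partial>lborel)"
  proof (rule nn_integral_eq_integral[symmetric])
    show "integrable lborel (\<lambda>x. \<bar>U x\<bar> powr (n / (n - 1)))"
    proof (rule integrable_compact_support[OF K(1)])
      have "0 < n / (n - 1)" using n by simp
      then show "continuous_on K (\<lambda>x. \<bar>U x\<bar> powr (n / (n - 1)))"
        by (intro continuous_on_powr' continuous_intros continuous_on_subset[OF cU]) auto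
    qed (simp add: K)
  qed simp
  also have "\<dots> = (\<integral>\<^sup>+x. ennreal (\<bar>U (e x)\<bar> powr (n / (n - 1))) \<partial>?P)"
    by (subst lb, subst nn_integral_distr) auto
  also have "\<dots> \<le> (\<integral>\<^sup>+x. epow (f x) (1 - (real (card (Basis::'a set)) - 1) * p)
            * (\<Prod>i\<in>Basis. epow (\<integral>\<^sup>+t. f (x(i := t)) \<partial>lborel) p) \<partial>?P)"
  proof (rule nn_integral_mono)
    fix x
    have "(\<bar>U (e x)\<bar> powr p) ^ DIM('a) = \<bar>U (e x)\<bar> powr (n / (n - 1))"
      unfolding p(4)[symmetric] unfolding n(1) by (cases "U (e x) = 0") (simp, subst powr_power, auto simp: mult.commute)
    then have "ennreal (\<bar>U (e x)\<bar> powr (n / (n - 1))) = epow (ennreal \<bar>U (e x)\<bar>) p ^ DIM('a)"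
      using p(1) by (simp add: epow_ennreal ennreal_power)
    also have "\<dots> = (\<Prod>i\<in>(Basis::'a set). epow (ennreal \<bar>U (e x)\<bar>) p)" by simp
    also have "\<dots> \<le> (\<Prod>i\<in>Basis. epow (\<integral>\<^sup>+t. f (x(i := t)) \<partial>lborel) p)"
      using compact_C1_pointwise_bound[OF U, of _ "e x"] p(1)
      by (intro prod_mono_ennreal epow_mono) (auto simp: f_def eu)
    also have "\<dots> = epow (f x) (1 - (real (card (Basis::'a set)) - 1) * p) * (\<Prod>i\<in>Basis. epow (\<integral>\<^sup>+t. f (x(i := t)) \<partial>lborel) p)"
      using p(2) n by simp
    finally show "ennreal (\<bar>U (e x)\<bar> powr (n / (n - 1))) \<le> \<dots>" .
  qed
  also have "\<dots> \<le> epow (\<integral>\<^sup>+x. f x \<partial>?P) (1 + p)"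
    using p n by (intro gridline_inequality f) auto
  also have "(\<integral>\<^sup>+x. f x \<partial>?P) = (\<integral>\<^sup>+x. ennreal (norm (g x)) \<partial>lborel)"
    unfolding f_def by (subst lb, subst nn_integral_distr) auto
  also have "\<dots> = ennreal (\<integral>x. norm (g x) \<partial>lborel)"
    using K by (intro nn_integral_eq_integral integrable_compact_support[OF K(1)])
       (auto intro!: continuous_intros continuous_on_subset[OF cg])
  also have "epow \<dots> (1 + p) = ennreal ((\<integral>x. norm (g x) \<partial>lborel) powr (1 + p))"
    using p by (intro epow_ennreal) auto
  finally show ?thesis by (simp add: p)
qed

text \<open>
  The derivative is written as a multiple of \<open>t * \<bar>t\<bar> powr (q - 2)\<close>, which is visibly continuous
  at \<open>0\<close>.
\<close>

lemma abs_powr_has_derivative: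
  fixes q :: real
  assumes "q > 2"
  shows "((\<lambda>t. \<bar>t\<bar> powr q) has_real_derivative (q * (t * \<bar>t\<bar> powr (q - 2)))) (at t)"
proof (cases t "0 :: real" rule: linorder_cases)
  case greater
  have "((\<lambda>t. t powr q) has_real_derivative (q * t powr (q - 1))) (at t)"
    using greater by (auto intro!: derivative_eq_intros)
  moreover have "\<forall>\<^sub>F s in nhds t. \<bar>s\<bar> powr q = s powr q"
    using eventually_nhds_in_open[of "{0<..}" t] greater by (auto elim!: eventually_mono)
  moreover have "t powr (q - 1) = t * \<bar>t\<bar> powr (q - 2)"
    using greater powr_add[of t 1 "q - 2"] by simp
  ultimately show ?thesis by (subst DERIV_cong_ev[OF refl _ refl]) auto
next
  case less
  have "((\<lambda>t. (-t) powr q) has_real_derivative (- (q * (-t) powr (q - 1)))) (at t)"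
    using less by (auto intro!: derivative_eq_intros)
  moreover have "\<forall>\<^sub>F s in nhds t. \<bar>s\<bar> powr q = (-s) powr q"
    using eventually_nhds_in_open[of "{..<0}" t] less by (auto elim!: eventually_mono)
  moreover have "- (q * (-t) powr (q - 1)) = q * (t * \<bar>t\<bar> powr (q - 2))"
    using less powr_add[of "-t" 1 "q - 2"] by simp
  ultimately show ?thesis by (subst DERIV_cong_ev[OF refl _ refl]) auto
next
  case equal
  have "continuous_on UNIV (\<lambda>h::real. h * \<bar>h\<bar> powr (q - 2))"
    using assms by (intro continuous_intros continuous_on_powr') auto
  then have "isCont (\<lambda>h::real. h * \<bar>h\<bar> powr (q - 2)) 0"
    by (auto simp: continuous_on_eq_continuous_at)
  then have "((\<lambda>h::real. h * \<bar>h\<bar> powr (q - 2)) \<longlongrightarrow> 0) (at 0)"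
    by (simp add: isCont_def)
  moreover have "(\<bar>h\<bar> powr q - 0) / h = h * \<bar>h\<bar> powr (q - 2)" if "h \<noteq> 0" for h :: real
  proof -
    have "\<bar>h\<bar> powr q = \<bar>h\<bar> powr 2 * \<bar>h\<bar> powr (q - 2)"
      using powr_add[of "\<bar>h\<bar>" 2 "q - 2"] by simp
    also have "\<bar>h\<bar> powr 2 = h * h" using that by (simp add: powr_numeral power2_eq_square)
    finally show ?thesis using that by simp
  qed
  ultimately have "((\<lambda>h::real. (\<bar>h\<bar> powr q - 0) / h) \<longlongrightarrow> 0) (at 0)"
    by (subst tendsto_cong) (auto simp: eventually_at_filter)
  then show ?thesis using equal by (simp add: DERIV_def)
qed

lemma compact_C1_abs_powr:
  assumes U: "compact_C1 S U g" and q: "q > 2"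
  shows "compact_C1 S (\<lambda>x. \<bar>U x\<bar> powr q) (\<lambda>x. (q * (U x * \<bar>U x\<bar> powr (q - 2))) *\<^sub>R g x)"
  unfolding compact_C1_def
proof (intro conjI allI)
  fix x
  have "(U has_derivative (\<lambda>h. g x \<bullet> h)) (at x)" using U by (auto simp: compact_C1_def)
  moreover have "((\<lambda>t. \<bar>t\<bar> powr q) has_derivative (*) (q * (U x * \<bar>U x\<bar> powr (q - 2)))) (at (U x))"
    using abs_powr_has_derivative[OF q, of "U x"] by (simp add: has_field_derivative_def)
  ultimately have "((\<lambda>x. \<bar>U x\<bar> powr q) has_derivative (\<lambda>h. q * (U x * \<bar>U x\<bar> powr (q - 2)) * (g x \<bullet> h))) (at x)"
    by (rule has_derivative_compose)
  then show "((\<lambda>x. \<bar>U x\<bar> powr q) has_derivative (\<lambda>h. ((q * (U x * \<bar>U x\<bar> powr (q - 2))) *\<^sub>R g x) \<bullet> h)) (at x)"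
    by simp
next
  have "continuous_on UNIV U" "continuous_on UNIV g"
    using compact_C1_continuous[OF U] U by (auto simp: compact_C1_def)
  then show "continuous_on UNIV (\<lambda>x. (q * (U x * \<bar>U x\<bar> powr (q - 2))) *\<^sub>R g x)"
    using q by (intro continuous_intros continuous_on_powr') auto
next
  show "\<exists>K. compact K \<and> K \<subseteq> S \<and>
        (\<forall>x. x \<notin> K \<longrightarrow> \<bar>U x\<bar> powr q = 0 \<and> (q * (U x * \<bar>U x\<bar> powr (q - 2))) *\<^sub>R g x = 0)"
    using U by (auto simp: compact_C1_def)
qed

text \<open>
  Integrate the square of \<open>A b - I a\<close>, where \<open>A\<close> and \<open>I\<close> are the integrals of \<open>a\<^sup>2\<close> and \<open>a b\<close>.
\<close>

lemma cauchy_schwarz_integral: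
  fixes a b :: "'a \<Rightarrow> real"
  assumes "integrable M (\<lambda>x. a x * a x)" "integrable M (\<lambda>x. a x * b x)" "integrable M (\<lambda>x. b x * b x)"
    and A: "0 < (\<integral>x. a x * a x \<partial>M)"
  shows "(\<integral>x. a x * b x \<partial>M)\<^sup>2 \<le> (\<integral>x. a x * a x \<partial>M) * (\<integral>x. b x * b x \<partial>M)"
proof -
  define A B I where "A = (\<integral>x. a x * a x \<partial>M)" "B = (\<integral>x. b x * b x \<partial>M)" "I = (\<integral>x. a x * b x \<partial>M)"
  note d = this
  have "0 \<le> (\<integral>x. (A * b x - I * a x)\<^sup>2 \<partial>M)" by simp
  also have "(\<lambda>x. (A * b x - I * a x)\<^sup>2) = (\<lambda>x. A * A * (b x * b x) - 2 * A * I * (a x * b x) + I * I * (a x * a x))"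
    by (auto simp: fun_eq_iff power2_eq_square algebra_simps)
  also have "(\<integral>x. A * A * (b x * b x) - 2 * A * I * (a x * b x) + I * I * (a x * a x) \<partial>M)
     = A * A * B - 2 * A * I * I + I * I * A"
    using assms(1-3) by (simp add: d)
  also have "\<dots> = A * (A * B - I\<^sup>2)" by (simp add: algebra_simps power2_eq_square)
  finally have "0 \<le> A * B - I\<^sup>2" using A by (simp add: zero_le_mult_iff d)
  then show ?thesis by (simp add: d)
qed

text \<open>
  Apply the inequality for gradients in \<open>L\<^sup>1\<close> to \<open>\<bar>U\<bar> powr q\<close> with \<open>q = 2 (n-1)/(n-2)\<close>.  For
  this \<open>q\<close>, Cauchy-Schwarz on the right side reproduces the integral \<open>A\<close> on the left side to a
  smaller power, and \<open>A\<close> can be divided out.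
\<close>

theorem sobolev_L2:
  fixes U :: "'a::euclidean_space \<Rightarrow> real"
  assumes U: "compact_C1 S U g" and n: "n = real DIM('a)" "n \<ge> 3"
  shows "(\<integral>x. \<bar>U x\<bar> powr (2 * n / (n - 2)) \<partial>lborel) powr ((n - 2) / n)
    \<le> (2 * (n - 1) / (n - 2))\<^sup>2 * (\<integral>x. (norm (g x))\<^sup>2 \<partial>lborel)"
proof -
  define q where "q = 2 * (n - 1) / (n - 2)"
  have cancel: "2 * a / b * (c / a) = 2 * c / b" if "a \<noteq> 0" for a b c :: real
    using that by simp
  have "q * (n / (n - 1)) = 2 * n / (n - 2)"
    unfolding q_def by (rule cancel) (use n(2) in simp)
  moreover have "q > 2" using n(2) by (simp add: q_def field_simps)
  moreover have "2 * (q - 1) = 2 * n / (n - 2)" using n(2) by (simp add: q_def field_simps)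
  ultimately have q: "q > 2" "2 * (q - 1) = 2 * n / (n - 2)" "q * (n / (n - 1)) = 2 * n / (n - 2)"
    by auto
  define A where "A = (\<integral>x. \<bar>U x\<bar> powr (2 * n / (n - 2)) \<partial>lborel)"
  define B where "B = (\<integral>x. (norm (g x))\<^sup>2 \<partial>lborel)"
  from U obtain K where K: "compact K" "\<And>x. x \<notin> K \<Longrightarrow> U x = 0" "\<And>x. x \<notin> K \<Longrightarrow> g x = 0"
    and cg: "continuous_on UNIV g" by (auto simp: compact_C1_def)
  have cU: "continuous_on UNIV U" by (rule compact_C1_continuous[OF U])
  show ?thesis
  proof (cases "A = 0")
    case True
    then show ?thesis by (simp flip: A_def)
  next
    case False
    have A: "0 < A" using False unfolding A_def by (simp add: less_le)
    let ?a = "\<lambda>x. \<bar>U x\<bar> powr (q - 1)" let ?b = "\<lambda>x. norm (g x)"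
    have aa: "?a x * ?a x = \<bar>U x\<bar> powr (2 * n / (n - 2))" for x
      unfolding q(2)[symmetric] by (simp flip: powr_add)
    have ca: "continuous_on K ?a"
      using q by (intro continuous_intros continuous_on_powr' continuous_on_subset[OF cU]) auto
    have cb: "continuous_on K ?b" by (intro continuous_intros continuous_on_subset[OF cg]) auto
    have int: "integrable lborel (\<lambda>x. ?a x * ?a x)" "integrable lborel (\<lambda>x. ?a x * ?b x)" "integrable lborel (\<lambda>x. ?b x * ?b x)"
      by (intro integrable_compact_support[OF K(1)] continuous_on_mult ca cb; simp add: K)+
    have A2: "(\<integral>x. ?a x * ?a x \<partial>lborel) = A" unfolding aa A_def ..
    have B2: "(\<integral>x. ?b x * ?b x \<partial>lborel) = B" by (simp only: B_def power2_eq_square)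
    have I: "(\<integral>x. ?a x * ?b x \<partial>lborel)\<^sup>2 \<le> A * B"
      using cauchy_schwarz_integral[OF int] A unfolding A2 B2 by blast
    have J0: "0 \<le> (\<integral>x. ?a x * ?b x \<partial>lborel)" by simp
    have "A = (\<integral>x. \<bar>\<bar>U x\<bar> powr q\<bar> powr (n / (n - 1)) \<partial>lborel)"
      unfolding A_def by (simp add: powr_powr q(3) del: times_divide_eq_right)
    also have "\<dots> \<le> (\<integral>x. norm ((q * (U x * \<bar>U x\<bar> powr (q - 2))) *\<^sub>R g x) \<partial>lborel) powr (n / (n - 1))"
      using n by (intro gagliardo_nirenberg_L1[OF compact_C1_abs_powr[OF U q(1)]]) auto
    also have "(\<lambda>x. norm ((q * (U x * \<bar>U x\<bar> powr (q - 2))) *\<^sub>R g x)) = (\<lambda>x. q * (?a x * ?b x))"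
    proof
      fix x
      have "\<bar>U x\<bar> * \<bar>U x\<bar> powr (q - 2) = \<bar>U x\<bar> powr (q - 1)"
        using powr_add[of "\<bar>U x\<bar>" 1 "q - 2"] by simp
      then show "norm ((q * (U x * \<bar>U x\<bar> powr (q - 2))) *\<^sub>R g x) = q * (?a x * ?b x)"
        using q by (simp add: abs_mult mult.assoc)
    qed
    \<comment> \<open>The exponent below is twice the reciprocal of \<open>n / (n - 1)\<close>, so that the right side becomes a square.\<close>
    finally have 1: "A \<le> (q * (\<integral>x. ?a x * ?b x \<partial>lborel)) powr (n / (n - 1))" by simp
    have "A powr (2 * (n - 1) / n) \<le> ((q * (\<integral>x. ?a x * ?b x \<partial>lborel)) powr (n / (n - 1))) powr (2 * (n - 1) / n)"
      using n A by (intro powr_mono2 1) auto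
    also have "\<dots> = (q * (\<integral>x. ?a x * ?b x \<partial>lborel))\<^sup>2"
    proof -
      have "n / (n - 1) * (2 * (n - 1) / n) = 2" using n by (simp add: field_simps)
      then show ?thesis using J0 q by (simp add: powr_powr powr_numeral)
    qed
    also have "\<dots> \<le> q\<^sup>2 * (A * B)" unfolding power_mult_distrib by (intro mult_left_mono I) auto
    finally have "A powr (2 * (n - 1) / n) \<le> A * (q\<^sup>2 * B)" by (simp add: mult_ac)
    moreover have "A powr (2 * (n - 1) / n) = A * A powr ((n - 2) / n)"
    proof -
      have "2 * (n - 1) / n = 1 + (n - 2) / n" using n by (simp add: field_simps)
      then show ?thesis using A by (simp add: powr_add)
    qed
    ultimately have "A powr ((n - 2) / n) \<le> q\<^sup>2 * B" using A by simp
    then show ?thesis by (simp add: A_def B_def q_def)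
  qed
qed

section \<open>Iterated logarithms and the constant kappa\<close>

lemma X_Suc_outer: "X (Suc k) t = 1 / (1 - ln (X k t))"
  by (induction k arbitrary: t) simp_all

lemma X_bounds: "0 < t \<Longrightarrow> t < 1 \<Longrightarrow> 0 < X k t \<and> X k t < 1"
proof (induction k)
  case (Suc k)
  then have "ln (X k t) < 0" by simp
  then show ?case unfolding X_Suc_outer by (simp add: field_simps)
qed simp

lemma X_strict_mono: "0 < s \<Longrightarrow> s < t \<Longrightarrow> t < 1 \<Longrightarrow> X k s < X k t"
proof (induction k)
  case (Suc k)
  then have "X k s < X k t" "0 < X k s" "0 < X k t" "X k t < 1" using X_bounds[of s k] X_bounds[of t k] by auto
  then have "ln (X k s) < ln (X k t)" "ln (X k t) < 0" by auto
  then show ?case unfolding X_Suc_outer by (simp add: frac_less2)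
qed simp

text \<open>
  The defining recursion peels off the innermost step; the estimates need the outermost one, as in
  \<open>X_Suc_outer\<close>, so the defining equations must not rewrite.
\<close>

declare X.simps [simp del]

definition Xprod :: "nat \<Rightarrow> real \<Rightarrow> real" where
  "Xprod i t = (\<Prod>j=1..i. X j t)"

lemma Xprod_0 [simp]: "Xprod 0 t = 1" by (simp add: Xprod_def)
lemma Xprod_Suc: "Xprod (Suc i) t = Xprod i t * X (Suc i) t" by (simp add: Xprod_def)

lemma Xprod_pos: "0 < t \<Longrightarrow> t < 1 \<Longrightarrow> 0 < Xprod i t"
  using X_bounds by (auto simp: Xprod_def intro!: prod_pos)

lemma Xprod_le_1: "0 < t \<Longrightarrow> t < 1 \<Longrightarrow> Xprod i t \<le> 1"
  using X_bounds by (auto simp: Xprod_def less_imp_le intro!: prod_le_1)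

lemma Xprod_mono: "0 < s \<Longrightarrow> s \<le> t \<Longrightarrow> t < 1 \<Longrightarrow> Xprod i s \<le> Xprod i t"
  unfolding Xprod_def using X_strict_mono[of s t] X_bounds[of s]
  by (cases "s = t") (auto intro!: prod_mono simp: less_imp_le)

lemma Xprod_strict_mono: "0 < s \<Longrightarrow> s < t \<Longrightarrow> t < 1 \<Longrightarrow> Xprod (Suc i) s < Xprod (Suc i) t"
  unfolding Xprod_def using X_strict_mono[of s t] X_bounds[of s] X_bounds[of t]
  by (intro prod_mono_strict) (auto simp: less_imp_le)

text \<open>
  The difference of the two sides decreases on \<open>(0, 1]\<close> and vanishes at \<open>1\<close>.
\<close>

lemma ln_upper_quadratic:
  fixes x :: real
  assumes "0 < x" "x < 1"
  shows "(1 - x) + (1 - x)\<^sup>2 / 2 \<le> - ln x"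
proof -
  define f where "f x = - ln x - (1 - x) - (1 - x)\<^sup>2 / 2" for x :: real
  have "f 1 \<le> f x"
  proof (rule DERIV_nonpos_imp_nonincreasing[of x 1 f])
    show "x \<le> 1" using assms by simp
    fix y assume y: "x \<le> y" "y \<le> 1"
    have "(f has_real_derivative (- 1 / y + 1 + (1 - y))) (at y)"
      unfolding f_def using y assms by (auto intro!: derivative_eq_intros simp: field_simps)
    moreover have "- 1 / y + 1 + (1 - y) = - ((1 - y)\<^sup>2 / y)"
      using y assms by (simp add: field_simps power2_eq_square)
    ultimately show "\<exists>z. (f has_real_derivative z) (at y) \<and> z \<le> 0"
      using y assms by (intro exI[of _ "- ((1 - y)\<^sup>2 / y)"]) auto
  qed
  then show ?thesis by (simp add: f_def)
qed

text \<open>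
  The series converges only like the sum of \<open>1/i\<^sup>2\<close>, since \<open>X i t\<close> tends to \<open>1\<close> with \<open>1 - X i t\<close>
  about \<open>2/i\<close>.  The ratio test is therefore useless, but this behaviour suggests comparing with
  the telescoping sequence of the quotients of \<open>Xprod i t\<close> and \<open>1 - X i t\<close>.
\<close>

lemma Xprod_telescope:
  assumes "0 < t" "t < 1"
  shows "Xprod (Suc i) t \<le> 3 * (Xprod (Suc i) t / (1 - X (Suc i) t) - Xprod (Suc (Suc i)) t / (1 - X (Suc (Suc i)) t))"
proof -
  define x where "x = X (Suc i) t"
  have x: "0 < x" "x < 1" using X_bounds[OF assms] by (auto simp: x_def)
  have x': "X (Suc (Suc i)) t = 1 / (1 - ln x)" by (simp only: X_Suc_outer[of "Suc i"] x_def)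
  have lnx: "ln x < 0" using x by simp
  have q: "(1 / (1 - ln x)) / (1 - 1 / (1 - ln x)) = 1 / (- ln x)"
    using lnx by (simp add: divide_simps)
  define \<epsilon> where "\<epsilon> = 1 - x"
  have e: "0 < \<epsilon>" "\<epsilon> < 1" using x by (auto simp: \<epsilon>_def)
  have "\<epsilon> + \<epsilon>\<^sup>2 / 2 \<le> - ln x" using ln_upper_quadratic[OF x] by (simp add: \<epsilon>_def)
  then have "1 / (- ln x) \<le> 1 / (\<epsilon> + \<epsilon>\<^sup>2 / 2)"
    using e by (intro divide_left_mono mult_pos_pos add_pos_pos) (use lnx in auto)
  also have "\<dots> = 1 / \<epsilon> - 1 / (2 + \<epsilon>)"
  proof -
    have "\<epsilon> + \<epsilon>\<^sup>2 / 2 = \<epsilon> * (2 + \<epsilon>) / 2" by (simp add: power2_eq_square algebra_simps)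
    then have "1 / (\<epsilon> + \<epsilon>\<^sup>2 / 2) = 2 / (\<epsilon> * (2 + \<epsilon>))" by (simp only:) simp
    also have "\<dots> = 1 / \<epsilon> - 1 / (2 + \<epsilon>)" using e by (simp add: diff_frac_eq)
    finally show ?thesis .
  qed
  also have "\<dots> \<le> 1 / \<epsilon> - 1 / 3" using e by (simp add: frac_le)
  finally have "1 \<le> 3 * (1 / (1 - x) - (1 / (1 - ln x)) / (1 - 1 / (1 - ln x)))"
    unfolding q by (simp add: \<epsilon>_def)
  \<comment> \<open>Multiplying by the product turns the inequality for the single factor \<open>x\<close> into the telescoping one.\<close>
  from mult_left_mono[OF this, of "Xprod (Suc i) t"] Xprod_pos[OF assms, of "Suc i"]
  have "Xprod (Suc i) t * 1 \<le> Xprod (Suc i) t * (3 * (1 / (1 - x) - (1 / (1 - ln x)) / (1 - 1 / (1 - ln x))))"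
    by simp
  also have "\<dots> = 3 * (Xprod (Suc i) t / (1 - x) - Xprod (Suc i) t * X (Suc (Suc i)) t / (1 - X (Suc (Suc i)) t))"
    unfolding x' by (simp only: algebra_simps times_divide_eq_right mult_1_right)
  finally show ?thesis by (simp only: Xprod_Suc[of "Suc i"] x_def mult_1_right)
qed

lemma Xprod_sum_bound:
  assumes "0 < t" "t < 1"
  shows "(\<Sum>i<N. Xprod (Suc i) t) \<le> 3 / (- ln t)"
proof -
  have lt: "ln t < 0" using assms by simp
  define d where "d i = Xprod (Suc i) t / (1 - X (Suc i) t)" for i
  have "(\<Sum>i<N. Xprod (Suc i) t) \<le> (\<Sum>i<N. 3 * (d i - d (Suc i)))"
    unfolding d_def by (intro sum_mono Xprod_telescope assms)
  also have "\<dots> = 3 * (d 0 - d N)"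
    by (simp only: sum_distrib_left[symmetric] sum_lessThan_telescope')
  also have "\<dots> \<le> 3 * d 0"
    using Xprod_pos[OF assms, of "Suc N"] X_bounds[OF assms, of "Suc N"] by (simp add: d_def)
  also have "d 0 = 1 / (- ln t)"
    using lt by (simp add: d_def Xprod_Suc X.simps divide_simps)
  finally show ?thesis by simp
qed

lemma summable_Xprod: "0 < t \<Longrightarrow> t < 1 \<Longrightarrow> summable (\<lambda>i. Xprod (Suc i) t)"
  using Xprod_pos Xprod_sum_bound
  by (intro summableI_nonneg_bounded[where x = "3 / (- ln t)"]) (auto simp: less_imp_le)

lemma suminf_Xprod_strict_mono:
  assumes "0 < s" "s < t" "t < 1"
  shows "(\<Sum>i. Xprod (Suc i) s) < (\<Sum>i. Xprod (Suc i) t)"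
proof -
  have S: "summable (\<lambda>i. Xprod (Suc i) s)" "summable (\<lambda>i. Xprod (Suc i) t)"
    using assms by (auto intro!: summable_Xprod)
  have "0 < (\<Sum>i. Xprod (Suc i) t - Xprod (Suc i) s)"
    by (rule suminf_pos[OF summable_diff[OF S(2,1)]]) (use Xprod_strict_mono[OF assms] in simp)
  then show ?thesis using suminf_diff[OF S(2,1)] by simp
qed

lemma X_continuous_on: "A \<subseteq> {0<..<1} \<Longrightarrow> continuous_on A (X k)"
proof (induction k)
  case 0
  have "X 0 = (\<lambda>t. t)" by (simp add: fun_eq_iff X.simps)
  then show ?case by (simp only: continuous_on_id)
next
  case (Suc k)
  have *: "X (Suc k) = (\<lambda>t. 1 / (1 - ln (X k t)))" by (rule ext) (rule X_Suc_outer)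
  have "X k t \<noteq> 0" "1 - ln (X k t) \<noteq> 0" if "t \<in> A" for t
  proof -
    have "0 < X k t" "X k t < 1" using X_bounds[of t k] Suc.prems that by auto
    then show "X k t \<noteq> 0" "1 - ln (X k t) \<noteq> 0" using ln_less_zero[of "X k t"] by linarith+
  qed
  then show ?case unfolding * by (intro continuous_intros Suc) auto
qed

lemma Xprod_continuous_on: "A \<subseteq> {0<..<1} \<Longrightarrow> continuous_on A (Xprod k)"
  unfolding Xprod_def[abs_def] by (intro continuous_on_prod X_continuous_on)

text \<open>
  The sum of the series is continuous (uniform convergence on compact intervals, dominated by
  the value at the right end) and strictly increasing in \<open>t = 1/c\<close>, at most \<open>1/4\<close> near \<open>0\<close> and
  at least \<open>1/4\<close> further right.
\<close>

lemma kappa_ex1: "\<exists>!c. c > 1 \<and> (\<lambda>i. Xprod (Suc i) (1 / c)) sums (1 / 4)"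
proof -
  define F where "F t = (\<Sum>i. Xprod (Suc i) t)" for t
  \<comment> \<open>At \<open>a\<close> the bound \<open>3 / (- ln t)\<close> equals \<open>1/4\<close>; at \<open>b\<close> the first term of the series equals \<open>1/4\<close>.\<close>
  define a b :: real where "a = exp (-12)" "b = exp (-3)"
  have ab: "0 < a" "a < b" "b < 1" by (auto simp: a_b_def)
  have Fa: "F a \<le> 1 / 4"
    unfolding F_def using Xprod_sum_bound[of a] ab
    by (intro suminf_le_const summable_Xprod) (auto simp: a_b_def)
  have "sum (\<lambda>i. Xprod (Suc i) b) {..<1} \<le> F b"
    unfolding F_def using ab Xprod_pos[of b] by (intro sum_le_suminf summable_Xprod) (auto simp: less_imp_le)
  then have Fb: "1 / 4 \<le> F b" by (simp add: Xprod_Suc X.simps a_b_def)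
  have "uniform_limit {a..b} (\<lambda>n t. \<Sum>i<n. Xprod (Suc i) t) F sequentially"
    unfolding F_def
  proof (rule Weierstrass_m_test)
    show "summable (\<lambda>i. Xprod (Suc i) b)" using ab by (intro summable_Xprod) auto
    show "norm (Xprod (Suc i) t) \<le> Xprod (Suc i) b" if "t \<in> {a..b}" for i t
      using that ab Xprod_mono[of t b "Suc i"] Xprod_pos[of t "Suc i"] by simp
  qed
  moreover have "\<forall>\<^sub>F n in sequentially. continuous_on {a..b} (\<lambda>t. \<Sum>i<n. Xprod (Suc i) t)"
    using ab by (intro always_eventually allI continuous_on_sum Xprod_continuous_on) auto
  ultimately have "continuous_on {a..b} F"
    by (intro uniform_limit_theorem[where F = sequentially and f = "\<lambda>n t. \<Sum>i<n. Xprod (Suc i) t"]) auto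
  with Fa Fb ab obtain t where t: "a \<le> t" "t \<le> b" "F t = 1 / 4"
    using IVT'[of F a "1 / 4" b] by auto
  show ?thesis
  proof (rule ex1I[of _ "1 / t"])
    show "1 / t > 1 \<and> (\<lambda>i. Xprod (Suc i) (1 / (1 / t))) sums (1 / 4)"
      using t ab summable_Xprod[of t] by (auto simp: F_def sums_iff)
    fix c assume c: "c > 1 \<and> (\<lambda>i. Xprod (Suc i) (1 / c)) sums (1 / 4)"
    then have "0 < 1 / c" "1 / c < 1" "F (1 / c) = 1 / 4" by (auto simp: F_def sums_iff)
    then have "1 / c = t"
      using suminf_Xprod_strict_mono[of t "1 / c"] suminf_Xprod_strict_mono[of "1 / c" t] t ab
      by (fastforce simp: F_def)
    then show "c = 1 / t" by auto
  qed
qed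

lemma kappa: "kappa > 1" "(\<lambda>i. Xprod (Suc i) (1 / kappa)) sums (1 / 4)"
  using theI'[OF kappa_ex1] unfolding kappa_def Xprod_def by auto

text \<open>
  The series defining \<open>kappa\<close> bounds this sum by \<open>1/4\<close> on the half ball.  It is also the
  logarithmic derivative of \<open>Xprod m\<close> with respect to \<open>ln t\<close>.
\<close>

definition Xsum :: "nat \<Rightarrow> real \<Rightarrow> real" where
  "Xsum m t = (\<Sum>i=1..m. Xprod i t)"

lemma Xsum_0 [simp]: "Xsum 0 t = 0" by (simp add: Xsum_def)
lemma Xsum_Suc: "Xsum (Suc m) t = Xsum m t + Xprod (Suc m) t" by (simp add: Xsum_def)

lemma Xsum_nonneg: "0 < t \<Longrightarrow> t < 1 \<Longrightarrow> 0 \<le> Xsum m t"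
  unfolding Xsum_def using Xprod_pos by (intro sum_nonneg) (auto simp: less_imp_le)

lemma Xsum_le: "0 < t \<Longrightarrow> t \<le> 1 / kappa \<Longrightarrow> Xsum m t \<le> 1 / 4"
proof -
  assume t: "0 < t" "t \<le> 1 / kappa"
  have k: "0 < 1 / kappa" "1 / kappa < 1" using kappa(1) by auto
  have "Xsum m t \<le> Xsum m (1 / kappa)"
    unfolding Xsum_def by (intro sum_mono Xprod_mono t k)
  also have "\<dots> = (\<Sum>i<m. Xprod (Suc i) (1 / kappa))"
    unfolding Xsum_def by (induction m) auto
  also have "\<dots> \<le> (\<Sum>i. Xprod (Suc i) (1 / kappa))"
    using Xprod_pos[OF k] by (intro sum_le_suminf summable_Xprod k) (auto simp: less_imp_le)
  also have "\<dots> = 1 / 4" using kappa(2) by (simp add: sums_iff)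
  finally show ?thesis .
qed

text \<open>
  Taking the derivative with respect to \<open>ln t\<close>, the recursion
  \<open>X (Suc k) t = 1 / (1 - ln (X k t))\<close> multiplies the logarithmic derivative by \<open>X (Suc k) t\<close>;
  so it is the product of all of them.
\<close>

lemma X_has_derivative:
  "0 < t \<Longrightarrow> t < 1 \<Longrightarrow> (X k has_real_derivative (X k t * Xprod k t / t)) (at t)"
proof (induction k)
  case 0
  have "X 0 = (\<lambda>t. t)" by (simp add: fun_eq_iff X.simps)
  then show ?case using 0 by simp
next
  case (Suc k)
  have *: "X (Suc k) = (\<lambda>t. 1 / (1 - ln (X k t)))" by (rule ext) (rule X_Suc_outer)
  have b: "0 < X k t" "X k t < 1" using X_bounds[OF Suc.prems] by auto
  then have l: "1 - ln (X k t) > 0" using ln_less_zero[of "X k t"] by linarith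
  have "((\<lambda>t. 1 / (1 - ln (X k t))) has_real_derivative (inverse (X k t) * (X k t * Xprod k t / t)) / (1 - ln (X k t))\<^sup>2) (at t)"
    using b l by (auto intro!: derivative_eq_intros Suc.IH[OF Suc.prems] simp: power2_eq_square divide_simps)
  also have "(inverse (X k t) * (X k t * Xprod k t / t)) / (1 - ln (X k t))\<^sup>2 = X (Suc k) t * Xprod (Suc k) t / t"
    using b unfolding Xprod_Suc X_Suc_outer by (simp add: power2_eq_square mult_ac)
  finally show ?case unfolding * .
qed

lemma Xprod_has_derivative:
  "0 < t \<Longrightarrow> t < 1 \<Longrightarrow> (Xprod i has_real_derivative (Xprod i t * Xsum i t / t)) (at t)"
proof (induction i)
  case 0
  have "Xprod 0 = (\<lambda>t. 1)" by (auto simp: fun_eq_iff)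
  then show ?case by simp
next
  case (Suc i)
  have "Xprod (Suc i) = (\<lambda>t. Xprod i t * X (Suc i) t)" by (rule ext) (rule Xprod_Suc)
  moreover have "((\<lambda>t. Xprod i t * X (Suc i) t) has_real_derivative
      (Xprod i t * Xsum i t / t * X (Suc i) t + X (Suc i) t * Xprod (Suc i) t / t * Xprod i t)) (at t)"
    by (rule DERIV_mult[OF Suc.IH[OF Suc.prems] X_has_derivative[OF Suc.prems]])
  moreover have "Xprod i t * Xsum i t / t * X (Suc i) t + X (Suc i) t * Xprod (Suc i) t / t * Xprod i t = Xprod (Suc i) t * Xsum (Suc i) t / t"
    unfolding Xsum_Suc Xprod_Suc by (simp add: algebra_simps add_divide_distrib)
  ultimately show ?case by simp
qed

text \<open>
  The products vary slowly, uniformly in \<open>i\<close>: their logarithmic derivative is at most \<open>1/4\<close>,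
  hence \<open>Xprod i t / sqrt t\<close> decreases.
\<close>

lemma Xprod_quadruple:
  assumes "0 < t" "4 * t \<le> 1 / kappa"
  shows "Xprod i (4 * t) \<le> 2 * Xprod i t"
proof -
  have k: "1 / kappa < 1" using kappa(1) by auto
  have "Xprod i (4 * t) / sqrt (4 * t) \<le> Xprod i t / sqrt t"
  proof (rule DERIV_nonpos_imp_nonincreasing[of t "4 * t" "\<lambda>s. Xprod i s / sqrt s"])
    show "t \<le> 4 * t" using assms by simp
    fix y assume y: "t \<le> y" "y \<le> 4 * t"
    then have y0: "0 < y" "y \<le> 1 / kappa" "y < 1" using assms k by auto
    have "((\<lambda>s. Xprod i s / sqrt s) has_real_derivative
       ((Xprod i y * Xsum i y / y) * sqrt y - Xprod i y * (inverse (sqrt y) / 2)) / (sqrt y * sqrt y)) (at y)"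
      by (rule DERIV_divide[OF Xprod_has_derivative DERIV_real_sqrt]) (use y0 in auto)
    moreover have "(Xprod i y * Xsum i y / y) * sqrt y - Xprod i y * (inverse (sqrt y) / 2) = Xprod i y / sqrt y * (Xsum i y - 1 / 2)"
      using y0 by (simp add: field_simps)
    moreover have "Xprod i y / sqrt y * (Xsum i y - 1 / 2) \<le> 0"
      using Xsum_le[OF y0(1,2), of i] Xprod_pos[OF y0(1,3), of i] y0 by (intro mult_nonneg_nonpos) auto
    ultimately show "\<exists>z. ((\<lambda>s. Xprod i s / sqrt s) has_real_derivative z) (at y) \<and> z \<le> 0"
      using y0 by (metis divide_nonpos_pos real_sqrt_gt_zero mult_pos_pos)
  qed
  then show ?thesis using assms by (simp add: real_sqrt_mult field_simps)
qed

section \<open>Hardy identities from vector fields\<close>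

text \<open>
  Difference quotients have integral zero by translation invariance.  They are dominated by the
  Lipschitz constant on a fixed ball, so the limit may be taken under the integral.
\<close>

lemma integral_directional_derivative_eq_0:
  assumes U: "compact_C1 S U g" and b: "norm b = 1"
  shows "(\<integral>x. g x \<bullet> b \<partial>lborel) = 0"
proof -
  from U obtain K where K: "compact K" "\<And>x. x \<notin> K \<Longrightarrow> U x = 0" "\<And>x. x \<notin> K \<Longrightarrow> g x = 0"
    and cg: "continuous_on UNIV g" and dU: "\<And>x. (U has_derivative (\<lambda>h. g x \<bullet> h)) (at x)"
    by (auto simp: compact_C1_def)
  have cU: "continuous_on A U" for A by (rule compact_C1_continuous[OF U])
  obtain B where B: "\<And>x. x \<in> K \<Longrightarrow> norm x \<le> B" using K(1) compact_imp_bounded bounded_iff by metis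
  have "bounded (g ` K)"
    using K(1) cg by (intro compact_imp_bounded compact_continuous_image continuous_on_subset[OF cg]) auto
  then obtain M0 where M0: "\<And>x. x \<in> K \<Longrightarrow> norm (g x) \<le> M0" unfolding bounded_iff by auto
  define M where "M = max 0 M0"
  have M: "norm (g x) \<le> M" for x using M0[of x] K(3)[of x] by (cases "x \<in> K") (auto simp: M_def)
  have M_nn: "0 \<le> M" by (simp add: M_def)
  have lip: "norm (U y - U x) \<le> M * norm (y - x)" for x y
  proof (rule differentiable_bound[of UNIV U "\<lambda>x h. g x \<bullet> h"])
    show "onorm (\<lambda>h. g z \<bullet> h) \<le> M" for z
    proof (rule onorm_le)
      fix h
      have "norm (g z \<bullet> h) \<le> norm (g z) * norm h" by (simp add: Cauchy_Schwarz_ineq2)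
      also have "\<dots> \<le> M * norm h" by (intro mult_right_mono M) auto
      finally show "norm (g z \<bullet> h) \<le> M * norm h" .
    qed
  qed (use dU in \<open>auto intro: has_derivative_at_withinI\<close>)
  define h where "h n = 1 / real (Suc n)" for n
  have h: "0 < h n" "h n \<le> 1" for n by (auto simp: h_def)
  have h0: "h \<longlonglongrightarrow> 0" unfolding h_def using LIMSEQ_Suc[OF lim_1_over_n] by simp
  define D where "D n x = (U (h n *\<^sub>R b + x) - U x) / h n" for n x
  have IU: "integrable lborel U" by (rule integrable_compact_support[OF K(1) cU K(2)])
  have mU: "U \<in> borel_measurable borel" by (intro borel_measurable_continuous_onI cU)
  have shift: "integrable lborel (\<lambda>x. U (c + x))" "(\<integral>x. U (c + x) \<partial>lborel) = (\<integral>x. U x \<partial>lborel)" for c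
  proof -
    have "distr lborel borel ((+) c) = (lborel :: 'a measure)" by (rule lborel_distr_plus)
    then show "integrable lborel (\<lambda>x. U (c + x))" "(\<integral>x. U (c + x) \<partial>lborel) = (\<integral>x. U x \<partial>lborel)"
      using integrable_distr_eq[of "(+) c" lborel borel U] integral_distr[of "(+) c" lborel borel U] IU mU
      by auto
  qed
  have D0: "(\<integral>x. D n x \<partial>lborel) = 0" for n
    unfolding D_def using shift IU by simp
  have mD: "D n \<in> borel_measurable lborel" for n
    unfolding D_def using shift(1)[of "h n *\<^sub>R b"] mU by (intro borel_measurable_divide borel_measurable_diff) auto
  have bound: "norm (D n x) \<le> indicator (cball 0 (B + 1)) x *\<^sub>R M" for n x
  proof (cases "norm x \<le> B + 1")
    case True
    have "norm (U (h n *\<^sub>R b + x) - U x) \<le> M * h n"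
      using lip[of "h n *\<^sub>R b + x" x] h(1)[of n] b by simp
    then show ?thesis using True h(1)[of n] by (simp add: D_def divide_le_eq)
  next
    case False
    have "norm x \<le> norm (h n *\<^sub>R b + x) + norm (h n *\<^sub>R b)"
      using norm_triangle_ineq4[of "h n *\<^sub>R b + x" "h n *\<^sub>R b"] by simp
    then have "norm (h n *\<^sub>R b + x) > B" using False h[of n] b by simp
    then have "h n *\<^sub>R b + x \<notin> K" using B by force
    moreover have "x \<notin> K" using B False by force
    ultimately show ?thesis using K(2) by (simp add: D_def M_nn)
  qed
  have lim: "(\<lambda>n. D n x) \<longlonglongrightarrow> g x \<bullet> b" for x
  proof -
    have d1: "((\<lambda>t. x + t *\<^sub>R b) has_derivative (\<lambda>t. t *\<^sub>R b)) (at 0)"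
      by (auto intro!: derivative_eq_intros)
    have d2: "(U has_derivative (\<lambda>h. g x \<bullet> h)) (at (x + 0 *\<^sub>R b))" using dU[of x] by simp
    note has_derivative_compose[OF d1 d2]
    then have "((\<lambda>t. U (x + t *\<^sub>R b)) has_field_derivative (g x \<bullet> b)) (at 0)"
      by (simp add: has_field_derivative_def mult_commute_abs)
    then have "(\<lambda>t. (U (x + t *\<^sub>R b) - U x) / t) \<midarrow>0\<rightarrow> g x \<bullet> b" by (simp add: DERIV_def)
    moreover have "filterlim h (at 0) sequentially"
      using h0 h(1) by (auto simp: filterlim_at intro!: always_eventually) (metis less_irrefl)
    ultimately have "(\<lambda>n. (U (x + h n *\<^sub>R b) - U x) / h n) \<longlonglongrightarrow> g x \<bullet> b"
      by (rule filterlim_compose)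
    then show ?thesis by (simp add: D_def add.commute)
  qed
  have "(\<lambda>n. \<integral>x. D n x \<partial>lborel) \<longlonglongrightarrow> (\<integral>x. g x \<bullet> b \<partial>lborel)"
  proof (rule integral_dominated_convergence)
    show "(\<lambda>x. g x \<bullet> b) \<in> borel_measurable lborel"
      using cg by (auto intro!: borel_measurable_continuous_onI continuous_intros)
    show "integrable lborel (\<lambda>x. indicator (cball 0 (B + 1)) x *\<^sub>R M)"
      by (rule borel_integrable_compact) auto
  qed (use mD bound lim in auto)
  then show ?thesis unfolding D0 by (simp add: LIMSEQ_const_iff)
qed

text \<open>
  The factor \<open>\<phi>\<close> need only be differentiable on \<open>S\<close>: outside the support the product vanishes
  identically, whatever \<open>\<phi>\<close> is there.
\<close>

lemma compact_C1_mult: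
  assumes S: "open S" and U: "compact_C1 S U g"
    and d: "\<And>x. x \<in> S \<Longrightarrow> (\<phi> has_derivative (\<lambda>h. \<psi> x \<bullet> h)) (at x)" and c: "continuous_on S \<psi>"
  shows "compact_C1 S (\<lambda>x. \<phi> x * U x) (\<lambda>x. \<phi> x *\<^sub>R g x + U x *\<^sub>R \<psi> x)"
proof -
  from U obtain K where K: "compact K" "K \<subseteq> S" "\<And>x. x \<notin> K \<Longrightarrow> U x = 0" "\<And>x. x \<notin> K \<Longrightarrow> g x = 0"
    and cg: "continuous_on UNIV g" and dU: "\<And>x. (U has_derivative (\<lambda>h. g x \<bullet> h)) (at x)"
    by (auto simp: compact_C1_def)
  have oK: "open (- K)" using K(1) by (simp add: compact_imp_closed open_Compl)
  have "((\<lambda>x. \<phi> x * U x) has_derivative (\<lambda>h. (\<phi> x *\<^sub>R g x + U x *\<^sub>R \<psi> x) \<bullet> h)) (at x)" for x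
  proof (cases "x \<in> S")
    case True
    show ?thesis
      by (rule has_derivative_eq_rhs[OF has_derivative_mult[OF d[OF True] dU]])
         (auto simp: inner_add_left fun_eq_iff)
  next
    case False
    then have x: "x \<in> - K" using K(2) by auto
    \<comment> \<open>Near \<open>x\<close> the product is identically zero.\<close>
    have "((\<lambda>x. 0::real) has_derivative (\<lambda>h. 0)) (at x)" by simp
    then have "((\<lambda>x. \<phi> x * U x) has_derivative (\<lambda>h. 0)) (at x)"
      by (rule has_derivative_transform_within_open[OF _ oK x]) (use K in auto)
    then show ?thesis using x K by simp
  qed
  moreover have "continuous_on (S \<union> - K) (\<lambda>x. \<phi> x *\<^sub>R g x + U x *\<^sub>R \<psi> x)"
  proof (rule continuous_on_open_Un[OF S oK])
    have "continuous_on S \<phi>" by (rule has_derivative_continuous_on[OF has_derivative_at_withinI[OF d]])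
    then show "continuous_on S (\<lambda>x. \<phi> x *\<^sub>R g x + U x *\<^sub>R \<psi> x)"
      by (intro continuous_intros c compact_C1_continuous[OF U] continuous_on_subset[OF cg]) auto
    show "continuous_on (- K) (\<lambda>x. \<phi> x *\<^sub>R g x + U x *\<^sub>R \<psi> x)"
      by (rule continuous_on_eq[of _ "\<lambda>x. 0"]) (use K in auto)
  qed
  moreover have "S \<union> - K = UNIV" using K by auto
  ultimately show ?thesis unfolding compact_C1_def using K by auto
qed

text \<open>
  Apply \<open>integral_directional_derivative_eq_0\<close> to each component of \<open>U\<^sup>2 T\<close>, add the components
  up and complete the square.
\<close>

lemma hardy_identity:
  fixes U :: "'a::euclidean_space \<Rightarrow> real" and T :: "'a \<Rightarrow> 'a"
  assumes S: "open S" and U: "compact_C1 S U g"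
    and T: "\<And>x. x \<in> S \<Longrightarrow> (T has_derivative T' x) (at x)"
    and cT': "\<And>b. b \<in> Basis \<Longrightarrow> continuous_on S (\<lambda>x. T' x b)"
    and P: "\<And>x. x \<in> S \<Longrightarrow> P x = - (\<Sum>b\<in>Basis. T' x b \<bullet> b) - (norm (T x))\<^sup>2"
  shows "(\<integral>x. (norm (g x))\<^sup>2 \<partial>lborel)
    = (\<integral>x. (norm (g x - U x *\<^sub>R T x))\<^sup>2 \<partial>lborel) + (\<integral>x. (U x)\<^sup>2 * P x \<partial>lborel)"
proof -
  from U obtain K where K: "compact K" "K \<subseteq> S" "\<And>x. x \<notin> K \<Longrightarrow> U x = 0" "\<And>x. x \<notin> K \<Longrightarrow> g x = 0"
    and cg: "continuous_on UNIV g" and dU: "\<And>x. (U has_derivative (\<lambda>h. g x \<bullet> h)) (at x)"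
    by (auto simp: compact_C1_def)
  have [continuous_intros]: "continuous_on K U" "continuous_on K g"
    using compact_C1_continuous[OF U] continuous_on_subset[OF cg] by auto
  have "continuous_on S T" by (rule has_derivative_continuous_on[OF has_derivative_at_withinI[OF T]])
  then have [continuous_intros]: "continuous_on K T" using K continuous_on_subset by blast
  have [continuous_intros]: "continuous_on K (\<lambda>x. T' x b)" if "b \<in> Basis" for b
    using cT'[OF that] K continuous_on_subset by blast
  have lin: "linear (T' x)" if "x \<in> S" for x using T[OF that] has_derivative_linear by blast
  \<comment> \<open>The gradient of \<open>U\<^sup>2\<close> in the form in which the product rule delivers it.\<close>
  have U2: "compact_C1 S (\<lambda>x. U x * U x) (\<lambda>x. U x *\<^sub>R g x + U x *\<^sub>R g x)"
    by (rule compact_C1_mult[OF S U dU continuous_on_subset[OF cg]]) simp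
  have comp: "(\<integral>x. (T x \<bullet> b) * (2 * U x * (g x \<bullet> b)) + (U x)\<^sup>2 * (T' x b \<bullet> b) \<partial>lborel) = 0"
    and int: "integrable lborel (\<lambda>x. (T x \<bullet> b) * (2 * U x * (g x \<bullet> b)) + (U x)\<^sup>2 * (T' x b \<bullet> b))"
    if b: "b \<in> Basis" for b
  proof -
    \<comment> \<open>The gradient of the component of \<open>T\<close> in direction \<open>b\<close>.\<close>
    define \<psi> where "\<psi> x = (\<Sum>c\<in>Basis. (T' x c \<bullet> b) *\<^sub>R c)" for x
    have psi: "T' x h \<bullet> b = \<psi> x \<bullet> h" if "x \<in> S" for x h
    proof -
      have "T' x h = T' x (\<Sum>c\<in>Basis. (h \<bullet> c) *\<^sub>R c)" by (simp add: euclidean_representation)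
      also have "\<dots> = (\<Sum>c\<in>Basis. (h \<bullet> c) *\<^sub>R T' x c)"
        using lin[OF that] by (simp add: linear_sum linear_scale)
      finally have e: "T' x h = (\<Sum>c\<in>Basis. (h \<bullet> c) *\<^sub>R T' x c)" .
      show ?thesis
        unfolding e \<psi>_def inner_sum_left inner_scaleR_left
        by (intro sum.cong refl) (simp only: mult.commute inner_commute)
    qed
    have "compact_C1 S (\<lambda>x. (T x \<bullet> b) * (U x * U x)) (\<lambda>x. (T x \<bullet> b) *\<^sub>R (U x *\<^sub>R g x + U x *\<^sub>R g x) + (U x * U x) *\<^sub>R \<psi> x)"
    proof (rule compact_C1_mult[OF S U2])
      show "((\<lambda>x. T x \<bullet> b) has_derivative (\<lambda>h. \<psi> x \<bullet> h)) (at x)" if "x \<in> S" for x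
        using has_derivative_inner_left[OF T[OF that], of b] by (simp add: psi[OF that])
      show "continuous_on S \<psi>" unfolding \<psi>_def by (intro continuous_intros cT')
    qed
    note * = integral_directional_derivative_eq_0[OF this norm_Basis[OF b]]
    have pt: "((T x \<bullet> b) *\<^sub>R (U x *\<^sub>R g x + U x *\<^sub>R g x) + (U x * U x) *\<^sub>R \<psi> x) \<bullet> b
        = (T x \<bullet> b) * (2 * U x * (g x \<bullet> b)) + (U x)\<^sup>2 * (T' x b \<bullet> b)" for x
    proof (cases "x \<in> S")
      case True
      show ?thesis unfolding psi[OF True] by (simp add: inner_add_left power2_eq_square)
    next
      case False
      then have "U x = 0" using K by auto
      then show ?thesis by simp
    qed
    show "(\<integral>x. (T x \<bullet> b) * (2 * U x * (g x \<bullet> b)) + (U x)\<^sup>2 * (T' x b \<bullet> b) \<partial>lborel) = 0"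
      using * unfolding pt .
    show "integrable lborel (\<lambda>x. (T x \<bullet> b) * (2 * U x * (g x \<bullet> b)) + (U x)\<^sup>2 * (T' x b \<bullet> b))"
      by (rule integrable_compact_support[OF K(1)]) (intro continuous_intros b, simp add: K)
  qed
  have "(\<integral>x. (norm (g x))\<^sup>2 - (norm (g x - U x *\<^sub>R T x))\<^sup>2 - (U x)\<^sup>2 * P x \<partial>lborel)
    = (\<integral>x. (\<Sum>b\<in>Basis. (T x \<bullet> b) * (2 * U x * (g x \<bullet> b)) + (U x)\<^sup>2 * (T' x b \<bullet> b)) \<partial>lborel)"
  proof (rule Bochner_Integration.integral_cong[OF refl])
    fix x
    show "(norm (g x))\<^sup>2 - (norm (g x - U x *\<^sub>R T x))\<^sup>2 - (U x)\<^sup>2 * P x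
       = (\<Sum>b\<in>Basis. (T x \<bullet> b) * (2 * U x * (g x \<bullet> b)) + (U x)\<^sup>2 * (T' x b \<bullet> b))"
    proof (cases "x \<in> S")
      case True
      have "(\<Sum>b\<in>Basis. (T x \<bullet> b) * (2 * U x * (g x \<bullet> b)) + (U x)\<^sup>2 * (T' x b \<bullet> b))
         = 2 * U x * (\<Sum>b\<in>Basis. (T x \<bullet> b) * (g x \<bullet> b)) + (U x)\<^sup>2 * (\<Sum>b\<in>Basis. T' x b \<bullet> b)"
        by (simp add: sum.distrib sum_distrib_left mult_ac)
      also have "\<dots> = 2 * U x * (T x \<bullet> g x) + (U x)\<^sup>2 * (- P x - (norm (T x))\<^sup>2)"
        using P[OF True] by (simp add: euclidean_inner[of "T x" "g x"])
      finally show ?thesis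
        unfolding power2_norm_eq_inner
        by (simp add: inner_diff_left inner_diff_right inner_commute algebra_simps power2_eq_square)
    next
      case False
      then have "x \<notin> K" using K(2) by auto
      then show ?thesis by (simp add: K)
    qed
  qed
  also have "\<dots> = 0" using comp int by (simp add: Bochner_Integration.integral_sum)
  finally have 0: "(\<integral>x. (norm (g x))\<^sup>2 - (norm (g x - U x *\<^sub>R T x))\<^sup>2 - (U x)\<^sup>2 * P x \<partial>lborel) = 0" .
  have "integrable lborel (\<lambda>x. (norm (g x))\<^sup>2)" "integrable lborel (\<lambda>x. (norm (g x - U x *\<^sub>R T x))\<^sup>2)"
    by (rule integrable_compact_support[OF K(1)], intro continuous_intros, simp add: K)+
  moreover have "integrable lborel (\<lambda>x. (U x)\<^sup>2 * P x)"
  proof (rule integrable_compact_support[OF K(1)])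
    have "continuous_on K (\<lambda>x. - (\<Sum>b\<in>Basis. T' x b \<bullet> b) - (norm (T x))\<^sup>2)"
      by (intro continuous_intros)
    then have "continuous_on K P" by (rule continuous_on_eq) (use P K in auto)
    then show "continuous_on K (\<lambda>x. (U x)\<^sup>2 * P x)" by (intro continuous_intros)
  qed (use K in auto)
  ultimately show ?thesis using 0 by simp
qed

lemma open_half_ball: "open (half_ball k R)"
proof -
  have "half_ball k R = {x. norm x < R} \<inter> {x. 0 < x $ k}" by (auto simp: half_ball_def)
  then show ?thesis by (auto intro!: open_Int open_Collect_less continuous_intros)
qed

lemma half_ball_norm: "x \<in> half_ball k R \<Longrightarrow> 0 < norm x \<and> norm x < R \<and> 0 < x $ k"
  by (auto simp: half_ball_def)

text \<open>
  For \<open>p = r f'(r)/f(r)\<close> this is \<open>\<nabla>\<phi>/\<phi>\<close> with \<open>\<phi>(x) = x\<^sub>k f(|x|)\<close>.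
\<close>

definition radial_field :: "'n::finite \<Rightarrow> (real \<Rightarrow> real) \<Rightarrow> real ^ 'n \<Rightarrow> real ^ 'n" where
  "radial_field k p x = (1 / x $ k) *\<^sub>R axis k 1 + (p (norm x) / (norm x)\<^sup>2) *\<^sub>R x"

text \<open>
  The potential of \<open>radial_field k p\<close>.  The term \<open>1/x\<^sub>k\<^sup>2\<close> cancels between the divergence and
  the square of the field, as \<open>x\<^sub>k\<close> is harmonic; what remains is radial.
\<close>

lemma radial_hardy_identity:
  fixes U :: "real ^ 'n \<Rightarrow> real" and k :: "'n::finite"
  assumes U: "compact_C1 (half_ball k R) U g"
    and p: "\<And>r. 0 < r \<Longrightarrow> r < R \<Longrightarrow> (p has_real_derivative p' r) (at r)"
    and cp': "continuous_on {0<..<R} p'"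
  shows "(\<integral>x. (norm (g x))\<^sup>2 \<partial>lborel)
    = (\<integral>x. (norm (g x - U x *\<^sub>R radial_field k p x))\<^sup>2 \<partial>lborel)
      + (\<integral>x. (U x)\<^sup>2 * ((- real CARD('n) * p (norm x) - norm x * p' (norm x) - (p (norm x))\<^sup>2) / (norm x)\<^sup>2) \<partial>lborel)"
proof (rule hardy_identity[OF open_half_ball U])
  let ?S = "half_ball k R"
  let ?e = "axis k 1 :: real ^ 'n"
  define G where "G r = p r / r\<^sup>2" for r
  define G' where "G' r = p' r / r\<^sup>2 - 2 * p r / r ^ 3" for r
  define T' where "T' x h = (- (h $ k) / (x $ k)\<^sup>2) *\<^sub>R ?e + (G (norm x) *\<^sub>R h + (G' (norm x) * (x \<bullet> h) / norm x) *\<^sub>R x)" for x h :: "real ^ 'n"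
  have G: "(G has_real_derivative G' r) (at r)" if "0 < r" "r < R" for r
    unfolding G_def G'_def using that
    by (auto intro!: derivative_eq_intros p simp: field_simps eval_nat_numeral)
  have nd: "(norm has_derivative (\<lambda>h. (x \<bullet> h) / norm x)) (at x)" if "x \<noteq> 0" for x :: "real ^ 'n"
    using has_derivative_norm[OF that] by (simp add: sgn_div_norm inner_commute divide_inverse mult.commute)
  show "(radial_field k p has_derivative T' x) (at x)" if x: "x \<in> ?S" for x
  proof -
    have xb: "0 < norm x" "norm x < R" "0 < x $ k" using half_ball_norm[OF x] by auto
    have "((\<lambda>x. G (norm x)) has_derivative (\<lambda>h. G' (norm x) * ((x \<bullet> h) / norm x))) (at x)"
      using has_derivative_compose[OF nd G[OF xb(1,2), unfolded has_field_derivative_def]] xb by simp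
    then show ?thesis
      unfolding radial_field_def[abs_def] G_def[symmetric] T'_def[abs_def]
      using xb by (auto intro!: derivative_eq_intros bounded_linear_imp_has_derivative[OF bounded_linear_vec_nth] simp: field_simps power2_eq_square fun_eq_iff)
  qed
  have cnorm: "continuous_on ?S (\<lambda>x. f (norm x))" if "continuous_on {0<..<R} f" for f :: "real \<Rightarrow> real"
    by (rule continuous_on_compose2[OF that]) (auto simp: half_ball_def intro!: continuous_intros)
  have cp: "continuous_on {0<..<R} p"
    by (rule DERIV_continuous_on) (use p in \<open>auto intro: has_field_derivative_at_within\<close>)
  have cG: "continuous_on ?S (\<lambda>x. G (norm x))" "continuous_on ?S (\<lambda>x. G' (norm x))"
    unfolding G_def G'_def by (intro cnorm continuous_intros cp cp'; force)+
  show "continuous_on ?S (\<lambda>x. T' x b)" for b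
    unfolding T'_def using half_ball_norm
    by (intro continuous_intros cG) (auto simp: half_ball_def)
  show "(- real CARD('n) * p (norm x) - norm x * p' (norm x) - (p (norm x))\<^sup>2) / (norm x)\<^sup>2
      = - (\<Sum>b\<in>Basis. T' x b \<bullet> b) - (norm (radial_field k p x))\<^sup>2" if x: "x \<in> ?S" for x
  proof -
    have xb: "0 < norm x" "norm x < R" "0 < x $ k" using half_ball_norm[OF x] by auto
    define r where "r = norm x"
    have r: "0 < r" using xb by (simp add: r_def)
    have xx: "x \<bullet> x = r\<^sup>2" by (simp add: r_def power2_norm_eq_inner)
    have bk: "b $ k = ?e \<bullet> b" for b :: "real ^ 'n" by (simp add: inner_axis')
    have e1: "(\<Sum>b\<in>Basis. (?e \<bullet> b) * (?e \<bullet> b)) = 1"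
      by (subst euclidean_inner[symmetric]) (simp add: inner_axis_axis)
    have e2: "(\<Sum>b\<in>Basis. (x \<bullet> b) * (x \<bullet> b)) = r\<^sup>2"
      by (subst euclidean_inner[symmetric]) (rule xx)
    have e3: "(\<Sum>b\<in>(Basis::(real^'n) set). b \<bullet> b) = real CARD('n)" by (simp add: inner_Basis)
    have "T' x b \<bullet> b = - 1 / (x $ k)\<^sup>2 * ((?e \<bullet> b) * (?e \<bullet> b)) + G r * (b \<bullet> b) + G' r / r * ((x \<bullet> b) * (x \<bullet> b))" for b
      unfolding T'_def bk r_def[symmetric] inner_add_left inner_scaleR_left by (simp add: mult.assoc)
    then have tr: "(\<Sum>b\<in>Basis. T' x b \<bullet> b) = - 1 / (x $ k)\<^sup>2 + G r * real CARD('n) + G' r * r"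
      using r by (simp only: sum.distrib sum_distrib_left[symmetric] e1 e2 e3) (simp add: power2_eq_square)
    have "(norm (radial_field k p x))\<^sup>2 = 1 / (x $ k)\<^sup>2 + 2 * G r + (G r)\<^sup>2 * r\<^sup>2"
      unfolding power2_norm_eq_inner radial_field_def r_def[symmetric] G_def[symmetric]
      using xb xx by (simp add: inner_add_left inner_add_right inner_axis inner_axis' inner_axis_axis power2_eq_square add_divide_distrib algebra_simps)
    then show ?thesis unfolding tr r_def[symmetric]
      using r by (simp add: G_def G'_def field_simps eval_nat_numeral)
  qed
qed

section \<open>The logarithmic ground state in the half ball\<close>

definition Xsq :: "nat \<Rightarrow> real \<Rightarrow> real" where
  "Xsq m t = (\<Sum>i=1..m. (Xprod i t)\<^sup>2)"

lemma Xsum_has_derivative: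
  assumes "0 < t" "t < 1"
  shows "(Xsum m has_real_derivative (((Xsum m t)\<^sup>2 + Xsq m t) / (2 * t))) (at t)"
proof (induction m)
  case 0
  have "Xsum 0 = (\<lambda>t. 0)" by (simp add: fun_eq_iff)
  then show ?case by (simp add: Xsq_def)
next
  case (Suc m)
  have "Xsum (Suc m) = (\<lambda>t. Xsum m t + Xprod (Suc m) t)" by (rule ext) (rule Xsum_Suc)
  moreover have "((\<lambda>t. Xsum m t + Xprod (Suc m) t) has_real_derivative
      (((Xsum m t)\<^sup>2 + Xsq m t) / (2 * t) + Xprod (Suc m) t * Xsum (Suc m) t / t)) (at t)"
    by (rule DERIV_add[OF Suc Xprod_has_derivative[OF assms]])
  moreover have "((Xsum m t)\<^sup>2 + Xsq m t) / (2 * t) + Xprod (Suc m) t * Xsum (Suc m) t / t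
      = ((Xsum (Suc m) t)\<^sup>2 + Xsq (Suc m) t) / (2 * t)"
    using assms by (simp add: Xsum_Suc Xsq_def field_simps power2_eq_square)
  ultimately show ?case by simp
qed

lemma Xsq_nonneg: "0 \<le> Xsq m t" unfolding Xsq_def by (intro sum_nonneg) auto

lemma Xsq_le:
  assumes "0 < t" "t < 1" shows "Xsq m t \<le> (Xsum m t)\<^sup>2"
proof (induction m)
  case (Suc m)
  have "0 \<le> Xsum m t * Xprod (Suc m) t"
    using Xsum_nonneg[OF assms] Xprod_pos[OF assms] by (simp add: less_imp_le)
  with Suc show ?case by (simp add: Xsq_def Xsum_Suc power2_sum)
qed (simp add: Xsq_def)

lemma scaled_radius_range:
  assumes "0 < r" "r \<le> R"
  shows "0 < r / (kappa * R)" "r / (kappa * R) \<le> 1 / kappa" "r / (kappa * R) < 1"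
proof -
  have R: "0 < R" and k: "kappa > 1" using assms kappa(1) by auto
  then show "0 < r / (kappa * R)" "r / (kappa * R) \<le> 1 / kappa" using assms by (auto simp: field_simps)
  moreover have "1 / kappa < 1" using k by simp
  ultimately show "r / (kappa * R) < 1" by linarith
qed

lemma Xprod_scaled_derivative:
  assumes "0 < r" "r < R"
  shows "((\<lambda>r. Xprod i (r / (kappa * R))) has_real_derivative
     (Xprod i (r / (kappa * R)) * Xsum i (r / (kappa * R)) / r)) (at r)"
proof -
  define c where "c = kappa * R"
  have t: "0 < r / c" "r / c < 1" using scaled_radius_range[of r R] assms by (auto simp: c_def)
  then have c0: "c \<noteq> 0" by (metis div_by_0 less_irrefl)
  have d: "((\<lambda>r. r / c) has_real_derivative (1 / c)) (at r)" by (rule DERIV_cdivide[OF DERIV_ident])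
  have "((\<lambda>r. Xprod i (r / c)) has_real_derivative
     (Xprod i (r / c) * Xsum i (r / c) / (r / c) * (1 / c))) (at r)"
    by (rule DERIV_chain2[OF Xprod_has_derivative d]) (use t in auto)
  then show ?thesis using c0 by (simp flip: c_def)
qed

lemma Xsum_scaled_derivative:
  assumes "0 < r" "r < R"
  shows "((\<lambda>r. Xsum m (r / (kappa * R))) has_real_derivative
     (((Xsum m (r / (kappa * R)))\<^sup>2 + Xsq m (r / (kappa * R))) / (2 * r))) (at r)"
proof -
  define c where "c = kappa * R"
  have t: "0 < r / c" "r / c < 1" using scaled_radius_range[of r R] assms by (auto simp: c_def)
  then have c0: "c \<noteq> 0" by (metis div_by_0 less_irrefl)
  have d: "((\<lambda>r. r / c) has_real_derivative (1 / c)) (at r)" by (rule DERIV_cdivide[OF DERIV_ident])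
  have "((\<lambda>r. Xsum m (r / c)) has_real_derivative
     (((Xsum m (r / c))\<^sup>2 + Xsq m (r / c)) / (2 * (r / c)) * (1 / c))) (at r)"
    by (rule DERIV_chain2[OF Xsum_has_derivative d]) (use t in auto)
  then show ?thesis using c0 by (simp flip: c_def)
qed

lemma Xprod_scaled_continuous: "continuous_on {0<..<R} (\<lambda>r. Xprod i (r / (kappa * R)))"
  by (rule DERIV_continuous_on[OF has_field_derivative_at_within[OF Xprod_scaled_derivative]]) auto
lemma Xsum_scaled_continuous: "continuous_on {0<..<R} (\<lambda>r. Xsum i (r / (kappa * R)))"
  by (rule DERIV_continuous_on[OF has_field_derivative_at_within[OF Xsum_scaled_derivative]]) auto
lemma Xsq_scaled_continuous: "continuous_on {0<..<R} (\<lambda>r. Xsq i (r / (kappa * R)))"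
  unfolding Xsq_def by (intro continuous_intros Xprod_scaled_continuous)

lemma radial_weight_continuous:
  assumes "continuous_on {0<..<R} F" "K \<subseteq> half_ball k R"
  shows "continuous_on K (\<lambda>x. F (norm x))"
proof (rule continuous_on_compose2[OF assms(1)])
  show "norm ` K \<subseteq> {0<..<R}" using assms(2) half_ball_norm by fastforce
qed (intro continuous_intros)

lemma integrable_weighted_square:
  assumes U: "compact_C1 (half_ball k R) U g" and F: "continuous_on {0<..<R} F"
  shows "integrable lborel (\<lambda>x. (U x)\<^sup>2 * F (norm x))"
proof -
  from U obtain K where K: "compact K" "K \<subseteq> half_ball k R" "\<And>x. x \<notin> K \<Longrightarrow> U x = 0"
    by (auto simp: compact_C1_def)
  show ?thesis
    by (rule integrable_compact_support[OF K(1)])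
       (intro continuous_intros compact_C1_continuous[OF U] radial_weight_continuous[OF F K(2)], simp add: K)
qed

lemma radial_field_continuous:
  assumes "continuous_on {0<..<R} p" "K \<subseteq> half_ball k R"
  shows "continuous_on K (radial_field k p)"
  unfolding radial_field_def[abs_def] using assms(2)
  by (intro continuous_intros radial_weight_continuous[OF assms]) (auto simp: half_ball_def)

lemma integrable_deficit:
  assumes U: "compact_C1 (half_ball k R) U g" and p: "continuous_on {0<..<R} p"
  shows "integrable lborel (\<lambda>x. (norm (g x - U x *\<^sub>R radial_field k p x))\<^sup>2)"
proof -
  from U obtain K where K: "compact K" "K \<subseteq> half_ball k R" "\<And>x. x \<notin> K \<Longrightarrow> U x = 0" "\<And>x. x \<notin> K \<Longrightarrow> g x = 0"
    and cg: "continuous_on UNIV g"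
    by (auto simp: compact_C1_def)
  show ?thesis
    by (rule integrable_compact_support[OF K(1)])
       (intro continuous_intros compact_C1_continuous[OF U] radial_field_continuous[OF p K(2)] continuous_on_subset[OF cg], simp_all add: K)
qed

text \<open>
  The field \<open>\<nabla>\<phi>/\<phi>\<close> for \<open>\<phi>(x) = x\<^sub>k |x| powr (-n/2) (X\<^sub>1 ... X\<^sub>m) powr (-1/2) f(|x|)\<close>, where
  \<open>w = r f'(r)/f(r)\<close> is the freedom left for a further radial factor.
\<close>

definition ground_field :: "'n::finite \<Rightarrow> real \<Rightarrow> nat \<Rightarrow> (real \<Rightarrow> real) \<Rightarrow> real ^ 'n \<Rightarrow> real ^ 'n" where
  "ground_field k R m w = radial_field k (\<lambda>r. - real CARD('n) / 2 - Xsum m (r / (kappa * R)) / 2 + w r)"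

lemma integrable_ground_deficit:
  assumes U: "compact_C1 (half_ball k R) U g" and w: "continuous_on {0<..<R} w"
  shows "integrable lborel (\<lambda>x. (norm (g x - U x *\<^sub>R ground_field k R m w x))\<^sup>2)"
  unfolding ground_field_def
  by (intro integrable_deficit[OF U] continuous_on_add continuous_on_diff continuous_on_divide continuous_on_const Xsum_scaled_continuous w) auto

text \<open>
  With \<open>p = -n/2 + h\<close> the radial potential is \<open>(n\<^sup>2/4 - r h' - h\<^sup>2)/r\<^sup>2\<close>.  For \<open>h = - Xsum/2\<close>
  the square of the sum cancels against the derivative, which leaves exactly \<open>Xsq/4\<close>; the
  bracket with \<open>w\<close> is the change of the potential caused by \<open>w\<close>.
\<close>

lemma log_hardy_identity:
  fixes U :: "real ^ 'n \<Rightarrow> real" and k :: "'n::finite"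
  assumes U: "compact_C1 (half_ball k R) U g"
    and w: "\<And>r. 0 < r \<Longrightarrow> r < R \<Longrightarrow> (w has_real_derivative w' r) (at r)"
    and cw': "continuous_on {0<..<R} w'"
  shows "(\<integral>x. (norm (g x))\<^sup>2 \<partial>lborel)
    = (\<integral>x. (norm (g x - U x *\<^sub>R ground_field k R m w x))\<^sup>2 \<partial>lborel)
      + (\<integral>x. (U x)\<^sup>2 * (((real CARD('n))\<^sup>2 / 4 + Xsq m (norm x / (kappa * R)) / 4
          + (- norm x * w' (norm x) + Xsum m (norm x / (kappa * R)) * w (norm x) - (w (norm x))\<^sup>2)) / (norm x)\<^sup>2) \<partial>lborel)"
proof -
  let ?n = "real CARD('n)"
  define S where "S r = Xsum m (r / (kappa * R))" for r
  define Q where "Q r = Xsq m (r / (kappa * R))" for r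
  define p where "p r = - ?n / 2 - S r / 2 + w r" for r
  define p' where "p' r = - ((S r)\<^sup>2 + Q r) / (4 * r) + w' r" for r
  have dS: "(S has_real_derivative (((S r)\<^sup>2 + Q r) / (2 * r))) (at r)" if "0 < r" "r < R" for r
    using Xsum_scaled_derivative[OF that, of m] by (simp add: S_def[abs_def] Q_def)
  have dp: "(p has_real_derivative p' r) (at r)" if "0 < r" "r < R" for r
    unfolding p_def p'_def
    using that by (auto intro!: derivative_eq_intros dS[OF that] w[OF that] simp: field_simps)
  have cS: "continuous_on {0<..<R} S" unfolding S_def by (rule Xsum_scaled_continuous)
  have cQ: "continuous_on {0<..<R} Q" unfolding Q_def by (rule Xsq_scaled_continuous)
  have cp': "continuous_on {0<..<R} p'"
    unfolding p'_def by (intro continuous_intros cS cQ cw') auto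
  have fld: "ground_field k R m w = radial_field k p"
    by (simp add: ground_field_def p_def[abs_def] S_def)
  have alg: "- ?n * p r - r * p' r - (p r)\<^sup>2 = ?n\<^sup>2 / 4 + Q r / 4 + (- r * w' r + S r * w r - (w r)\<^sup>2)" if "r \<noteq> 0" for r
  proof -
    \<comment> \<open>The cross terms of \<open>n\<close> cancel between \<open>- n p\<close> and \<open>- p\<^sup>2\<close>.\<close>
    have "r * p' r = - ((S r)\<^sup>2 + Q r) / 4 + r * w' r" using that by (simp add: p'_def field_simps)
    then show ?thesis by (simp add: p_def power2_eq_square field_simps)
  qed
  have "(\<integral>x. (U x)\<^sup>2 * ((- ?n * p (norm x) - norm x * p' (norm x) - (p (norm x))\<^sup>2) / (norm x)\<^sup>2) \<partial>lborel)
     = (\<integral>x. (U x)\<^sup>2 * ((?n\<^sup>2 / 4 + Q (norm x) / 4 + (- norm x * w' (norm x) + S (norm x) * w (norm x) - (w (norm x))\<^sup>2)) / (norm x)\<^sup>2) \<partial>lborel)"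
  proof (rule Bochner_Integration.integral_cong[OF refl])
    fix x :: "real ^ 'n"
    show "(U x)\<^sup>2 * ((- ?n * p (norm x) - norm x * p' (norm x) - (p (norm x))\<^sup>2) / (norm x)\<^sup>2)
     = (U x)\<^sup>2 * ((?n\<^sup>2 / 4 + Q (norm x) / 4 + (- norm x * w' (norm x) + S (norm x) * w (norm x) - (w (norm x))\<^sup>2)) / (norm x)\<^sup>2)"
    proof (cases "norm x = 0")
      case False
      then show ?thesis by (simp only: alg[OF False])
    qed simp
  qed
  with radial_hardy_identity[OF U dp cp'] show ?thesis
    unfolding fld by (simp add: S_def Q_def)
qed

text \<open>
  The deficit is what the Hardy inequality with logarithmic weights gives away.
\<close>

abbreviation (input) deficit where
  "deficit k R m U g \<equiv> (\<integral>x. (norm (g x - U x *\<^sub>R ground_field k R m (\<lambda>_. 0) x))\<^sup>2 \<partial>lborel)"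

text \<open>
  Write the Dirichlet integral with the ground field and with its perturbation by \<open>w = - Y \<theta>\<close>,
  where \<open>Y\<close> is the product of the first \<open>m+1\<close> iterated logarithms.  As \<open>r Y' = Y (Xsum m + Y)\<close>,
  the terms containing \<open>Xsum m\<close> drop out of the difference of the potentials.
\<close>

lemma deficit_lower_bound:
  fixes U :: "real ^ 'n \<Rightarrow> real" and k :: "'n::finite"
  assumes U: "compact_C1 (half_ball k R) U g"
    and d: "\<And>r. 0 < r \<Longrightarrow> r < R \<Longrightarrow> (\<theta> has_real_derivative \<theta>' r) (at r)"
    and c: "continuous_on {0<..<R} \<theta>'"
  shows "(\<integral>x. (U x)\<^sup>2 * ((Xprod (Suc m) (norm x / (kappa * R)) * (norm x * \<theta>' (norm x))
          + (Xprod (Suc m) (norm x / (kappa * R)))\<^sup>2 * (\<theta> (norm x) * (1 - \<theta> (norm x)))) / (norm x)\<^sup>2) \<partial>lborel)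
    \<le> deficit k R m U g"
proof -
  let ?n = "real CARD('n)"
  define S where "S r = Xsum m (r / (kappa * R))" for r
  define Q where "Q r = Xsq m (r / (kappa * R))" for r
  define Y where "Y r = Xprod (Suc m) (r / (kappa * R))" for r
  define w where "w r = - (Y r * \<theta> r)" for r
  define w' where "w' r = - (Y r * (S r + Y r) / r * \<theta> r + Y r * \<theta>' r)" for r
  define E where "E r = (Y r * (r * \<theta>' r) + (Y r)\<^sup>2 * (\<theta> r * (1 - \<theta> r)))" for r
  have dY: "(Y has_real_derivative (Y r * (S r + Y r) / r)) (at r)" if "0 < r" "r < R" for r
    using Xprod_scaled_derivative[OF that, of "Suc m"] by (simp add: S_def Y_def[abs_def] Xsum_Suc)
  have cS: "continuous_on {0<..<R} S" unfolding S_def by (rule Xsum_scaled_continuous)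
  have cQ: "continuous_on {0<..<R} Q" unfolding Q_def by (rule Xsq_scaled_continuous)
  have cY: "continuous_on {0<..<R} Y" unfolding Y_def by (rule Xprod_scaled_continuous)
  have cx: "continuous_on {0<..<R} \<theta>"
    by (rule DERIV_continuous_on[OF has_field_derivative_at_within[OF d]]) auto
  have dw: "(w has_real_derivative w' r) (at r)" if "0 < r" "r < R" for r
    unfolding w_def w'_def
    by (auto intro!: derivative_eq_intros dY[OF that] d[OF that])
  have cw': "continuous_on {0<..<R} w'"
    unfolding w'_def by (intro continuous_intros cS cY cx c) auto
  define A where "A r = (?n\<^sup>2 / 4 + Q r / 4 + (- r * 0 + S r * 0 - 0\<^sup>2)) / r\<^sup>2" for r
  define B where "B r = (?n\<^sup>2 / 4 + Q r / 4 + (- r * w' r + S r * w r - (w r)\<^sup>2)) / r\<^sup>2" for r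
  have cont: "continuous_on {0<..<R} (\<lambda>r. A r)" "continuous_on {0<..<R} (\<lambda>r. E r / r\<^sup>2)"
    unfolding A_def E_def by (intro continuous_intros cS cQ cY cx c; simp)+
  have BA: "B r = A r + E r / r\<^sup>2" if "r \<noteq> 0" for r
  proof -
    have "- r * w' r + S r * w r - (w r)\<^sup>2 = E r"
      using that by (simp add: w'_def w_def E_def power2_eq_square field_simps)
    then show ?thesis by (simp add: A_def B_def add_divide_distrib)
  qed
  have BA': "(U x)\<^sup>2 * B (norm x) = (U x)\<^sup>2 * A (norm x) + (U x)\<^sup>2 * (E (norm x) / (norm x)\<^sup>2)" for x
  proof (cases "norm x = 0")
    case True
    then show ?thesis by (simp add: A_def B_def)
  next
    case False
    show ?thesis unfolding BA[OF False] by (simp add: algebra_simps)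
  qed
  have "deficit k R m U g + (\<integral>x. (U x)\<^sup>2 * A (norm x) \<partial>lborel) = (\<integral>x. (norm (g x))\<^sup>2 \<partial>lborel)"
    using log_hardy_identity[OF U, of "\<lambda>_. 0" "\<lambda>_. 0" m] by (simp add: A_def S_def Q_def)
  also have "\<dots> = (\<integral>x. (norm (g x - U x *\<^sub>R ground_field k R m w x))\<^sup>2 \<partial>lborel) + (\<integral>x. (U x)\<^sup>2 * B (norm x) \<partial>lborel)"
    using log_hardy_identity[OF U dw cw', of m] by (simp add: B_def S_def Q_def)
  also have "(\<integral>x. (U x)\<^sup>2 * B (norm x) \<partial>lborel)
      = (\<integral>x. (U x)\<^sup>2 * A (norm x) \<partial>lborel) + (\<integral>x. (U x)\<^sup>2 * (E (norm x) / (norm x)\<^sup>2) \<partial>lborel)"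
    unfolding BA' using integrable_weighted_square[OF U cont(1)] integrable_weighted_square[OF U cont(2)] by simp
  finally have "(\<integral>x. (U x)\<^sup>2 * (E (norm x) / (norm x)\<^sup>2) \<partial>lborel) \<le> deficit k R m U g" by simp
  then show ?thesis by (simp add: E_def Y_def)
qed

lemma log_hardy_remainder:
  fixes U :: "real ^ 'n \<Rightarrow> real" and k :: "'n::finite"
  assumes U: "compact_C1 (half_ball k R) U g"
  shows "(\<integral>x. (U x)\<^sup>2 * ((Xprod (Suc m) (norm x / (kappa * R)))\<^sup>2 / (norm x)\<^sup>2) \<partial>lborel) \<le> 4 * deficit k R m U g"
proof -
  have "(\<integral>x. (1 / 4) * ((U x)\<^sup>2 * ((Xprod (Suc m) (norm x / (kappa * R)))\<^sup>2 / (norm x)\<^sup>2)) \<partial>lborel) \<le> deficit k R m U g"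
    using deficit_lower_bound[OF U, of "\<lambda>_. 1 / 2" "\<lambda>_. 0" m] by (simp add: mult.commute)
  then show ?thesis unfolding integral_mult_right_zero by simp
qed

text \<open>
  The increasing function \<open>\<theta>\<close> makes most of its rise from \<open>0\<close> to \<open>1\<close> on the shell, so \<open>r \<theta>'\<close> is
  bounded below there.  Compared with \<open>log_hardy_remainder\<close>, the smaller weight \<open>Y\<^sup>2\<close> is
  replaced by \<open>Y\<close>, at the price of seeing only one shell.
\<close>

lemma log_hardy_on_shell:
  fixes U :: "real ^ 'n \<Rightarrow> real" and k :: "'n::finite"
  assumes U: "compact_C1 (half_ball k R) U g" and \<rho>: "0 < \<rho>"
  shows "(\<integral>x. indicator {x. \<rho> / 4 < norm x \<and> norm x < 2 * \<rho>} x * ((U x)\<^sup>2 * (Xprod (Suc m) (norm x / (kappa * R)) / (norm x)\<^sup>2)) \<partial>lborel)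
    \<le> 10 * deficit k R m U g"
proof -
  define Y where "Y r = Xprod (Suc m) (r / (kappa * R))" for r
  define \<theta> where "\<theta> r = r\<^sup>2 / (r\<^sup>2 + \<rho>\<^sup>2)" for r
  define \<theta>' where "\<theta>' r = 2 * r * \<rho>\<^sup>2 / (r\<^sup>2 + \<rho>\<^sup>2)\<^sup>2" for r
  have den: "r\<^sup>2 + \<rho>\<^sup>2 > 0" for r using \<rho> by (simp add: add_nonneg_pos)
  have den': "r\<^sup>2 + \<rho>\<^sup>2 \<noteq> 0" for r using den[of r] by (metis less_irrefl)
  have d: "(\<theta> has_real_derivative \<theta>' r) (at r)" for r
    unfolding \<theta>_def \<theta>'_def using den'[of r] \<rho>
    by (auto intro!: derivative_eq_intros simp: power2_eq_square field_simps)
  have c: "continuous_on A \<theta>'" "continuous_on A \<theta>" for A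
    unfolding \<theta>_def \<theta>'_def using \<rho> by (intro continuous_intros; simp)+
  have cY: "continuous_on {0<..<R} Y" unfolding Y_def by (rule Xprod_scaled_continuous)
  define E where "E r = (Y r * (r * \<theta>' r) + (Y r)\<^sup>2 * (\<theta> r * (1 - \<theta> r))) / r\<^sup>2" for r
  have cE: "continuous_on {0<..<R} (\<lambda>r. E r)" "continuous_on {0<..<R} (\<lambda>r. Y r / r\<^sup>2)"
    unfolding E_def by (intro continuous_intros cY c; simp)+
  have m: "{x. \<rho> / 4 < norm x \<and> norm x < 2 * \<rho>} \<in> sets (borel :: (real ^ 'n) measure)"
    by (intro borel_open open_Collect_conj open_Collect_less continuous_intros)
  have "(\<integral>x. indicator {x. \<rho> / 4 < norm x \<and> norm x < 2 * \<rho>} x * ((U x)\<^sup>2 * (Y (norm x) / (norm x)\<^sup>2)) \<partial>lborel)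
     \<le> (\<integral>x. 10 * ((U x)\<^sup>2 * E (norm x)) \<partial>lborel)"
  proof (rule integral_mono)
    show "integrable lborel (\<lambda>x. indicator {x. \<rho> / 4 < norm x \<and> norm x < 2 * \<rho>} x * ((U x)\<^sup>2 * (Y (norm x) / (norm x)\<^sup>2)))"
      using integrable_mult_indicator[OF _ integrable_weighted_square[OF U cE(2)]] m by simp
    show "integrable lborel (\<lambda>x. 10 * ((U x)\<^sup>2 * E (norm x)))"
      using integrable_weighted_square[OF U cE(1)] by simp
    fix x :: "real ^ 'n"
    show "indicator {x. \<rho> / 4 < norm x \<and> norm x < 2 * \<rho>} x * ((U x)\<^sup>2 * (Y (norm x) / (norm x)\<^sup>2)) \<le> 10 * ((U x)\<^sup>2 * E (norm x))"
    proof (cases "U x = 0")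
      case False
      define r where "r = norm x"
      have xb: "x \<in> half_ball k R" using U False by (auto simp: compact_C1_def)
      then have r: "0 < r" "r < R" using half_ball_norm by (auto simp: r_def)
      have Y: "0 < Y r" using scaled_radius_range[of r R] r Xprod_pos by (auto simp: Y_def)
      have xi: "0 \<le> \<theta> r" "\<theta> r \<le> 1" using den[of r] by (auto simp: \<theta>_def)
      have xi': "0 \<le> r * \<theta>' r" using r by (simp add: \<theta>'_def)
      have E0: "Y r * (r * \<theta>' r) / r\<^sup>2 \<le> E r"
        unfolding E_def using xi by (intro divide_right_mono) auto
      have "indicator {x. \<rho> / 4 < norm x \<and> norm x < 2 * \<rho>} x * (Y r / r\<^sup>2) \<le> 10 * E r"
      proof (cases "\<rho> / 4 < r \<and> r < 2 * \<rho>")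
        case True
        have "0 \<le> (16 * r\<^sup>2 - \<rho>\<^sup>2) * (4 * \<rho>\<^sup>2 - r\<^sup>2)"
        proof -
          have "\<rho>\<^sup>2 \<le> (4 * r)\<^sup>2" "r\<^sup>2 \<le> (2 * \<rho>)\<^sup>2" using True r \<rho> by (intro power_mono; simp)+
          then show ?thesis by (intro mult_nonneg_nonneg) (auto simp: power_mult_distrib)
        qed
        then have ab: "0 \<le> (16 * a - b) * (4 * b - a)" if "a = r\<^sup>2" "b = \<rho>\<^sup>2" for a b using that by simp
        \<comment> \<open>On the fat shell \<open>a = r\<^sup>2\<close> and \<open>b = \<rho>\<^sup>2\<close> satisfy \<open>b \<le> 16 a\<close> and \<open>a \<le> 4 b\<close>.\<close>
        have arith: "(a + b)\<^sup>2 \<le> 10 * (2 * a * b)" if "0 \<le> (16 * a - b) * (4 * b - a)" "0 \<le> a * b" for a b :: real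
        proof -
          have "16 * a\<^sup>2 + 4 * b\<^sup>2 \<le> 65 * (a * b)" using that(1) by (simp add: power2_eq_square algebra_simps)
          moreover have "0 \<le> a\<^sup>2" by simp
          ultimately have "a\<^sup>2 + b\<^sup>2 \<le> 18 * (a * b)" using that(2) by linarith
          then show ?thesis by (simp add: power2_sum)
        qed
        have "(r\<^sup>2 + \<rho>\<^sup>2)\<^sup>2 \<le> 10 * (2 * r\<^sup>2 * \<rho>\<^sup>2)"
          by (rule arith[OF ab]) auto
        then have "1 \<le> 10 * (2 * r\<^sup>2 * \<rho>\<^sup>2) / (r\<^sup>2 + \<rho>\<^sup>2)\<^sup>2"
          using den[of r] by (subst le_divide_eq_1_pos) auto
        also have "\<dots> = 10 * (r * \<theta>' r)" by (simp add: \<theta>'_def power2_eq_square)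
        finally have "1 \<le> 10 * (r * \<theta>' r)" .
        then have "Y r / r\<^sup>2 * 1 \<le> Y r / r\<^sup>2 * (10 * (r * \<theta>' r))" using Y by (intro mult_left_mono) auto
        also have "\<dots> = 10 * (Y r * (r * \<theta>' r) / r\<^sup>2)" by simp
        finally show ?thesis using E0 True by (simp add: r_def)
      next
        case False
        have "0 \<le> Y r * (r * \<theta>' r) / r\<^sup>2" using Y xi' by simp
        with E0 have "0 \<le> E r" by linarith
        then show ?thesis using False by (auto simp: r_def)
      qed
      from mult_left_mono[OF this, of "(U x)\<^sup>2"] show ?thesis by (simp add: r_def mult_ac)
    qed simp
  qed
  also have "\<dots> = 10 * (\<integral>x. (U x)\<^sup>2 * E (norm x) \<partial>lborel)" by simp
  also have "\<dots> \<le> 10 * deficit k R m U g"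
    using deficit_lower_bound[OF U d c(1), of m] by (simp add: E_def Y_def)
  finally show ?thesis by (simp add: Y_def)
qed

section \<open>A Sobolev bound for the deficit\<close>

lemma pos_part_square_derivative:
  "((\<lambda>t::real. (max 0 t)\<^sup>2) has_real_derivative (2 * max 0 t)) (at t)"
proof (cases t "0 :: real" rule: linorder_cases)
  case greater
  have "((\<lambda>t. t\<^sup>2) has_real_derivative (2 * t)) (at t)" by (auto intro!: derivative_eq_intros)
  moreover have "\<forall>\<^sub>F s in nhds t. (max 0 s)\<^sup>2 = s\<^sup>2"
    using eventually_nhds_in_open[of "{0<..}" t] greater by (auto elim!: eventually_mono)
  ultimately show ?thesis using greater by (subst DERIV_cong_ev[OF refl _ refl]) auto
next
  case less
  have "\<forall>\<^sub>F s in nhds t. (max 0 s)\<^sup>2 = 0"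
    using eventually_nhds_in_open[of "{..<0}" t] less by (auto elim!: eventually_mono)
  then show ?thesis using less by (subst DERIV_cong_ev[OF refl _ refl, where g = "\<lambda>_. 0"]) auto
next
  case equal
  have "((\<lambda>h::real. max 0 h) \<longlongrightarrow> max 0 0) (at 0)" by (intro tendsto_intros)
  moreover have "((max 0 h)\<^sup>2 - 0) / h = max 0 h" if "h \<noteq> 0" for h :: real
    using that by (auto simp: max_def power2_eq_square)
  ultimately have "((\<lambda>h::real. ((max 0 h)\<^sup>2 - 0) / h) \<longlongrightarrow> 0) (at 0)"
    by (subst tendsto_cong) (auto simp: eventually_at_filter)
  then show ?thesis using equal by (simp add: DERIV_def)
qed

definition shell :: "real \<Rightarrow> 'a::euclidean_space set" where
  "shell \<rho> = {x. \<rho> / 2 < norm x \<and> norm x \<le> \<rho>}"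
definition fat_shell :: "real \<Rightarrow> 'a::euclidean_space set" where
  "fat_shell \<rho> = {x. \<rho> / 4 < norm x \<and> norm x < 2 * \<rho>}"

lemma shell_measurable [measurable]: "shell \<rho> \<in> sets borel" unfolding shell_def by measurable
lemma fat_shell_measurable [measurable]: "fat_shell \<rho> \<in> sets borel" unfolding fat_shell_def by measurable

text \<open>
  A cutoff built from \<open>(s - 1/16)(4 - s)\<close> with \<open>s = |x|\<^sup>2/\<rho>\<^sup>2\<close>; squaring the positive part makes
  it continuously differentiable.  The size of its gradient is at most a constant over \<open>|x|\<close>,
  independently of \<open>\<rho>\<close>.
\<close>

lemma shell_cutoff:
  assumes \<rho>: "0 < \<rho>"
  obtains \<eta> :: "'a::euclidean_space \<Rightarrow> real" and \<psi> where
    "\<And>x. (\<eta> has_derivative (\<lambda>h. \<psi> x \<bullet> h)) (at x)" "continuous_on UNIV \<psi>"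
    "\<And>x. x \<in> shell \<rho> \<Longrightarrow> 1 \<le> \<eta> x"
    "\<And>x. x \<notin> fat_shell \<rho> \<Longrightarrow> \<eta> x = 0 \<and> \<psi> x = 0"
    "\<And>x. \<bar>\<eta> x\<bar> \<le> 6000" "\<And>x. norm (\<psi> x) * norm x \<le> 6000"
proof -
  define s where "s x = (x \<bullet> x) / \<rho>\<^sup>2" for x :: 'a
  define \<omega> where "\<omega> t = (t - 1 / 16) * (4 - t)" for t :: real
  define \<eta> where "\<eta> x = 4 * (max 0 (\<omega> (s x)))\<^sup>2" for x
  define \<psi> where "\<psi> x = (16 * max 0 (\<omega> (s x)) * (65 / 16 - 2 * s x) / \<rho>\<^sup>2) *\<^sub>R x" for x
  have sn: "s x = (norm x / \<rho>)\<^sup>2" for x by (simp add: s_def power2_norm_eq_inner power_divide)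
  have ds: "(s has_derivative (\<lambda>h. 2 * (x \<bullet> h) / \<rho>\<^sup>2)) (at x)" for x
  proof -
    have "((\<lambda>x. x \<bullet> x) has_derivative (\<lambda>h. 2 * (x \<bullet> h))) (at x)"
      by (auto intro!: derivative_eq_intros simp: inner_commute)
    from has_derivative_mult_right[OF this, of "1 / \<rho>\<^sup>2"] show ?thesis by (simp add: s_def[abs_def])
  qed
  have dw: "((\<lambda>t. 4 * (max 0 (\<omega> t))\<^sup>2) has_real_derivative (8 * max 0 (\<omega> t) * (65 / 16 - 2 * t))) (at t)" for t
  proof -
    have "(\<omega> has_real_derivative (65 / 16 - 2 * t)) (at t)"
      unfolding \<omega>_def[abs_def] by (auto intro!: derivative_eq_intros simp: algebra_simps)
    show ?thesis
      by (rule DERIV_cong[OF DERIV_cmult[OF DERIV_chain2[OF pos_part_square_derivative \<open>(\<omega> has_real_derivative _) _\<close>]]]) simp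
  qed
  have 1: "(\<eta> has_derivative (\<lambda>h. \<psi> x \<bullet> h)) (at x)" for x
    unfolding \<eta>_def[abs_def]
    by (rule has_derivative_eq_rhs[OF has_derivative_compose[OF ds dw[unfolded has_field_derivative_def]]])
       (simp add: \<psi>_def fun_eq_iff algebra_simps add_divide_distrib diff_divide_distrib)
  have cs: "continuous_on UNIV s" unfolding s_def using \<rho> by (intro continuous_intros) auto
  have 2: "continuous_on UNIV \<psi>"
    unfolding \<psi>_def \<omega>_def using \<rho> by (intro continuous_intros cs) auto
  have 3: "1 \<le> \<eta> x" if "x \<in> shell \<rho>" for x
  proof -
    have "(1 / 2)\<^sup>2 \<le> (norm x / \<rho>)\<^sup>2" "(norm x / \<rho>)\<^sup>2 \<le> 1\<^sup>2"
      using that \<rho> by (intro power_mono; simp add: shell_def field_simps)+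
    then have sb: "1 / 4 \<le> s x" "s x \<le> 1" by (auto simp: sn power2_eq_square)
    have "3 / 16 * 3 \<le> \<omega> (s x)" unfolding \<omega>_def using sb by (intro mult_mono) auto
    then have "(9 / 16)\<^sup>2 \<le> (max 0 (\<omega> (s x)))\<^sup>2" by (intro power_mono) auto
    then show ?thesis by (simp add: \<eta>_def power2_eq_square)
  qed
  have pos: "1 / 16 < s x \<and> s x < 4" if "0 < \<omega> (s x)" for x
    using that unfolding \<omega>_def zero_less_mult_iff by auto
  have 4: "\<eta> x = 0 \<and> \<psi> x = 0" if "x \<notin> fat_shell \<rho>" for x
  proof -
    have "\<omega> (s x) \<le> 0"
    proof (rule ccontr)
      assume "\<not> ?thesis"
      then have "(1 / 4)\<^sup>2 < (norm x / \<rho>)\<^sup>2" "(norm x / \<rho>)\<^sup>2 < 2\<^sup>2" using pos[of x] by (auto simp: sn power2_eq_square)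
      from power2_less_imp_less[OF this(1)] power2_less_imp_less[OF this(2)]
      have "1 / 4 < norm x / \<rho>" "norm x / \<rho> < 2" using \<rho> by auto
      then show False using that \<rho> by (auto simp: fat_shell_def field_simps)
    qed
    then show ?thesis by (simp add: \<eta>_def \<psi>_def)
  qed
  have wb: "0 \<le> max 0 (\<omega> (s x))" "max 0 (\<omega> (s x)) \<le> 16" for x
  proof -
    have "\<omega> (s x) \<le> 16" if "0 < \<omega> (s x)"
    proof -
      have "\<omega> (s x) \<le> 4 * 4" unfolding \<omega>_def using pos[OF that] by (intro mult_mono) auto
      then show ?thesis by simp
    qed
    then show "max 0 (\<omega> (s x)) \<le> 16" by (cases "0 < \<omega> (s x)") auto
  qed simp
  have 5: "\<bar>\<eta> x\<bar> \<le> 6000" for x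
    using power_mono[OF wb(2,1), of x 2] by (simp add: \<eta>_def)
  have 6: "norm (\<psi> x) * norm x \<le> 6000" for x
  proof (cases "0 < \<omega> (s x)")
    case True
    have "norm (\<psi> x) * norm x = 16 * max 0 (\<omega> (s x)) * (\<bar>65 / 16 - 2 * s x\<bar> * s x)"
      using \<rho> by (simp add: \<psi>_def sn abs_mult power2_eq_square)
    also have "\<dots> \<le> 16 * 16 * (5 * 4)"
      using pos[OF True] wb[of x] by (intro mult_mono) auto
    finally show ?thesis by simp
  next
    case False
    then show ?thesis by (simp add: \<psi>_def)
  qed
  show ?thesis using that 1 2 3 4 5 6 by blast
qed

text \<open>
  The Sobolev constant times the loss in passing from \<open>U\<close> to \<open>\<eta> U\<close>; \<open>6000\<close> bounds \<open>\<eta>\<close> and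
  \<open>|x| |\<nabla>\<eta>|\<close>, and \<open>n\<^sup>2\<close> bounds the Hardy potential times \<open>|x|\<^sup>2\<close>.
\<close>

definition shell_sobolev_const :: "real \<Rightarrow> real" where
  "shell_sobolev_const n = (2 * (n - 1) / (n - 2))\<^sup>2 * (6000\<^sup>2 * (4 + n\<^sup>2))"

lemma norm_add_square_le: "(norm (a + b))\<^sup>2 \<le> 2 * (norm a)\<^sup>2 + 2 * (norm (b :: 'a::real_normed_vector))\<^sup>2"
proof -
  have "(norm (a + b))\<^sup>2 \<le> (norm a + norm b)\<^sup>2" by (intro power_mono norm_triangle_ineq) simp
  also have "\<dots> \<le> 2 * (norm a)\<^sup>2 + 2 * (norm b)\<^sup>2"
    using zero_le_power2[of "norm a - norm b"] by (simp add: power2_eq_square algebra_simps)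
  finally show ?thesis .
qed

lemma integrable_abs_powr:
  assumes U: "compact_C1 (half_ball k R) U g" and q: "0 < q" and F: "continuous_on {0<..<R} F"
  shows "integrable lborel (\<lambda>x. F (norm x) * \<bar>U x\<bar> powr q)"
proof -
  from U obtain K where K: "compact K" "K \<subseteq> half_ball k R" "\<And>x. x \<notin> K \<Longrightarrow> U x = 0"
    by (auto simp: compact_C1_def)
  show ?thesis
  proof (rule integrable_compact_support[OF K(1)])
    have "continuous_on K (\<lambda>x. \<bar>U x\<bar> powr q)"
      using q by (intro continuous_on_powr' continuous_intros compact_C1_continuous[OF U]) auto
    then show "continuous_on K (\<lambda>x. F (norm x) * \<bar>U x\<bar> powr q)"
      by (intro continuous_on_mult radial_weight_continuous[OF F K(2)])
  qed (simp add: K)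
qed

lemma integrable_indicator_mult:
  fixes f :: "'a::euclidean_space \<Rightarrow> real"
  assumes "integrable lborel f" "A \<in> sets borel"
  shows "integrable lborel (\<lambda>x. indicator A x * f x)"
  using integrable_mult_indicator[OF _ assms(1), of A] assms(2) by simp

abbreviation (input) deviation where
  "deviation k R m U g x \<equiv> (norm (g x - U x *\<^sub>R ground_field k R m (\<lambda>_. 0) x))\<^sup>2"

text \<open>
  Apply the Sobolev inequality to \<open>W = \<eta> U\<close>.  The singular part \<open>U/x\<^sub>k\<close> of the gradient is not
  bounded by the right side pointwise; the Hardy identity for \<open>W\<close> itself removes it, since the
  potential of the ground field is at most \<open>n\<^sup>2/|x|\<^sup>2\<close>.
\<close>

lemma shell_sobolev:
  fixes U :: "real ^ 'n \<Rightarrow> real" and k :: "'n::finite"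
  assumes U: "compact_C1 (half_ball k R) U g" and \<rho>: "0 < \<rho>" and n: "n = real CARD('n)" "n \<ge> 3"
  shows "(\<integral>x. indicator (shell \<rho>) x * \<bar>U x\<bar> powr (2 * n / (n - 2)) \<partial>lborel)
    \<le> (shell_sobolev_const n * (\<integral>x. indicator (fat_shell \<rho>) x * (deviation k R m U g x + (U x)\<^sup>2 / (norm x)\<^sup>2) \<partial>lborel)) powr (n / (n - 2))"
proof -
  obtain \<eta> :: "real ^ 'n \<Rightarrow> real" and \<psi> where
    eta: "\<And>x. (\<eta> has_derivative (\<lambda>h. \<psi> x \<bullet> h)) (at x)" "continuous_on UNIV \<psi>"
    "\<And>x. x \<in> shell \<rho> \<Longrightarrow> 1 \<le> \<eta> x"
    "\<And>x. x \<notin> fat_shell \<rho> \<Longrightarrow> \<eta> x = 0 \<and> \<psi> x = 0"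
    "\<And>x. \<bar>\<eta> x\<bar> \<le> 6000" "\<And>x. norm (\<psi> x) * norm x \<le> 6000"
    using shell_cutoff[OF \<rho>] by blast
  define M :: real where "M = 6000"
  define W where "W x = \<eta> x * U x" for x
  define h where "h x = \<eta> x *\<^sub>R g x + U x *\<^sub>R \<psi> x" for x
  define T where "T = ground_field k R m (\<lambda>_. 0)"
  define f where "f x = deviation k R m U g x + (U x)\<^sup>2 / (norm x)\<^sup>2" for x
  define Z where "Z r = (n\<^sup>2 / 4 + Xsq m (r / (kappa * R)) / 4) / r\<^sup>2" for r
  have W: "compact_C1 (half_ball k R) W h"
    unfolding W_def[abs_def] h_def[abs_def]
    by (rule compact_C1_mult[OF open_half_ball U eta(1) continuous_on_subset[OF eta(2)]]) simp
  have cZ: "continuous_on {0<..<R} Z" unfolding Z_def by (intro continuous_intros Xsq_scaled_continuous) auto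
  have f0: "0 \<le> f x" for x by (simp add: f_def)
  have If: "integrable lborel (\<lambda>x. indicator (fat_shell \<rho>) x * f x)"
  proof (rule integrable_indicator_mult)
    have "integrable lborel (\<lambda>x. (U x)\<^sup>2 * (1 / (norm x)\<^sup>2))"
      by (rule integrable_weighted_square[OF U]) (auto intro!: continuous_intros)
    then show "integrable lborel f"
      unfolding f_def using integrable_ground_deficit[OF U continuous_on_const] by simp
  qed measurable
  have ID: "integrable lborel (\<lambda>x. (norm (h x - W x *\<^sub>R T x))\<^sup>2)"
    unfolding T_def by (rule integrable_ground_deficit[OF W continuous_on_const])
  have IZ: "integrable lborel (\<lambda>x. (W x)\<^sup>2 * Z (norm x))" by (rule integrable_weighted_square[OF W cZ])
  have key: "(norm (h x - W x *\<^sub>R T x))\<^sup>2 + (W x)\<^sup>2 * Z (norm x) \<le> M\<^sup>2 * (4 + n\<^sup>2) * (indicator (fat_shell \<rho>) x * f x)" for x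
  proof (cases "U x = 0 \<and> g x = 0 \<or> x \<notin> fat_shell \<rho>")
    case True
    then have "h x = 0" "W x = 0" using eta(4)[of x] by (auto simp: h_def W_def)
    then show ?thesis using f0[of x] n by simp
  next
    case False
    then have xb: "x \<in> half_ball k R" and xf: "x \<in> fat_shell \<rho>" using U by (auto simp: compact_C1_def)
    define r where "r = norm x"
    have r: "0 < r" "r < R" using half_ball_norm[OF xb] by (auto simp: r_def)
    note sc = scaled_radius_range[of r R]
    define d where "d = g x - U x *\<^sub>R T x"
    define v where "v = (U x)\<^sup>2 / r\<^sup>2"
    have v0: "0 \<le> v" by (simp add: v_def)
    have e2: "(\<eta> x)\<^sup>2 \<le> M\<^sup>2" using power_mono[OF eta(5)[of x], of 2] by (simp add: M_def)
    have p2: "(norm (\<psi> x))\<^sup>2 \<le> M\<^sup>2 / r\<^sup>2"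
    proof -
      have "(norm (\<psi> x) * r)\<^sup>2 \<le> M\<^sup>2" using eta(6)[of x] r by (intro power_mono) (auto simp: r_def M_def)
      then show ?thesis using r by (simp add: power_mult_distrib pos_le_divide_eq)
    qed
    have "Xsq m (r / (kappa * R)) \<le> (Xsum m (r / (kappa * R)))\<^sup>2" using sc r by (intro Xsq_le) auto
    also have "\<dots> \<le> (1 / 4)\<^sup>2"
      using sc r by (intro power_mono Xsum_le Xsum_nonneg) auto
    finally have q: "Xsq m (r / (kappa * R)) \<le> 1" by (simp add: power2_eq_square)
    have "3 * 3 \<le> n * n" using n by (intro mult_mono) auto
    then have nn: "9 \<le> n\<^sup>2" by (simp add: power2_eq_square)
    have "h x - W x *\<^sub>R T x = \<eta> x *\<^sub>R d + U x *\<^sub>R \<psi> x"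
      by (simp add: h_def W_def d_def algebra_simps)
    then have "(norm (h x - W x *\<^sub>R T x))\<^sup>2 \<le> 2 * (norm (\<eta> x *\<^sub>R d))\<^sup>2 + 2 * (norm (U x *\<^sub>R \<psi> x))\<^sup>2"
      by (simp only: norm_add_square_le)
    also have "\<dots> = 2 * ((\<eta> x)\<^sup>2 * (norm d)\<^sup>2) + 2 * ((U x)\<^sup>2 * (norm (\<psi> x))\<^sup>2)" by (simp add: power_mult_distrib)
    also have "\<dots> \<le> 2 * (M\<^sup>2 * (norm d)\<^sup>2) + 2 * ((U x)\<^sup>2 * (M\<^sup>2 / r\<^sup>2))"
      using e2 p2 by (intro add_mono mult_left_mono mult_right_mono) auto
    also have "\<dots> = M\<^sup>2 * (2 * (norm d)\<^sup>2 + 2 * v)" by (simp add: v_def algebra_simps)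
    finally have 1: "(norm (h x - W x *\<^sub>R T x))\<^sup>2 \<le> M\<^sup>2 * (2 * (norm d)\<^sup>2 + 2 * v)" .
    have "(W x)\<^sup>2 * Z r = (\<eta> x)\<^sup>2 * (v * (n\<^sup>2 / 4 + Xsq m (r / (kappa * R)) / 4))"
      by (simp add: W_def Z_def v_def power_mult_distrib)
    also have "\<dots> \<le> M\<^sup>2 * (v * n\<^sup>2)"
      using q v0 e2 nn Xsq_nonneg[of m "r / (kappa * R)"] by (intro mult_mono mult_nonneg_nonneg add_nonneg_nonneg) auto
    finally have "(norm (h x - W x *\<^sub>R T x))\<^sup>2 + (W x)\<^sup>2 * Z r \<le> M\<^sup>2 * (2 * (norm d)\<^sup>2 + 2 * v) + M\<^sup>2 * (v * n\<^sup>2)"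
      using 1 by linarith
    also have "\<dots> = M\<^sup>2 * (2 * (norm d)\<^sup>2 + (2 + n\<^sup>2) * v)" by (simp add: algebra_simps)
    also have "\<dots> \<le> M\<^sup>2 * ((4 + n\<^sup>2) * (norm d)\<^sup>2 + (4 + n\<^sup>2) * v)"
      using v0 by (intro mult_left_mono add_mono mult_right_mono) auto
    also have "\<dots> = M\<^sup>2 * (4 + n\<^sup>2) * (indicator (fat_shell \<rho>) x * f x)"
      using xf by (simp add: f_def d_def T_def v_def r_def algebra_simps add_divide_distrib)
    finally show ?thesis by (simp add: r_def)
  qed
  have "(\<integral>x. (norm (h x))\<^sup>2 \<partial>lborel) = (\<integral>x. (norm (h x - W x *\<^sub>R T x))\<^sup>2 \<partial>lborel) + (\<integral>x. (W x)\<^sup>2 * Z (norm x) \<partial>lborel)"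
    using log_hardy_identity[OF W, of "\<lambda>_. 0" "\<lambda>_. 0" m] by (simp add: T_def Z_def n(1))
  also have "\<dots> = (\<integral>x. (norm (h x - W x *\<^sub>R T x))\<^sup>2 + (W x)\<^sup>2 * Z (norm x) \<partial>lborel)"
    using ID IZ by simp
  also have "\<dots> \<le> (\<integral>x. M\<^sup>2 * (4 + n\<^sup>2) * (indicator (fat_shell \<rho>) x * f x) \<partial>lborel)"
    using ID IZ If key by (intro integral_mono) auto
  also have "\<dots> = M\<^sup>2 * (4 + n\<^sup>2) * (\<integral>x. indicator (fat_shell \<rho>) x * f x \<partial>lborel)" by simp
  finally have gradW: "(\<integral>x. (norm (h x))\<^sup>2 \<partial>lborel) \<le> \<dots>" .
  define A where "A = (\<integral>x. \<bar>W x\<bar> powr (2 * n / (n - 2)) \<partial>lborel)"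
  have A0: "0 \<le> A" by (simp add: A_def)
  have "A powr ((n - 2) / n) \<le> (2 * (n - 1) / (n - 2))\<^sup>2 * (\<integral>x. (norm (h x))\<^sup>2 \<partial>lborel)"
    unfolding A_def using n by (intro sobolev_L2[OF W]) auto
  also have "\<dots> \<le> (2 * (n - 1) / (n - 2))\<^sup>2 * (M\<^sup>2 * (4 + n\<^sup>2) * (\<integral>x. indicator (fat_shell \<rho>) x * f x \<partial>lborel))"
    by (intro mult_left_mono gradW) auto
  also have "\<dots> = shell_sobolev_const n * (\<integral>x. indicator (fat_shell \<rho>) x * f x \<partial>lborel)"
    by (simp add: shell_sobolev_const_def M_def)
  finally have "(A powr ((n - 2) / n)) powr (n / (n - 2)) \<le> \<dots> powr (n / (n - 2))"
    using n by (intro powr_mono2) auto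
  moreover have "(A powr ((n - 2) / n)) powr (n / (n - 2)) = A" using n A0 by (simp add: powr_powr)
  moreover have "(\<integral>x. indicator (shell \<rho>) x * \<bar>U x\<bar> powr (2 * n / (n - 2)) \<partial>lborel) \<le> A"
    unfolding A_def
  proof (rule integral_mono)
    have q: "0 < 2 * n / (n - 2)" using n by simp
    show "integrable lborel (\<lambda>x. indicator (shell \<rho>) x * \<bar>U x\<bar> powr (2 * n / (n - 2)))"
      using integrable_abs_powr[OF U q, of "\<lambda>_. 1"] by (intro integrable_indicator_mult) auto
    show "integrable lborel (\<lambda>x. \<bar>W x\<bar> powr (2 * n / (n - 2)))"
      using integrable_abs_powr[OF W q, of "\<lambda>_. 1"] by simp
    fix x :: "real ^ 'n"
    show "indicator (shell \<rho>) x * \<bar>U x\<bar> powr (2 * n / (n - 2)) \<le> \<bar>W x\<bar> powr (2 * n / (n - 2))"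
    proof (cases "x \<in> shell \<rho>")
      case True
      have "1 * \<bar>U x\<bar> \<le> \<bar>\<eta> x\<bar> * \<bar>U x\<bar>" using eta(3)[OF True] by (intro mult_right_mono) auto
      then show ?thesis using True q by (auto simp: W_def abs_mult intro!: powr_mono2)
    qed simp
  qed
  ultimately show ?thesis by (simp add: f_def)
qed

text \<open>
  Here \<open>y = Y (\<rho> / 4)\<close> bounds \<open>Y\<close> from below on the fat shell, and \<open>Y \<le> 2 y\<close> on the shell.  The
  exponent of \<open>y\<close> is \<open>2 + 2/(n-2)\<close>: two powers turn the local energy into a density that can be
  summed over shells, the remaining \<open>2/(n-2)\<close> tame the extra power of the local energy through
  \<open>log_hardy_on_shell\<close>.
\<close>

lemma shell_weighted:
  fixes U :: "real ^ 'n \<Rightarrow> real" and k :: "'n::finite" and R :: real and m :: nat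
  defines "Y \<equiv> \<lambda>r. Xprod (Suc m) (r / (kappa * R))"
  assumes U: "compact_C1 (half_ball k R) U g" and \<rho>: "0 < \<rho>" "\<rho> \<le> R" and n: "n = real CARD('n)" "n \<ge> 3"
  shows "(\<integral>x. indicator (shell \<rho>) x * (Y (norm x) powr ((2 * n - 2) / (n - 2)) * \<bar>U x\<bar> powr (2 * n / (n - 2))) \<partial>lborel)
    \<le> 2 powr ((2 * n - 2) / (n - 2)) * shell_sobolev_const n powr (n / (n - 2)) * (11 * deficit k R m U g) powr (2 / (n - 2))
      * (\<integral>x. indicator (fat_shell \<rho>) x * (deviation k R m U g x + (U x)\<^sup>2 * ((Y (norm x))\<^sup>2 / (norm x)\<^sup>2)) \<partial>lborel)"
proof -
  define q where "q = (2 * n - 2) / (n - 2)"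
  define \<theta> where "\<theta> = 2 / (n - 2)"
  have th: "n / (n - 2) = 1 + \<theta>" "q = 2 + \<theta>" "0 < \<theta>" "0 < q"
    using n(2) by (auto simp: \<theta>_def q_def field_simps)
  define E where "E = deficit k R m U g"
  define D where "D x = deviation k R m U g x" for x
  define V where "V x = (U x)\<^sup>2 / (norm x)\<^sup>2" for x
  define y where "y = Y (\<rho> / 4)"
  define F where "F = (\<integral>x. indicator (fat_shell \<rho>) x * (D x + V x) \<partial>lborel)"
  define G where "G = (\<integral>x. indicator (fat_shell \<rho>) x * (D x + V x * (Y (norm x))\<^sup>2) \<partial>lborel)"
  have R: "0 < R" using \<rho> by simp
  have sc: "0 < r / (kappa * R)" "r / (kappa * R) < 1" "r / (kappa * R) \<le> 1 / kappa" if "0 < r" "r \<le> R" for r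
    using scaled_radius_range[OF that] by auto
  have y: "0 < y" "y \<le> 1"
    using sc[of "\<rho> / 4"] \<rho> by (auto simp: y_def Y_def Xprod_pos Xprod_le_1)
  have Ymono: "Y r \<le> Y s" if "0 < r" "r \<le> s" "s \<le> R" for r s
    unfolding Y_def using sc[of r] sc[of s] that kappa(1) by (intro Xprod_mono divide_right_mono) auto
  have Ypos: "0 < Y r" if "0 < r" "r \<le> R" for r
    unfolding Y_def using sc[OF that] by (intro Xprod_pos) auto
  \<comment> \<open>Slow variation: \<open>Y\<close> at the outer radius of the shell against \<open>Y\<close> at the inner radius of the fat shell.\<close>
  have Y2: "Y \<rho> \<le> 2 * y"
    using Xprod_quadruple[of "\<rho> / 4 / (kappa * R)" "Suc m"] sc[of "\<rho> / 4"] sc[of \<rho>] \<rho> by (simp add: Y_def y_def)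
  have cY: "continuous_on {0<..<R} Y" unfolding Y_def by (rule Xprod_scaled_continuous)
  have supp: "0 < norm x \<and> norm x < R" if "U x \<noteq> 0" for x
  proof -
    from U that have "x \<in> half_ball k R" by (auto simp: compact_C1_def)
    then show ?thesis using half_ball_norm by blast
  qed
  have D0: "0 \<le> D x" "0 \<le> V x" for x by (auto simp: D_def V_def)
  have ID: "integrable lborel D" unfolding D_def by (rule integrable_ground_deficit[OF U continuous_on_const])
  have IV: "integrable lborel (\<lambda>x. V x * w (norm x))" if "continuous_on {0<..<R} w" for w
  proof -
    have "integrable lborel (\<lambda>x. (U x)\<^sup>2 * (w (norm x) / (norm x)\<^sup>2))"
      by (rule integrable_weighted_square[OF U]) (intro continuous_intros that, auto)
    then show ?thesis by (simp add: V_def)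
  qed
  have IV1: "integrable lborel V" using IV[of "\<lambda>_. 1"] by simp
  have IVY: "integrable lborel (\<lambda>x. V x * Y (norm x))" by (rule IV[OF cY])
  have IVY2: "integrable lborel (\<lambda>x. V x * (Y (norm x))\<^sup>2)" by (rule IV) (intro continuous_intros cY)
  have F0: "0 \<le> F" unfolding F_def by (intro Bochner_Integration.integral_nonneg mult_nonneg_nonneg add_nonneg_nonneg D0) auto
  have E0: "0 \<le> E" by (simp add: E_def)
  have yY: "y \<le> Y (norm x)" if "x \<in> fat_shell \<rho>" "U x \<noteq> 0" for x
    unfolding y_def using that supp[of x] \<rho> by (intro Ymono) (auto simp: fat_shell_def)
  have yF: "y * F \<le> 11 * E"
  proof -
    have "y * F = (\<integral>x. y * (indicator (fat_shell \<rho>) x * (D x + V x)) \<partial>lborel)" by (simp add: F_def)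
    also have "\<dots> \<le> (\<integral>x. D x + indicator (fat_shell \<rho>) x * (V x * Y (norm x)) \<partial>lborel)"
    proof (rule integral_mono)
      show "integrable lborel (\<lambda>x. y * (indicator (fat_shell \<rho>) x * (D x + V x)))"
        using ID IV1 by (intro integrable_mult_right integrable_indicator_mult) auto
      show "integrable lborel (\<lambda>x. D x + indicator (fat_shell \<rho>) x * (V x * Y (norm x)))"
        using ID IVY by (intro Bochner_Integration.integrable_add integrable_indicator_mult) auto
      fix x
      show "y * (indicator (fat_shell \<rho>) x * (D x + V x)) \<le> D x + indicator (fat_shell \<rho>) x * (V x * Y (norm x))"
      proof (cases "x \<in> fat_shell \<rho>")
        case True
        have "y * V x \<le> V x * Y (norm x)"
        proof (cases "U x = 0")
          case False
          then show ?thesis using mult_left_mono[OF yY[OF True False] D0(2)[of x]] by (simp add: mult.commute)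
        qed (simp add: V_def)
        moreover have "y * D x \<le> 1 * D x" by (intro mult_right_mono y D0)
        ultimately show ?thesis using True by (simp add: distrib_left)
      qed (simp add: D0)
    qed
    also have "\<dots> = E + (\<integral>x. indicator (fat_shell \<rho>) x * (V x * Y (norm x)) \<partial>lborel)"
      using ID IVY by (subst Bochner_Integration.integral_add) (auto intro!: integrable_indicator_mult simp: E_def D_def[abs_def])
    also have "(\<integral>x. indicator (fat_shell \<rho>) x * (V x * Y (norm x)) \<partial>lborel) \<le> 10 * E"
      using log_hardy_on_shell[OF U \<rho>(1), of m] by (simp add: E_def Y_def V_def fat_shell_def)
    finally show ?thesis by simp
  qed
  have y2F: "y\<^sup>2 * F \<le> G"
  proof -
    have "y\<^sup>2 * F = (\<integral>x. y\<^sup>2 * (indicator (fat_shell \<rho>) x * (D x + V x)) \<partial>lborel)" by (simp add: F_def)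
    also have "\<dots> \<le> G"
      unfolding G_def
    proof (rule integral_mono)
      show "integrable lborel (\<lambda>x. y\<^sup>2 * (indicator (fat_shell \<rho>) x * (D x + V x)))"
        using ID IV1 by (intro integrable_mult_right integrable_indicator_mult) auto
      show "integrable lborel (\<lambda>x. indicator (fat_shell \<rho>) x * (D x + V x * (Y (norm x))\<^sup>2))"
        using ID IVY2 by (intro integrable_indicator_mult) auto
      fix x
      show "y\<^sup>2 * (indicator (fat_shell \<rho>) x * (D x + V x)) \<le> indicator (fat_shell \<rho>) x * (D x + V x * (Y (norm x))\<^sup>2)"
      proof (cases "x \<in> fat_shell \<rho>")
        case True
        have "y\<^sup>2 * V x \<le> V x * (Y (norm x))\<^sup>2"
        proof (cases "U x = 0")
          case False
          have "y\<^sup>2 \<le> (Y (norm x))\<^sup>2" using yY[OF True False] y by (intro power_mono) auto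
          from mult_left_mono[OF this D0(2)[of x]] show ?thesis by (simp add: mult.commute)
        qed (simp add: V_def)
        moreover have "y\<^sup>2 * D x \<le> 1 * D x" using y by (intro mult_right_mono D0) (auto intro: power_le_one)
        ultimately show ?thesis using True by (simp add: distrib_left)
      qed simp
    qed
    finally show ?thesis .
  qed
  have "(\<integral>x. indicator (shell \<rho>) x * (Y (norm x) powr q * \<bar>U x\<bar> powr (2 * n / (n - 2))) \<partial>lborel)
    \<le> (\<integral>x. (2 * y) powr q * (indicator (shell \<rho>) x * \<bar>U x\<bar> powr (2 * n / (n - 2))) \<partial>lborel)"
  proof (rule integral_mono)
    have p: "0 < 2 * n / (n - 2)" using n by simp
    have "continuous_on {0<..<R} (\<lambda>r. Y r powr q)"
      using th Ypos by (intro continuous_on_powr' cY continuous_intros) (auto simp: less_imp_le)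
    then show "integrable lborel (\<lambda>x. indicator (shell \<rho>) x * (Y (norm x) powr q * \<bar>U x\<bar> powr (2 * n / (n - 2))))"
      by (intro integrable_indicator_mult integrable_abs_powr[OF U p]) auto
    show "integrable lborel (\<lambda>x. (2 * y) powr q * (indicator (shell \<rho>) x * \<bar>U x\<bar> powr (2 * n / (n - 2))))"
      using integrable_abs_powr[OF U p, of "\<lambda>_. 1"] by (intro integrable_mult_right integrable_indicator_mult) auto
    fix x
    show "indicator (shell \<rho>) x * (Y (norm x) powr q * \<bar>U x\<bar> powr (2 * n / (n - 2)))
      \<le> (2 * y) powr q * (indicator (shell \<rho>) x * \<bar>U x\<bar> powr (2 * n / (n - 2)))"
    proof (cases "x \<in> shell \<rho> \<and> U x \<noteq> 0")
      case True
      then have "0 < norm x" "norm x \<le> \<rho>" "norm x \<le> R" using supp[of x] by (auto simp: shell_def)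
      then have "Y (norm x) \<le> 2 * y" "0 < Y (norm x)" using Ymono[of "norm x" \<rho>] \<rho> Y2 Ypos[of "norm x"] by auto
      then have "Y (norm x) powr q \<le> (2 * y) powr q" using th by (intro powr_mono2) auto
      then show ?thesis using True by (auto intro!: mult_right_mono)
    next
      case False
      then show ?thesis using p by auto
    qed
  qed
  also have "\<dots> = (2 * y) powr q * (\<integral>x. indicator (shell \<rho>) x * \<bar>U x\<bar> powr (2 * n / (n - 2)) \<partial>lborel)" by simp
  also have "\<dots> \<le> (2 * y) powr q * (shell_sobolev_const n * F) powr (1 + \<theta>)"
    using shell_sobolev[OF U \<rho>(1) n, of m] by (intro mult_left_mono) (auto simp: F_def D_def V_def th(1))
  also have "\<dots> = 2 powr q * shell_sobolev_const n powr (1 + \<theta>) * ((y * F) powr \<theta> * (y\<^sup>2 * F))"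
  proof -
    have "0 \<le> shell_sobolev_const n" by (simp add: shell_sobolev_const_def)
    then have "(2 * y) powr q * (shell_sobolev_const n * F) powr (1 + \<theta>) = 2 powr q * y powr q * (shell_sobolev_const n powr (1 + \<theta>) * F powr (1 + \<theta>))"
      using y F0 by (simp add: powr_mult)
    moreover have "y powr q = y\<^sup>2 * y powr \<theta>" using y by (simp add: th(2) powr_add powr_numeral)
    moreover have "F powr (1 + \<theta>) = F * F powr \<theta>" using F0 by (cases "F = 0") (auto simp: powr_add)
    moreover have "(y * F) powr \<theta> = y powr \<theta> * F powr \<theta>" using y F0 by (simp add: powr_mult)
    ultimately show ?thesis by (simp add: mult_ac)
  qed
  also have "\<dots> \<le> 2 powr q * shell_sobolev_const n powr (1 + \<theta>) * ((11 * E) powr \<theta> * G)"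
  proof -
    have "(y * F) powr \<theta> \<le> (11 * E) powr \<theta>" using y F0 th yF by (intro powr_mono2) auto
    then have "(y * F) powr \<theta> * (y\<^sup>2 * F) \<le> (11 * E) powr \<theta> * G"
      using y2F F0 by (intro mult_mono) auto
    then show ?thesis by (intro mult_left_mono) auto
  qed
  finally show ?thesis
    by (simp add: q_def[symmetric] \<theta>_def[symmetric] th(1) E_def G_def D_def V_def mult.assoc)
qed

lemma fat_shell_multiplicity:
  fixes x :: "'a::euclidean_space"
  assumes "0 < R"
  shows "(\<Sum>j<N. indicator (fat_shell (R / 2 ^ j)) x) \<le> (3 :: real)"
proof -
  define J where "J = {j\<in>{..<N}. x \<in> fat_shell (R / 2 ^ j)}"
  have fin: "finite J" by (simp add: J_def)
  have "(\<Sum>j<N. indicator (fat_shell (R / 2 ^ j)) x :: real) = real (card J)"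
    unfolding J_def by (simp add: indicator_def sum.If_cases Int_def)
  moreover have "card J \<le> 3"
  proof (cases "J = {}")
    case False
    define a where "a = Min J"
    have a: "a \<in> J" "\<And>j. j \<in> J \<Longrightarrow> a \<le> j" using fin False by (auto simp: a_def)
    have "J \<subseteq> {a..<a + 3}"
    proof
      fix j assume j: "j \<in> J"
      have "j < a + 3"
      proof (rule ccontr)
        assume "\<not> j < a + 3"
        then obtain i where i: "j = a + 3 + i" using le_Suc_ex by (metis not_less)
        have "norm x < 2 * (R / 2 ^ j)" "R / 2 ^ a / 4 < norm x" using j a(1) by (auto simp: J_def fat_shell_def)
        then have "R / 2 ^ a / 4 < 2 * (R / 2 ^ (a + 3 + i))" unfolding i by linarith
        also have "\<dots> = (R / 2 ^ a / 4) / 2 ^ i" by (simp add: power_add field_simps)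
        also have "\<dots> \<le> R / 2 ^ a / 4 / 1" using assms by (intro divide_left_mono) auto
        finally show False by simp
      qed
      then show "j \<in> {a..<a + 3}" using a(2)[OF j] by auto
    qed
    then show ?thesis using card_mono[of "{a..<a + 3}" J] by simp
  qed simp
  ultimately show ?thesis by simp
qed

lemma shell_cover:
  fixes x :: "'a::euclidean_space"
  assumes "R / 2 ^ N < norm x" "norm x < R"
  shows "\<exists>j<N. x \<in> shell (R / 2 ^ j)"
  using assms(1)
proof (induction N)
  case 0
  then show ?case using assms by simp
next
  case (Suc N)
  show ?case
  proof (cases "R / 2 ^ N < norm x")
    case True
    with Suc show ?thesis using less_SucI by blast
  next
    case False
    then show ?thesis using Suc.prems by (intro exI[of _ N]) (auto simp: shell_def)
  qed
qed

text \<open>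
  Add up the shells of radius \<open>R/2\<^sup>j\<close>.  Finitely many suffice because the support keeps a
  positive distance from the origin, and at most three fat shells meet in a point.  The constant
  is chosen before \<open>m\<close>, \<open>k\<close>, \<open>R\<close> and the function.
\<close>

theorem deficit_sobolev:
  assumes n: "n = real CARD('n::finite)" "n \<ge> 3"
  shows "\<exists>C>0. \<forall>m R U g. \<forall>k::'n. compact_C1 (half_ball k R) U g \<longrightarrow>
    (\<integral>x. Xprod (Suc m) (norm x / (kappa * R)) powr ((2 * n - 2) / (n - 2)) * \<bar>U x\<bar> powr (2 * n / (n - 2)) \<partial>lborel) powr ((n - 2) / n)
      \<le> C * deficit k R m U g"
proof -
  define q where "q = (2 * n - 2) / (n - 2)"
  define p where "p = 2 * n / (n - 2)"
  define \<theta> where "\<theta> = 2 / (n - 2)"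
  have th: "n / (n - 2) = 1 + \<theta>" "0 < \<theta>" "0 < q" "0 < p" "(n - 2) / n = 1 / (1 + \<theta>)"
    using n(2) by (auto simp: \<theta>_def q_def p_def field_simps)
  define B where "B = 2 powr q * shell_sobolev_const n powr (1 + \<theta>) * 11 powr \<theta> * 15"
  have "0 < shell_sobolev_const n" using n(2) unfolding shell_sobolev_const_def by (intro mult_pos_pos add_pos_nonneg) auto
  then have B: "0 < B" by (simp add: B_def)
  show ?thesis
  proof (intro exI[of _ "B powr (1 / (1 + \<theta>))"] conjI allI impI)
    show "0 < B powr (1 / (1 + \<theta>))" using B by simp
    fix m R U g and k :: 'n
    assume U: "compact_C1 (half_ball k R) U g"
    define Y where "Y r = Xprod (Suc m) (r / (kappa * R))" for r
    define E where "E = deficit k R m U g"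
    define D where "D x = deviation k R m U g x" for x
    define h where "h x = D x + (U x)\<^sup>2 * ((Y (norm x))\<^sup>2 / (norm x)\<^sup>2)" for x
    define I where "I = (\<integral>x. Y (norm x) powr q * \<bar>U x\<bar> powr p \<partial>lborel)"
    have E0: "0 \<le> E" by (simp add: E_def)
    have "I \<le> B * E powr (1 + \<theta>)"
    proof (cases "0 < R")
      case False
      have "U x = 0" for x
      proof (rule ccontr)
        assume "U x \<noteq> 0"
        with U have "x \<in> half_ball k R" by (auto simp: compact_C1_def)
        with half_ball_norm[of x k R] False show False by linarith
      qed
      then have "I = 0" using th by (simp add: I_def)
      then show ?thesis using B by simp
    next
      case R: True
      from U obtain K where K: "compact K" "K \<subseteq> half_ball k R" "\<And>x. x \<notin> K \<Longrightarrow> U x = 0"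
        by (auto simp: compact_C1_def)
      have "\<exists>\<delta>>0. \<forall>x\<in>K. \<delta> < norm x"
      proof (cases "K = {}")
        case False
        obtain x0 where x0: "x0 \<in> K" "\<And>x. x \<in> K \<Longrightarrow> norm x0 \<le> norm x"
          using continuous_attains_inf[OF K(1) False, of norm] by (auto intro: continuous_intros)
        have "0 < norm x0" using x0(1) K(2) half_ball_norm by blast
        moreover from this have "norm x0 / 2 < norm x" if "x \<in> K" for x using x0(2)[OF that] by linarith
        ultimately show ?thesis by (intro exI[of _ "norm x0 / 2"]) auto
      qed (auto intro: exI[of _ 1])
      then obtain \<delta> where d: "0 < \<delta>" "\<And>x. x \<in> K \<Longrightarrow> \<delta> < norm x" by blast
      \<comment> \<open>The support lies outside the ball of radius \<open>R / 2 ^ N\<close>, so \<open>N\<close> shells cover it.\<close>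
      obtain N where N: "(1 / 2) ^ N < \<delta> / R" using real_arch_pow_inv[of "\<delta> / R" "1 / 2"] d R by auto
      have N': "R / 2 ^ N < \<delta>" using N R by (simp add: field_simps)
      have cY: "continuous_on {0<..<R} Y" unfolding Y_def by (rule Xprod_scaled_continuous)
      have Ypos: "0 < Y r" if "0 < r" "r < R" for r
        unfolding Y_def using scaled_radius_range[of r R] that by (intro Xprod_pos) auto
      have cYq: "continuous_on {0<..<R} (\<lambda>r. Y r powr q)"
        using th Ypos by (intro continuous_on_powr' cY continuous_intros) (auto simp: less_imp_le)
      have II: "integrable lborel (\<lambda>x. Y (norm x) powr q * \<bar>U x\<bar> powr p)"
        by (rule integrable_abs_powr[OF U th(4) cYq])
      have ID: "integrable lborel D" unfolding D_def by (rule integrable_ground_deficit[OF U continuous_on_const])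
      have IY: "integrable lborel (\<lambda>x. (U x)\<^sup>2 * ((Y (norm x))\<^sup>2 / (norm x)\<^sup>2))"
        by (rule integrable_weighted_square[OF U]) (intro continuous_intros cY, auto)
      have Ih: "integrable lborel h" unfolding h_def using ID IY by simp
      have h0: "0 \<le> h x" for x by (simp add: h_def D_def)
      have "I \<le> (\<integral>x. (\<Sum>j<N. indicator (shell (R / 2 ^ j)) x * (Y (norm x) powr q * \<bar>U x\<bar> powr p)) \<partial>lborel)"
        unfolding I_def
      proof (rule integral_mono[OF II])
        show "integrable lborel (\<lambda>x. \<Sum>j<N. indicator (shell (R / 2 ^ j)) x * (Y (norm x) powr q * \<bar>U x\<bar> powr p))"
          by (intro Bochner_Integration.integrable_sum integrable_indicator_mult II) auto
        fix x
        show "Y (norm x) powr q * \<bar>U x\<bar> powr p \<le> (\<Sum>j<N. indicator (shell (R / 2 ^ j)) x * (Y (norm x) powr q * \<bar>U x\<bar> powr p))"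
        proof (cases "x \<in> K")
          case True
          then have "R / 2 ^ N < norm x" "norm x < R" using d(2)[OF True] N' K(2) half_ball_norm by force+
          from shell_cover[OF this] obtain j where j: "j < N" "x \<in> shell (R / 2 ^ j)" by blast
          have "indicator (shell (R / 2 ^ j)) x * (Y (norm x) powr q * \<bar>U x\<bar> powr p)
            \<le> (\<Sum>j<N. indicator (shell (R / 2 ^ j)) x * (Y (norm x) powr q * \<bar>U x\<bar> powr p))"
            using j(1) by (intro member_le_sum) auto
          then show ?thesis using j by simp
        qed (use K(3) th in auto)
      qed
      also have "\<dots> = (\<Sum>j<N. \<integral>x. indicator (shell (R / 2 ^ j)) x * (Y (norm x) powr q * \<bar>U x\<bar> powr p) \<partial>lborel)"
        by (intro Bochner_Integration.integral_sum integrable_indicator_mult II) auto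
      also have "\<dots> \<le> (\<Sum>j<N. 2 powr q * shell_sobolev_const n powr (1 + \<theta>) * (11 * E) powr \<theta>
          * (\<integral>x. indicator (fat_shell (R / 2 ^ j)) x * h x \<partial>lborel))"
      proof (rule sum_mono)
        fix j
        have "0 < R / 2 ^ j" "R / 2 ^ j \<le> R" using R by (auto simp: divide_le_eq)
        from shell_weighted[OF U this n, of m]
        show "(\<integral>x. indicator (shell (R / 2 ^ j)) x * (Y (norm x) powr q * \<bar>U x\<bar> powr p) \<partial>lborel)
          \<le> 2 powr q * shell_sobolev_const n powr (1 + \<theta>) * (11 * E) powr \<theta>
          * (\<integral>x. indicator (fat_shell (R / 2 ^ j)) x * h x \<partial>lborel)"
          unfolding Y_def q_def p_def h_def D_def E_def \<theta>_def[symmetric] th(1) .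
      qed
      also have "\<dots> = 2 powr q * shell_sobolev_const n powr (1 + \<theta>) * (11 * E) powr \<theta>
          * (\<integral>x. (\<Sum>j<N. indicator (fat_shell (R / 2 ^ j)) x * h x) \<partial>lborel)"
        unfolding sum_distrib_left[symmetric]
        by (subst Bochner_Integration.integral_sum) (auto intro!: integrable_indicator_mult Ih)
      also have "(\<integral>x. (\<Sum>j<N. indicator (fat_shell (R / 2 ^ j)) x * h x) \<partial>lborel) \<le> (\<integral>x. 3 * h x \<partial>lborel)"
      proof (rule integral_mono)
        show "integrable lborel (\<lambda>x. \<Sum>j<N. indicator (fat_shell (R / 2 ^ j)) x * h x)"
          by (intro Bochner_Integration.integrable_sum integrable_indicator_mult Ih) auto
        show "integrable lborel (\<lambda>x. 3 * h x)" using Ih by simp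
        show "(\<Sum>j<N. indicator (fat_shell (R / 2 ^ j)) x * h x) \<le> 3 * h x" for x
          unfolding sum_distrib_right[symmetric] by (intro mult_right_mono fat_shell_multiplicity R h0)
      qed
      also have "(\<integral>x. 3 * h x \<partial>lborel) = 3 * (E + (\<integral>x. (U x)\<^sup>2 * ((Y (norm x))\<^sup>2 / (norm x)\<^sup>2) \<partial>lborel))"
      proof -
        have "(\<integral>x. h x \<partial>lborel) = (\<integral>x. D x \<partial>lborel) + (\<integral>x. (U x)\<^sup>2 * ((Y (norm x))\<^sup>2 / (norm x)\<^sup>2) \<partial>lborel)"
          unfolding h_def by (rule Bochner_Integration.integral_add[OF ID IY])
        then show ?thesis by (simp add: E_def D_def[abs_def])
      qed
      also have "\<dots> \<le> 15 * E"
        using log_hardy_remainder[OF U, of m] by (simp add: E_def Y_def)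
      finally have "I \<le> 2 powr q * shell_sobolev_const n powr (1 + \<theta>) * (11 * E) powr \<theta> * (15 * E)"
        by (simp add: mult_left_mono)
      also have "\<dots> = B * E powr (1 + \<theta>)"
        using E0 by (cases "E = 0") (auto simp: B_def powr_mult powr_add)
      finally show ?thesis .
    qed
    then have "I powr (1 / (1 + \<theta>)) \<le> (B * E powr (1 + \<theta>)) powr (1 / (1 + \<theta>))"
      using th by (intro powr_mono2) (auto simp: I_def)
    also have "\<dots> = B powr (1 / (1 + \<theta>)) * E"
      using B E0 th by (simp add: powr_mult powr_powr)
    finally show "(\<integral>x. Xprod (Suc m) (norm x / (kappa * R)) powr ((2 * n - 2) / (n - 2)) * \<bar>U x\<bar> powr (2 * n / (n - 2)) \<partial>lborel) powr ((n - 2) / n)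
      \<le> B powr (1 / (1 + \<theta>)) * deficit k R m U g"
      by (simp add: I_def E_def Y_def q_def p_def th(5))
  qed
qed

section \<open>The weight with exponent three halves\<close>

definition sqrt_ratio :: "real \<Rightarrow> real \<Rightarrow> real" where "sqrt_ratio R r = sqrt (r / R)"

lemma sqrt_ratio_range: "0 < r \<Longrightarrow> r < R \<Longrightarrow> 0 < sqrt_ratio R r \<and> sqrt_ratio R r < 1"
  by (simp add: sqrt_ratio_def)

lemma sqrt_ratio_derivative:
  assumes "0 < r" "r < R"
  shows "(sqrt_ratio R has_real_derivative (sqrt_ratio R r / (2 * r))) (at r)"
proof -
  have R: "0 < r / R" using assms by simp
  have "((\<lambda>r. sqrt (r / R)) has_real_derivative (inverse (sqrt (r / R)) / 2 * (1 / R))) (at r)"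
    by (rule DERIV_chain2[OF DERIV_real_sqrt[OF R] DERIV_cdivide[OF DERIV_ident]])
  moreover have "inverse (sqrt (r / R)) / 2 * (1 / R) = sqrt_ratio R r / (2 * r)"
  proof -
    have "sqrt (r / R) * sqrt (r / R) = r / R" using R by (simp only: real_sqrt_mult_self abs_of_pos)
    moreover have "inverse w = w / (w * w)" if "w \<noteq> 0" for w :: real using that by (simp add: field_simps)
    ultimately have "inverse (sqrt (r / R)) = sqrt (r / R) / (r / R)" using R by (metis real_sqrt_gt_zero less_irrefl)
    then show ?thesis using assms by (simp add: sqrt_ratio_def field_simps)
  qed
  ultimately show ?thesis by (simp add: sqrt_ratio_def[abs_def])
qed

text \<open>
  The logarithmic derivative of \<open>2 - sqrt(r/R)\<close> with respect to \<open>ln r\<close>.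
\<close>

definition edge_slope :: "real \<Rightarrow> real \<Rightarrow> real" where "edge_slope R r = - (sqrt_ratio R r / (2 * (2 - sqrt_ratio R r)))"
definition edge_slope' :: "real \<Rightarrow> real \<Rightarrow> real" where "edge_slope' R r = - (sqrt_ratio R r / (2 * r * (2 - sqrt_ratio R r)\<^sup>2))"

lemma sqrt_ratio_continuous: "continuous_on {0<..<R} (sqrt_ratio R)"
  by (rule DERIV_continuous_on[OF has_field_derivative_at_within[OF sqrt_ratio_derivative]]) auto

lemma edge_slope_derivative:
  assumes "0 < r" "r < R"
  shows "(edge_slope R has_real_derivative edge_slope' R r) (at r)"
proof -
  have z: "sqrt_ratio R r < 1" using sqrt_ratio_range[OF assms] by simp
  define z where "z = sqrt_ratio R r"
  have "((\<lambda>r. - (sqrt_ratio R r / (2 * (2 - sqrt_ratio R r)))) has_real_derivative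
     - ((z / (2 * r) * (2 * (2 - z)) - z * (2 * (0 - z / (2 * r)))) / ((2 * (2 - z)) * (2 * (2 - z))))) (at r)"
    unfolding z_def
    using z by (intro DERIV_minus DERIV_divide DERIV_cmult DERIV_diff DERIV_const sqrt_ratio_derivative assms) auto
  also have "z / (2 * r) * (2 * (2 - z)) - z * (2 * (0 - z / (2 * r))) = 2 * z / r"
    using assms by (simp add: field_simps)
  also have "- (2 * z / r / ((2 * (2 - z)) * (2 * (2 - z)))) = edge_slope' R r"
  proof -
    have "2 * z / r / ((2 * d) * (2 * d)) = z / (2 * r * d\<^sup>2)" for d :: real by (simp add: power2_eq_square)
    then show ?thesis by (simp only: edge_slope'_def z_def)
  qed
  finally show ?thesis by (simp only: edge_slope_def[abs_def])
qed

lemma edge_slope'_continuous: "continuous_on {0<..<R} (edge_slope' R)"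
  unfolding edge_slope'_def[abs_def] using sqrt_ratio_range[of _ R]
  by (intro continuous_intros sqrt_ratio_continuous) fastforce

lemma edge_slope_continuous: "continuous_on {0<..<R} (edge_slope R)"
  by (rule DERIV_continuous_on[OF has_field_derivative_at_within[OF edge_slope_derivative]]) auto

text \<open>
  With \<open>z = sqrt(r/R)\<close> and \<open>S = 1/4\<close> the right side is exactly \<open>z / (8 (2 - z))\<close>, and smaller
  \<open>S\<close> only increase it.
\<close>

lemma edge_slope_gain:
  assumes r: "0 < r" "r < R" and S: "0 \<le> S" "S \<le> 1 / 4"
  shows "sqrt_ratio R r / 16 \<le> - r * edge_slope' R r + S * edge_slope R r - (edge_slope R r)\<^sup>2"
proof -
  define z where "z = sqrt_ratio R r"
  have z: "0 < z" "z < 1" using sqrt_ratio_range[OF r] by (auto simp: z_def)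
  define d where "d = 2 - z"
  have d: "0 < d" "d \<le> 2" "z = 2 - d" using z by (auto simp: d_def)
  have "z / 16 \<le> z / (8 * d)" using d z by (intro divide_left_mono) auto
  also have "\<dots> = z / (2 * d\<^sup>2) - (1 / 4) * (z / (2 * d)) - (z / (2 * d))\<^sup>2"
    unfolding d(3) using d(1) by (simp add: field_simps power2_eq_square)
  also have "\<dots> \<le> z / (2 * d\<^sup>2) - S * (z / (2 * d)) - (z / (2 * d))\<^sup>2"
    using S z d by (intro diff_right_mono diff_left_mono mult_right_mono) auto
  also have "\<dots> = - r * edge_slope' R r + S * edge_slope R r - (edge_slope R r)\<^sup>2"
    using r by (simp add: edge_slope_def edge_slope'_def z_def d_def)
  finally show ?thesis by (simp add: z_def)
qed

lemma ground_field_edge: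
  "ground_field k R m (edge_slope R) x = ground_field k R m (\<lambda>_. 0) x + (edge_slope R (norm x) / (norm x)\<^sup>2) *\<^sub>R x"
  by (simp add: ground_field_def radial_field_def add_divide_distrib scaleR_add_left)

text \<open>
  If \<open>u = f v\<close>, then \<open>\<nabla>u - u T = f (\<nabla>v - v T\<^sub>0)\<close> with \<open>T = T\<^sub>0 + \<nabla>f/f\<close>.  Here
  \<open>f = 2 - sqrt(|x|/R)\<close> lies between \<open>1\<close> and \<open>2\<close>.
\<close>

lemma ground_state_substitution:
  fixes u :: "real ^ 'n \<Rightarrow> real" and k :: "'n::finite"
  assumes u: "compact_C1 (half_ball k R) u g"
  obtains v h where "compact_C1 (half_ball k R) v h" "\<And>x. \<bar>u x\<bar> \<le> 2 * \<bar>v x\<bar>"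
    "deficit k R m v h \<le> (\<integral>x. (norm (g x - u x *\<^sub>R ground_field k R m (edge_slope R) x))\<^sup>2 \<partial>lborel)"
proof -
  let ?S = "half_ball k R"
  define \<phi> where "\<phi> x = 1 / (2 - sqrt_ratio R (norm x))" for x :: "real ^ 'n"
  define a where "a r = sqrt_ratio R r / (2 * r\<^sup>2 * (2 - sqrt_ratio R r)\<^sup>2)" for r
  define \<psi> where "\<psi> x = a (norm x) *\<^sub>R x" for x :: "real ^ 'n"
  define v where "v x = \<phi> x * u x" for x
  define h where "h x = \<phi> x *\<^sub>R g x + u x *\<^sub>R \<psi> x" for x
  have nb: "0 < norm x" "norm x < R" "0 < sqrt_ratio R (norm x)" "sqrt_ratio R (norm x) < 1" if "x \<in> ?S" for x
    using half_ball_norm[OF that] sqrt_ratio_range by auto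
  have ca: "continuous_on {0<..<R} a"
    unfolding a_def using sqrt_ratio_range[of _ R] by (intro continuous_intros sqrt_ratio_continuous) fastforce
  have v: "compact_C1 ?S v h"
    unfolding v_def[abs_def] h_def[abs_def]
  proof (rule compact_C1_mult[OF open_half_ball u])
    show "continuous_on ?S \<psi>"
      unfolding \<psi>_def by (intro continuous_intros radial_weight_continuous[OF ca]) auto
    fix x assume x: "x \<in> ?S"
    note nb = nb[OF x]
    have nz: "x \<noteq> 0" using nb by auto
    have nd: "(norm has_derivative (\<lambda>h. (x \<bullet> h) / norm x)) (at x)"
      using has_derivative_norm[OF nz] by (simp add: sgn_div_norm inner_commute divide_inverse mult.commute)
    have "((\<lambda>r. 1 / (2 - sqrt_ratio R r)) has_real_derivative ((0 * (2 - sqrt_ratio R (norm x)) - 1 * (0 - sqrt_ratio R (norm x) / (2 * norm x))) / ((2 - sqrt_ratio R (norm x)) * (2 - sqrt_ratio R (norm x))))) (at (norm x))"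
      using nb by (intro DERIV_divide DERIV_diff DERIV_const sqrt_ratio_derivative) auto
    from has_derivative_compose[OF nd this[unfolded has_field_derivative_def]]
    show "(\<phi> has_derivative (\<lambda>h. \<psi> x \<bullet> h)) (at x)"
      unfolding \<phi>_def[abs_def]
      by (rule has_derivative_eq_rhs) (use nb in \<open>simp add: \<psi>_def a_def fun_eq_iff power2_eq_square mult_ac\<close>)
  qed
  moreover have "\<bar>u x\<bar> \<le> 2 * \<bar>v x\<bar>" for x
  proof (cases "u x = 0")
    case False
    then have "x \<in> ?S" using u by (auto simp: compact_C1_def)
    from nb[OF this] have "1 / 2 \<le> \<phi> x" by (simp add: \<phi>_def frac_le)
    then have "1 / 2 * \<bar>u x\<bar> \<le> \<bar>\<phi> x\<bar> * \<bar>u x\<bar>" by (intro mult_right_mono) auto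
    then show ?thesis by (simp add: v_def abs_mult)
  qed simp
  moreover have "deficit k R m v h \<le> (\<integral>x. (norm (g x - u x *\<^sub>R ground_field k R m (edge_slope R) x))\<^sup>2 \<partial>lborel)"
  proof (rule integral_mono)
    show "integrable lborel (\<lambda>x. deviation k R m v h x)"
      by (rule integrable_ground_deficit[OF v continuous_on_const])
    show "integrable lborel (\<lambda>x. (norm (g x - u x *\<^sub>R ground_field k R m (edge_slope R) x))\<^sup>2)"
      by (rule integrable_ground_deficit[OF u edge_slope_continuous])
    fix x
    show "deviation k R m v h x \<le> (norm (g x - u x *\<^sub>R ground_field k R m (edge_slope R) x))\<^sup>2"
    proof (cases "u x = 0 \<and> g x = 0")
      case True
      then show ?thesis by (simp add: v_def h_def)
    next
      case False
      then have "x \<in> ?S" using u by (auto simp: compact_C1_def)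
      note nb = nb[OF this]
      have psi: "\<psi> x = - (\<phi> x * (edge_slope R (norm x) / (norm x)\<^sup>2)) *\<^sub>R x"
        unfolding \<psi>_def using nb by (simp add: a_def \<phi>_def edge_slope_def power2_eq_square mult_ac)
      have "h x - v x *\<^sub>R ground_field k R m (\<lambda>_. 0) x = \<phi> x *\<^sub>R (g x - u x *\<^sub>R ground_field k R m (edge_slope R) x)"
        unfolding h_def v_def ground_field_edge psi by (simp add: algebra_simps)
      moreover have "0 \<le> \<phi> x" "\<phi> x \<le> 1" using nb by (auto simp: \<phi>_def)
      ultimately have "norm (h x - v x *\<^sub>R ground_field k R m (\<lambda>_. 0) x) \<le> 1 * norm (g x - u x *\<^sub>R ground_field k R m (edge_slope R) x)"
        by (simp add: mult_left_le_one_le)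
      then show ?thesis by (intro power_mono) auto
    qed
  qed
  ultimately show ?thesis using that by blast
qed

lemma improved_hardy:
  fixes u :: "real ^ 'n \<Rightarrow> real" and k :: "'n::finite"
  assumes u: "compact_C1 (half_ball k R) u g" and R: "0 < R"
  shows "(real CARD('n))\<^sup>2 / 4 * (\<integral>x. (u x)\<^sup>2 / (norm x)\<^sup>2 \<partial>lborel)
      + 1 / 4 * (\<Sum>i=1..m. \<integral>x. (u x)\<^sup>2 / (norm x)\<^sup>2 * (\<Prod>j=1..i. (X j (norm x / (kappa * R)))\<^sup>2) \<partial>lborel)
      + 1 / (16 * R powr (1 / 2)) * (\<integral>x. (u x)\<^sup>2 / norm x powr (3 / 2) \<partial>lborel)
      + (\<integral>x. (norm (g x - u x *\<^sub>R ground_field k R m (edge_slope R) x))\<^sup>2 \<partial>lborel)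
    \<le> (\<integral>x. (norm (g x))\<^sup>2 \<partial>lborel)"
proof -
  let ?n = "real CARD('n)"
  define S where "S r = Xsum m (r / (kappa * R))" for r
  define P where "P i r = Xprod i (r / (kappa * R))" for i r
  define Z where "Z r = (?n\<^sup>2 / 4 + Xsq m (r / (kappa * R)) / 4 + (- r * edge_slope' R r + S r * edge_slope R r - (edge_slope R r)\<^sup>2)) / r\<^sup>2" for r
  have cS: "continuous_on {0<..<R} S" unfolding S_def by (rule Xsum_scaled_continuous)
  have cP: "continuous_on {0<..<R} (P i)" for i unfolding P_def by (rule Xprod_scaled_continuous)
  have cZ: "continuous_on {0<..<R} Z"
    unfolding Z_def by (intro continuous_intros Xsq_scaled_continuous cS edge_slope_continuous edge_slope'_continuous) auto
  have I0: "integrable lborel (\<lambda>x. (u x)\<^sup>2 * (1 / (norm x)\<^sup>2))"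
    by (rule integrable_weighted_square[OF u]) (intro continuous_intros, auto)
  have I1: "integrable lborel (\<lambda>x. (u x)\<^sup>2 * ((P i (norm x))\<^sup>2 / (norm x)\<^sup>2))" for i
    by (rule integrable_weighted_square[OF u]) (intro continuous_intros cP, auto)
  have I2: "integrable lborel (\<lambda>x. (u x)\<^sup>2 * (1 / norm x powr (3 / 2)))"
    by (rule integrable_weighted_square[OF u]) (intro continuous_intros, auto)
  have IZ: "integrable lborel (\<lambda>x. (u x)\<^sup>2 * Z (norm x))" by (rule integrable_weighted_square[OF u cZ])
  have lin: "(\<integral>x. \<alpha> * a x + \<beta> * (\<Sum>i=1..m. b i x) + \<gamma> * c x \<partial>lborel)
      = \<alpha> * (\<integral>x. a x \<partial>lborel) + \<beta> * (\<Sum>i=1..m. \<integral>x. b i x \<partial>lborel) + \<gamma> * (\<integral>x. c x \<partial>lborel)"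
    if "integrable lborel a" "\<And>i. integrable lborel (b i)" "integrable lborel c"
    for a c :: "real ^ 'n \<Rightarrow> real" and b :: "nat \<Rightarrow> real ^ 'n \<Rightarrow> real" and \<alpha> \<beta> \<gamma> :: real
    using that by (simp add: Bochner_Integration.integral_sum)
  have "?n\<^sup>2 / 4 * (\<integral>x. (u x)\<^sup>2 * (1 / (norm x)\<^sup>2) \<partial>lborel)
      + 1 / 4 * (\<Sum>i=1..m. \<integral>x. (u x)\<^sup>2 * ((P i (norm x))\<^sup>2 / (norm x)\<^sup>2) \<partial>lborel)
      + 1 / (16 * R powr (1 / 2)) * (\<integral>x. (u x)\<^sup>2 * (1 / norm x powr (3 / 2)) \<partial>lborel)
    = (\<integral>x. ?n\<^sup>2 / 4 * ((u x)\<^sup>2 * (1 / (norm x)\<^sup>2))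
      + 1 / 4 * (\<Sum>i=1..m. (u x)\<^sup>2 * ((P i (norm x))\<^sup>2 / (norm x)\<^sup>2))
      + 1 / (16 * R powr (1 / 2)) * ((u x)\<^sup>2 * (1 / norm x powr (3 / 2))) \<partial>lborel)"
    by (rule lin[symmetric, OF I0 I1 I2])
  also have "\<dots> \<le> (\<integral>x. (u x)\<^sup>2 * Z (norm x) \<partial>lborel)"
  proof (rule integral_mono)
    show "integrable lborel (\<lambda>x. ?n\<^sup>2 / 4 * ((u x)\<^sup>2 * (1 / (norm x)\<^sup>2))
      + 1 / 4 * (\<Sum>i=1..m. (u x)\<^sup>2 * ((P i (norm x))\<^sup>2 / (norm x)\<^sup>2))
      + 1 / (16 * R powr (1 / 2)) * ((u x)\<^sup>2 * (1 / norm x powr (3 / 2))))"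
      by (intro Bochner_Integration.integrable_add Bochner_Integration.integrable_sum integrable_mult_right I0 I1 I2)
    show "integrable lborel (\<lambda>x. (u x)\<^sup>2 * Z (norm x))" by (rule IZ)
    fix x
    show "?n\<^sup>2 / 4 * ((u x)\<^sup>2 * (1 / (norm x)\<^sup>2))
      + 1 / 4 * (\<Sum>i=1..m. (u x)\<^sup>2 * ((P i (norm x))\<^sup>2 / (norm x)\<^sup>2))
      + 1 / (16 * R powr (1 / 2)) * ((u x)\<^sup>2 * (1 / norm x powr (3 / 2))) \<le> (u x)\<^sup>2 * Z (norm x)"
    proof (cases "u x = 0")
      case False
      then have "x \<in> half_ball k R" using u by (auto simp: compact_C1_def)
      then have "0 < norm x" "norm x < R" using half_ball_norm by auto
      then obtain r where r: "norm x = r" "0 < r" "r < R" by blast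
      note sc = scaled_radius_range[of r R]
      have S: "0 \<le> S r" "S r \<le> 1 / 4"
        unfolding S_def using sc r by (intro Xsum_nonneg Xsum_le; simp)+
      have "1 / (16 * R powr (1 / 2)) * (1 / r powr (3 / 2)) = sqrt_ratio R r / 16 / r\<^sup>2"
      proof -
        have "r\<^sup>2 = r powr (1 / 2) * r powr (3 / 2)" using r by (simp flip: powr_add add: powr_numeral)
        moreover have "sqrt_ratio R r = r powr (1 / 2) / R powr (1 / 2)"
          using r by (simp add: sqrt_ratio_def powr_half_sqrt real_sqrt_divide)
        ultimately show ?thesis using r by simp
      qed
      also have "\<dots> \<le> (- r * edge_slope' R r + S r * edge_slope R r - (edge_slope R r)\<^sup>2) / r\<^sup>2"
        using edge_slope_gain[OF r(2,3) S] by (intro divide_right_mono) auto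
      finally have 1: "1 / (16 * R powr (1 / 2)) * (1 / r powr (3 / 2)) \<le> \<dots>" .
      have 2: "Xsq m (r / (kappa * R)) / 4 / r\<^sup>2 = 1 / 4 * (\<Sum>i=1..m. (P i r)\<^sup>2 / r\<^sup>2)"
        by (simp add: Xsq_def P_def sum_divide_distrib mult.commute)
      have "?n\<^sup>2 / 4 * (1 / r\<^sup>2) + 1 / 4 * (\<Sum>i=1..m. (P i r)\<^sup>2 / r\<^sup>2) + 1 / (16 * R powr (1 / 2)) * (1 / r powr (3 / 2)) \<le> Z r"
        using 1 unfolding Z_def add_divide_distrib 2 by simp
      from mult_left_mono[OF this, of "(u x)\<^sup>2"] show ?thesis
        unfolding r(1) sum_distrib_left[symmetric] by (simp add: distrib_left mult_ac)
    qed simp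
  qed
  also have "\<dots> + (\<integral>x. (norm (g x - u x *\<^sub>R ground_field k R m (edge_slope R) x))\<^sup>2 \<partial>lborel) = (\<integral>x. (norm (g x))\<^sup>2 \<partial>lborel)"
    using log_hardy_identity[OF u edge_slope_derivative edge_slope'_continuous, of m] by (simp add: Z_def S_def)
  finally show ?thesis
    by (simp add: P_def Xprod_def prod_power_distrib)
qed

section \<open>Test functions and conclusion\<close>

text \<open>
  The partial derivatives are the coordinates of the derivative.  Off the support the function
  vanishes in a neighbourhood, and so does its derivative.
\<close>

lemma test_function_compact_C1:
  fixes u :: "real ^ 'n::finite \<Rightarrow> real"
  assumes u: "u \<in> test_functions S"
  shows "compact_C1 S u (gradient u)"
proof -
  define K where "K = closure {x. u x \<noteq> 0}"
  have K: "compact K" "K \<subseteq> S" "\<And>x. x \<notin> K \<Longrightarrow> u x = 0"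
    using u closure_subset[of "{x. u x \<noteq> 0}"] by (auto simp: test_functions_def K_def)
  have "C_k (Suc 0) u" using u by (simp only: test_functions_def) blast
  then have du: "u differentiable (at x)" and cu: "continuous_on UNIV (partial_deriv i u)" for x i by auto
  have d: "(u has_derivative (\<lambda>h. gradient u x \<bullet> h)) (at x)" for x
  proof -
    let ?L = "frechet_derivative u (at x)"
    have L: "(u has_derivative ?L) (at x)" using du frechet_derivative_works by blast
    have "?L h = gradient u x \<bullet> h" for h
    proof -
      have lin: "linear ?L" by (rule has_derivative_linear[OF L])
      have "?L h = ?L (\<Sum>i\<in>UNIV. h $ i *\<^sub>R axis i 1)"
        using basis_expansion[of h] by (simp add: scalar_mult_eq_scaleR)
      also have "\<dots> = (\<Sum>i\<in>UNIV. h $ i * partial_deriv i u x)"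
        using lin by (simp add: linear_sum linear_scale partial_deriv_def)
      finally show ?thesis by (simp add: gradient_def inner_vec_def mult.commute)
    qed
    then have "?L = (\<lambda>h. gradient u x \<bullet> h)" by (rule ext)
    with L show ?thesis by simp
  qed
  have c: "continuous_on UNIV (gradient u)"
    unfolding gradient_def[abs_def] by (intro continuous_on_vec_lambda cu)
  have z: "gradient u x = 0" if x: "x \<notin> K" for x
  proof -
    have "open (- K)" using K(1) by (simp add: compact_imp_closed open_Compl)
    moreover have "((\<lambda>x. 0::real) has_derivative (\<lambda>h. 0)) (at x)" by simp
    ultimately have "(u has_derivative (\<lambda>h. 0)) (at x)"
      using has_derivative_transform_within_open[of "\<lambda>x. 0" "\<lambda>h. 0" x UNIV "- K" u] x K(3) by auto
    from has_derivative_unique[OF d this] have "gradient u x \<bullet> gradient u x = 0" by (rule fun_cong)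
    then show ?thesis by simp
  qed
  show ?thesis unfolding compact_C1_def using K d c z by blast
qed

lemma set_integral_eq_integral:
  fixes f :: "'a \<Rightarrow> real"
  assumes "\<And>x. x \<notin> S \<Longrightarrow> f x = 0"
  shows "set_lebesgue_integral M S f = integral\<^sup>L M f"
  unfolding set_lebesgue_integral_def
  by (rule Bochner_Integration.integral_cong[OF refl]) (use assms in \<open>auto simp: indicator_def\<close>)

theorem lemma3:
  fixes n :: nat
  assumes "n = CARD('n::finite)" and "n \<ge> 3"
  shows "\<exists>C>0. \<forall>m::nat. \<forall>k::'n. \<forall>R>0. \<forall>u \<in> test_functions (half_ball k R).
    (LINT x:half_ball k R|lborel. (norm (gradient u x))\<^sup>2)
    \<ge> (real n)\<^sup>2 / 4 * (LINT x:half_ball k R|lborel. (u x)\<^sup>2 / (norm x)\<^sup>2)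
      + 1 / 4 * (\<Sum>i=1..m. LINT x:half_ball k R|lborel.
          (u x)\<^sup>2 / (norm x)\<^sup>2 * (\<Prod>j=1..i. (X j (norm x / (kappa * R)))\<^sup>2))
      + 1 / (16 * R powr (1 / 2)) *
          (LINT x:half_ball k R|lborel. (u x)\<^sup>2 / norm x powr (3 / 2))
      + C * (LINT x:half_ball k R|lborel.
          (\<Prod>j=1..m+1. X j (norm x / (kappa * R))) powr ((2 * real n - 2) / (real n - 2))
            * \<bar>u x\<bar> powr (2 * real n / (real n - 2))) powr ((real n - 2) / real n)"
proof -
  define p where "p = 2 * real n / (real n - 2)"
  define q where "q = (2 * real n - 2) / (real n - 2)"
  define e where "e = (real n - 2) / real n"
  have ex: "0 < p" "0 < q" "0 < e" "p * e = 2"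
    using assms(2) by (auto simp: p_def q_def e_def field_simps)
  have "real n = real CARD('n)" "real n \<ge> 3" using assms by auto
  from deficit_sobolev[OF this] obtain C where C: "0 < C"
    "\<And>m R U g (k :: 'n). compact_C1 (half_ball k R) U g \<Longrightarrow>
      (\<integral>x. Xprod (Suc m) (norm x / (kappa * R)) powr q * \<bar>U x\<bar> powr p \<partial>lborel) powr e \<le> C * deficit k R m U g"
    unfolding p_def q_def e_def by blast
  show ?thesis
  proof (intro exI[of _ "1 / (4 * C)"] conjI allI impI ballI)
    show "0 < 1 / (4 * C)" using C by simp
    fix m :: nat and k :: 'n and R :: real and u
    assume R: "0 < R" and u: "u \<in> test_functions (half_ball k R)"
    let ?S = "half_ball k R"
    define g where "g = gradient u"
    have U: "compact_C1 ?S u g" unfolding g_def by (rule test_function_compact_C1[OF u])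
    have off: "u x = 0" "g x = 0" if "x \<notin> ?S" for x using U that by (auto simp: compact_C1_def)
    obtain v h where v: "compact_C1 ?S v h" "\<And>x. \<bar>u x\<bar> \<le> 2 * \<bar>v x\<bar>"
      and dv: "deficit k R m v h \<le> (\<integral>x. (norm (g x - u x *\<^sub>R ground_field k R m (edge_slope R) x))\<^sup>2 \<partial>lborel)"
      using ground_state_substitution[OF U] by blast
    define Y where "Y r = Xprod (Suc m) (r / (kappa * R))" for r
    define I where "I = (\<integral>x. Y (norm x) powr q * \<bar>u x\<bar> powr p \<partial>lborel)"
    define J where "J = (\<integral>x. Y (norm x) powr q * \<bar>v x\<bar> powr p \<partial>lborel)"
    have I0: "0 \<le> I" "0 \<le> J" by (auto simp: I_def J_def)
    have cYq: "continuous_on {0<..<R} (\<lambda>r. Y r powr q)"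
    proof (intro continuous_on_powr' continuous_intros ballI conjI impI)
      show "continuous_on {0<..<R} Y" unfolding Y_def by (rule Xprod_scaled_continuous)
      fix r assume r: "r \<in> {0<..<R}"
      then have "0 < Y r" unfolding Y_def using scaled_radius_range[of r R] by (intro Xprod_pos) auto
      then show "0 \<le> Y r" by simp
      show "0 < q" by (rule ex)
    qed
    have "I \<le> (\<integral>x. 2 powr p * (Y (norm x) powr q * \<bar>v x\<bar> powr p) \<partial>lborel)"
      unfolding I_def
    proof (rule integral_mono)
      show "integrable lborel (\<lambda>x. Y (norm x) powr q * \<bar>u x\<bar> powr p)" by (rule integrable_abs_powr[OF U ex(1) cYq])
      show "integrable lborel (\<lambda>x. 2 powr p * (Y (norm x) powr q * \<bar>v x\<bar> powr p))"
        by (intro integrable_mult_right integrable_abs_powr[OF v(1) ex(1) cYq])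
      fix x
      have "\<bar>u x\<bar> powr p \<le> (2 * \<bar>v x\<bar>) powr p" using ex v(2) by (intro powr_mono2) auto
      then have "\<bar>u x\<bar> powr p \<le> 2 powr p * \<bar>v x\<bar> powr p" by (simp add: powr_mult)
      from mult_left_mono[OF this, of "Y (norm x) powr q"]
      show "Y (norm x) powr q * \<bar>u x\<bar> powr p \<le> 2 powr p * (Y (norm x) powr q * \<bar>v x\<bar> powr p)"
        by (simp add: mult_ac)
    qed
    then have "I \<le> 2 powr p * J" by (simp add: J_def)
    then have "I powr e \<le> (2 powr p * J) powr e" using I0 ex by (intro powr_mono2) auto
    also have "\<dots> = 4 * J powr e" using I0 ex(4) by (simp add: powr_mult powr_powr powr_numeral)
    also have "\<dots> \<le> 4 * (C * deficit k R m v h)" using C(2)[OF v(1), of m] by (simp add: J_def Y_def)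
    also have "\<dots> \<le> 4 * (C * (\<integral>x. (norm (g x - u x *\<^sub>R ground_field k R m (edge_slope R) x))\<^sup>2 \<partial>lborel))"
      using C(1) dv by (intro mult_left_mono) auto
    finally have *: "1 / (4 * C) * I powr e \<le> (\<integral>x. (norm (g x - u x *\<^sub>R ground_field k R m (edge_slope R) x))\<^sup>2 \<partial>lborel)"
      using C(1) by (simp add: field_simps)
    have S: "(LINT x:?S|lborel. (norm (gradient u x))\<^sup>2) = (\<integral>x. (norm (g x))\<^sup>2 \<partial>lborel)"
      "(LINT x:?S|lborel. (u x)\<^sup>2 / (norm x)\<^sup>2) = (\<integral>x. (u x)\<^sup>2 / (norm x)\<^sup>2 \<partial>lborel)"
      "\<And>f. (LINT x:?S|lborel. (u x)\<^sup>2 / (norm x)\<^sup>2 * f x) = (\<integral>x. (u x)\<^sup>2 / (norm x)\<^sup>2 * f x \<partial>lborel)"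
      "(LINT x:?S|lborel. (u x)\<^sup>2 / norm x powr (3 / 2)) = (\<integral>x. (u x)\<^sup>2 / norm x powr (3 / 2) \<partial>lborel)"
      "(LINT x:?S|lborel. (\<Prod>j=1..m+1. X j (norm x / (kappa * R))) powr q * \<bar>u x\<bar> powr p) = I"
      using off ex by (simp_all add: g_def I_def Y_def Xprod_def set_integral_eq_integral)
    show "(real n)\<^sup>2 / 4 * (LINT x:?S|lborel. (u x)\<^sup>2 / (norm x)\<^sup>2)
      + 1 / 4 * (\<Sum>i=1..m. LINT x:?S|lborel.
          (u x)\<^sup>2 / (norm x)\<^sup>2 * (\<Prod>j=1..i. (X j (norm x / (kappa * R)))\<^sup>2))
      + 1 / (16 * R powr (1 / 2)) *
          (LINT x:?S|lborel. (u x)\<^sup>2 / norm x powr (3 / 2))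
      + 1 / (4 * C) * (LINT x:?S|lborel.
          (\<Prod>j=1..m+1. X j (norm x / (kappa * R))) powr ((2 * real n - 2) / (real n - 2))
            * \<bar>u x\<bar> powr (2 * real n / (real n - 2))) powr ((real n - 2) / real n)
      \<le> (LINT x:?S|lborel. (norm (gradient u x))\<^sup>2)"
      unfolding p_def[symmetric] q_def[symmetric] e_def[symmetric] S
      using improved_hardy[OF U R, of m] * unfolding assms(1) by linarith
  qed
qed

end
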